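(* Let $\Omega\subset\mathbb{R}^n$ be open, bounded and connected with Lipschitz boundary, let $f$ be an appropriate function on $\Omega\times\mathbb{R}$, and let $I=[a,b]\supset\overline{\partial_2 f(\Omega,\mathbb{R})}$. Then the map $F:X=H^1_0(\Omega)\to Y=H^{-1}(\Omega)$, $F(u)=-\Delta u-f(\cdot,u)$, is flat with respect to the $I$-decompositions $X=W_X\oplus V_X$ and $Y=W_Y\oplus V_Y$.
   Context: $f:\Omega\times\mathbb{R}\to\mathbb{R}$ is appropriate if $f\in C^1(\Omega\times\mathbb{R})$, $\|f(\cdot,0)\|_{L^2(\Omega)}<\infty$ and $\|\partial_2 f\|_\infty<\infty$, where $\partial_2$ is the partial derivative in the second variable and $\|\cdot\|_\infty$ is the sup norm. $X=H^1_0(\Omega)$ carries the inner product $\langle u,v\rangle_1=\int_\Omega\nabla u\cdot\nabla v$. $Y=H^{-1}(\Omega)$ is its dual, with the dual norm and the inner product transported by the isometry $-\Delta:X\to Y$, $u\mapsto\langle u,\cdot\rangle_1$. An $L^2$ function $\phi$ is regarded as the element $z\mapsto\int_\Omega\phi z$ of $Y$. The map $F$ is understood weakly: $F(u)$ is the functional $z\mapsto\int_\Omega\nabla u\cdot\nabla z-\int_\Omega f(x,u(x))z(x)\,dx$. Let $0<\lambda_1\le\lambda_2\le\dots$ be the eigenvalues (with multiplicity) of the Dirichlet Laplacian $-\Delta_D$ on $\Omega$, with corresponding orthogonal eigenfunctions $\varphi_k$ (orthogonal in $L^2$, $H^1_0$ and $H^{-1}$). The $I$-index set is $\mathcal{I}=\{i:\lambda_i\in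 I\}$. The $I$-decompositions are given by $V_X=V_Y=\operatorname{Span}\{\varphi_i: i\in\mathcal{I}\}$ (as a subspace of $X$, respectively of $Y$), $W_X=V_X^\perp$ in $X$ and $W_Y=V_Y^\perp$ in $Y$. Let $P_Y:Y\to W_Y$ be the orthogonal projection. For $v\in V_X$ the projected restriction is $F_v:W_X\to W_Y$, $F_v(w)=P_YF(w+v)$. $F$ is flat with respect to the decompositions if $F$ is a $C^1$ map and, for every $v\in V_X$, $F_v$ is a ($C^1$) diffeomorphism from $W_X$ onto $W_Y$. *)

theory Defs
  imports "HOL-Analysis.Analysis"
begin

section \<open>Square-integrable functions up to equality almost everywhere\<close>

definition sq_integrable :: "('a::euclidean_space \<Rightarrow> 'b::euclidean_space) \<Rightarrow> bool" where
  "sq_integrable f \<longleftrightarrow> f \<in> borel_measurable lborel \<and> integrable lborel (\<lambda>x. (norm (f x))\<^sup>2)"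

lemma sq_integrable_zero [simp]: "sq_integrable (\<lambda>x. 0)"
  by (simp add: sq_integrable_def)

lemma sq_integrable_scaleR: "sq_integrable f \<Longrightarrow> sq_integrable (\<lambda>x. c *\<^sub>R f x)"
  by (auto simp: sq_integrable_def power_mult_distrib)

lemma sq_integrable_inner:
  assumes "sq_integrable f" "sq_integrable g"
  shows "integrable lborel (\<lambda>x. f x \<bullet> g x)"
proof (rule Bochner_Integration.integrable_bound)
  show "integrable lborel (\<lambda>x. (norm (f x))\<^sup>2 + (norm (g x))\<^sup>2)"
    using assms by (auto simp: sq_integrable_def)
  show "(\<lambda>x. f x \<bullet> g x) \<in> borel_measurable lborel"
    using assms by (auto simp: sq_integrable_def)
  have "norm (f x \<bullet> g x) \<le> (norm (f x))\<^sup>2 + (norm (g x))\<^sup>2" for x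
  proof -
    have "norm (f x \<bullet> g x) \<le> norm (f x) * norm (g x)"
      by (simp add: Cauchy_Schwarz_ineq2)
    also have "\<dots> \<le> (norm (f x))\<^sup>2 + (norm (g x))\<^sup>2"
      using sum_squares_bound[of "norm (f x)" "norm (g x)"]
        mult_nonneg_nonneg[OF norm_ge_zero norm_ge_zero, of "f x" "g x"] by linarith
    finally show ?thesis .
  qed
  then show "AE x in lborel. norm (f x \<bullet> g x) \<le> norm ((norm (f x))\<^sup>2 + (norm (g x))\<^sup>2)"
    by (auto intro!: AE_I2 order_trans[OF _ abs_ge_self])
qed

lemma sq_integrable_add:
  assumes "sq_integrable f" "sq_integrable g"
  shows "sq_integrable (\<lambda>x. f x + g x)"
proof -
  have eq: "(norm (f x + g x))\<^sup>2 = (norm (f x))\<^sup>2 + 2 * (f x \<bullet> g x) + (norm (g x))\<^sup>2" for x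
    by (simp add: power2_norm_eq_inner inner_add inner_commute)
  have "integrable lborel (\<lambda>x. (norm (f x + g x))\<^sup>2)"
    unfolding eq using assms sq_integrable_inner[OF assms]
    by (auto simp: sq_integrable_def)
  then show ?thesis using assms by (auto simp: sq_integrable_def)
qed

definition l2_eq :: "('a::euclidean_space \<Rightarrow> 'b::euclidean_space) \<Rightarrow> ('a \<Rightarrow> 'b) \<Rightarrow> bool" where
  "l2_eq f g \<longleftrightarrow> sq_integrable f \<and> sq_integrable g \<and> (AE x in lborel. f x = g x)"

quotient_type (overloaded) ('a, 'b) l2 = "'a::euclidean_space \<Rightarrow> 'b::euclidean_space"
  / partial: l2_eq
proof (rule part_equivpI)
  show "\<exists>f::'a \<Rightarrow> 'b. l2_eq f f"
    by (rule exI[of _ "\<lambda>x. 0"]) (simp add: l2_eq_def)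
  show "symp (l2_eq :: ('a \<Rightarrow> 'b) \<Rightarrow> _)"
    by (auto intro!: sympI simp: l2_eq_def)
  show "transp (l2_eq :: ('a \<Rightarrow> 'b) \<Rightarrow> _)"
    by (auto intro!: transpI simp: l2_eq_def)
qed

instantiation l2 :: (euclidean_space, euclidean_space) real_vector
begin

lift_definition zero_l2 :: "('a, 'b) l2" is "\<lambda>x. 0"
  by (simp add: l2_eq_def)

lift_definition plus_l2 :: "('a, 'b) l2 \<Rightarrow> ('a, 'b) l2 \<Rightarrow> ('a, 'b) l2" is "\<lambda>f g x. f x + g x"
  by (auto simp: l2_eq_def sq_integrable_add)

lift_definition scaleR_l2 :: "real \<Rightarrow> ('a, 'b) l2 \<Rightarrow> ('a, 'b) l2" is "\<lambda>c f x. c *\<^sub>R f x"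
  by (auto simp: l2_eq_def sq_integrable_scaleR)

definition uminus_l2 :: "('a, 'b) l2 \<Rightarrow> ('a, 'b) l2" where "uminus_l2 u = (-1) *\<^sub>R u"

definition minus_l2 :: "('a, 'b) l2 \<Rightarrow> ('a, 'b) l2 \<Rightarrow> ('a, 'b) l2" where "minus_l2 u v = u + (-1) *\<^sub>R v"

instance
proof
  fix u v w :: "('a, 'b) l2" and r s :: real
  show "u + v + w = u + (v + w)"
    by transfer (auto simp: l2_eq_def add.assoc intro!: sq_integrable_add)
  show "u + v = v + u"
    by transfer (auto simp: l2_eq_def add.commute intro!: sq_integrable_add)
  show "0 + u = u"
    by transfer (auto simp: l2_eq_def)
  show "- u + u = 0" unfolding uminus_l2_def
    by transfer (auto simp: l2_eq_def)
  show "u - v = u + - v" by (simp add: uminus_l2_def minus_l2_def)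
  show "r *\<^sub>R (u + v) = r *\<^sub>R u + r *\<^sub>R v"
    by transfer (auto simp: l2_eq_def scaleR_add_right intro!: sq_integrable_add sq_integrable_scaleR)
  show "(r + s) *\<^sub>R u = r *\<^sub>R u + s *\<^sub>R u"
    by transfer (auto simp: l2_eq_def scaleR_add_left intro!: sq_integrable_add sq_integrable_scaleR)
  show "r *\<^sub>R s *\<^sub>R u = (r * s) *\<^sub>R u"
    by transfer (auto simp: l2_eq_def intro!: sq_integrable_scaleR)
  show "1 *\<^sub>R u = u"
    by transfer (auto simp: l2_eq_def)
qed

end

instantiation l2 :: (euclidean_space, euclidean_space) real_inner
begin

lift_definition inner_l2 :: "('a, 'b) l2 \<Rightarrow> ('a, 'b) l2 \<Rightarrow> real" is
  "\<lambda>f g. \<integral>x. f x \<bullet> g x \<partial>lborel"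
  by (auto simp: l2_eq_def sq_integrable_def intro!: integral_cong_AE)

definition norm_l2 :: "('a, 'b) l2 \<Rightarrow> real" where "norm_l2 u = sqrt (u \<bullet> u)"

definition sgn_l2 :: "('a, 'b) l2 \<Rightarrow> ('a, 'b) l2" where "sgn_l2 u = u /\<^sub>R norm u"

definition dist_l2 :: "('a, 'b) l2 \<Rightarrow> ('a, 'b) l2 \<Rightarrow> real" where "dist_l2 u v = norm (u - v)"

definition uniformity_l2 :: "(('a, 'b) l2 \<times> ('a, 'b) l2) filter" where
  "uniformity_l2 = (INF e\<in>{0 <..}. principal {(u, v). dist u v < e})"

definition open_l2 :: "('a, 'b) l2 set \<Rightarrow> bool" where
  "open_l2 U \<longleftrightarrow> (\<forall>u\<in>U. eventually (\<lambda>(u', v). u' = u \<longrightarrow> v \<in> U) uniformity)"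

instance
proof
  fix u v w :: "('a, 'b) l2" and r :: real and U :: "('a, 'b) l2 set"
  show "dist u v = norm (u - v)" by (rule dist_l2_def)
  show "sgn u = u /\<^sub>R norm u" by (rule sgn_l2_def)
  show "(uniformity :: (('a, 'b) l2 \<times> ('a, 'b) l2) filter)
      = (INF e\<in>{0 <..}. principal {(u, v). dist u v < e})"
    by (rule uniformity_l2_def)
  show "open U \<longleftrightarrow> (\<forall>u\<in>U. eventually (\<lambda>(u', v). u' = u \<longrightarrow> v \<in> U) uniformity)"
    by (rule open_l2_def)
  show "u \<bullet> v = v \<bullet> u" by transfer (simp add: inner_commute)
  show "(u + v) \<bullet> w = u \<bullet> w + v \<bullet> w"
    by transfer (simp add: l2_eq_def inner_add_left sq_integrable_inner)
  show "(r *\<^sub>R u) \<bullet> v = r * (u \<bullet> v)" by transfer simp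
  show "0 \<le> u \<bullet> u" by transfer simp
  show "u \<bullet> u = 0 \<longleftrightarrow> u = 0"
  proof transfer
    fix f :: "'a \<Rightarrow> 'b" assume f: "l2_eq f f"
    then have "integrable lborel (\<lambda>x. f x \<bullet> f x)"
      by (simp add: l2_eq_def sq_integrable_inner)
    then have "(\<integral>x. f x \<bullet> f x \<partial>lborel) = 0 \<longleftrightarrow> (AE x in lborel. f x \<bullet> f x = 0)"
      by (intro integral_nonneg_eq_0_iff_AE) auto
    with f show "((\<integral>x. f x \<bullet> f x \<partial>lborel) = 0) = l2_eq f (\<lambda>x. 0)"
      by (simp add: l2_eq_def)
  qed
  show "norm u = sqrt (u \<bullet> u)" by (rule norm_l2_def)
qed

end

section \<open>Test functions and the graph of the gradient\<close>

text \<open>A function is smooth iff all its iterated directional derivatives are differentiable.\<close>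

coinductive smooth :: "('a::real_normed_vector \<Rightarrow> real) \<Rightarrow> bool" where
  smoothI: "\<lbrakk>\<forall>x. \<phi> differentiable (at x); \<forall>h. smooth (\<lambda>x. frechet_derivative \<phi> (at x) h)\<rbrakk>
    \<Longrightarrow> smooth \<phi>"

definition test_functions :: "'a::real_normed_vector set \<Rightarrow> ('a \<Rightarrow> real) set" where
  "test_functions \<Omega> = {\<phi>. smooth \<phi> \<and> (\<exists>K. compact K \<and> K \<subseteq> \<Omega> \<and> (\<forall>x. x \<notin> K \<longrightarrow> \<phi> x = 0))}"

text \<open>The pairs of a test function on \<open>\<Omega>\<close>, extended by zero, and its gradient.  The closure of this set
  in the product norm, which is the \<open>H\<^sup>1\<close> norm, is \<open>H\<^sup>1\<^sub>0(\<Omega>)\<close>, each function being accompanied by its weak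
  gradient.\<close>

definition test_pairs :: "(real^'n) set \<Rightarrow> ((real^'n, real) l2 \<times> (real^'n, real^'n) l2) set" where
  "test_pairs \<Omega> = {(abs_l2 \<phi>, abs_l2 g) |\<phi> g. \<phi> \<in> test_functions \<Omega> \<and> (\<forall>x. GDERIV \<phi> x :> g x)}"

lemma smooth_imp_continuous: "smooth \<phi> \<Longrightarrow> continuous_on UNIV \<phi>"
  by (auto elim!: smooth.cases
      intro!: continuous_at_imp_continuous_on differentiable_imp_continuous_within)

lemma smooth_zero [simp]: "smooth (\<lambda>x. 0)"
proof (rule smooth.coinduct[of "\<lambda>\<phi>. \<phi> = (\<lambda>x. 0)"])
  fix \<phi> :: "'a \<Rightarrow> real" assume "\<phi> = (\<lambda>x. 0)"
  moreover have "frechet_derivative (\<lambda>x. 0 :: real) (at x) = (\<lambda>h. 0)" for x :: 'a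
    by (rule frechet_derivative_const)
  ultimately show "\<exists>\<psi>. \<phi> = \<psi> \<and> (\<forall>x. \<psi> differentiable at x) \<and>
      (\<forall>h. (\<lambda>x. frechet_derivative \<psi> (at x) h) = (\<lambda>x. 0) \<or>
        smooth (\<lambda>x. frechet_derivative \<psi> (at x) h))"
    by (intro exI[of _ \<phi>]) simp
qed simp

lemma smooth_scaleR_add:
  assumes "smooth \<phi>" "smooth \<psi>"
  shows "smooth (\<lambda>x. c * \<phi> x + \<psi> x)"
proof (rule smooth.coinduct[of "\<lambda>\<rho>. \<exists>\<phi> \<psi>. smooth \<phi> \<and> smooth \<psi> \<and> \<rho> = (\<lambda>x. c * \<phi> x + \<psi> x)"])
  fix \<rho> :: "'a \<Rightarrow> real"
  assume "\<exists>\<phi> \<psi>. smooth \<phi> \<and> smooth \<psi> \<and> \<rho> = (\<lambda>x. c * \<phi> x + \<psi> x)"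
  then obtain \<phi> \<psi> where s: "smooth \<phi>" "smooth \<psi>" and \<rho>: "\<rho> = (\<lambda>x. c * \<phi> x + \<psi> x)"
    by blast
  let ?D = "\<lambda>x h. c * frechet_derivative \<phi> (at x) h + frechet_derivative \<psi> (at x) h"
  from s have d: "\<phi> differentiable (at x)" "\<psi> differentiable (at x)"
    and s': "smooth (\<lambda>x. frechet_derivative \<phi> (at x) h)" "smooth (\<lambda>x. frechet_derivative \<psi> (at x) h)"
    for x h by (blast elim: smooth.cases)+
  have D: "(\<rho> has_derivative ?D x) (at x)" for x
    unfolding \<rho>
    by (intro has_derivative_add has_derivative_mult_right frechet_derivative_works[THEN iffD1] d)
  have E: "frechet_derivative \<rho> (at x) = ?D x" for x
    by (rule frechet_derivative_at[OF D, symmetric])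
  show "\<exists>\<psi>. \<rho> = \<psi> \<and> (\<forall>x. \<psi> differentiable at x) \<and>
      (\<forall>h. (\<exists>\<phi>' \<psi>'. smooth \<phi>' \<and> smooth \<psi>' \<and>
          (\<lambda>x. frechet_derivative \<psi> (at x) h) = (\<lambda>x. c * \<phi>' x + \<psi>' x)) \<or>
        smooth (\<lambda>x. frechet_derivative \<psi> (at x) h))"
  proof (rule exI[of _ \<rho>], intro conjI allI disjI1 refl)
    show "\<rho> differentiable at x" for x using D by (rule differentiableI)
    show "\<exists>\<phi>' \<psi>'. smooth \<phi>' \<and> smooth \<psi>' \<and>
        (\<lambda>x. frechet_derivative \<rho> (at x) h) = (\<lambda>x. c * \<phi>' x + \<psi>' x)" for h
      unfolding E using s' by blast
  qed
qed (use assms in blast)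

lemma sq_integrable_continuous_compact:
  fixes g :: "'a::euclidean_space \<Rightarrow> 'b::euclidean_space"
  assumes "continuous_on UNIV g" "compact K" "\<And>x. x \<notin> K \<Longrightarrow> g x = 0"
  shows "sq_integrable g"
proof -
  have "integrable lborel (\<lambda>x. indicator K x *\<^sub>R (norm (g x))\<^sup>2)"
    using assms by (intro borel_integrable_compact) (auto intro!: continuous_intros intro: continuous_on_subset)
  moreover have "(\<lambda>x. indicator K x *\<^sub>R (norm (g x))\<^sup>2) = (\<lambda>x. (norm (g x))\<^sup>2)"
    using assms(3) by (auto simp: indicator_def fun_eq_iff)
  ultimately show ?thesis
    using assms(1) by (auto simp: sq_integrable_def borel_measurable_continuous_onI)
qed

lemma gradient_eq_frechet:
  fixes \<phi> :: "real^'n \<Rightarrow> real"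
  assumes "GDERIV \<phi> x :> g"
  shows "frechet_derivative \<phi> (at x) h = h \<bullet> g"
  using frechet_derivative_at[of \<phi> "\<lambda>h. h \<bullet> g" x] assms by (auto simp: gderiv_def fun_eq_iff)

lemma test_function_props:
  fixes \<phi> :: "real^'n \<Rightarrow> real"
  assumes \<phi>: "\<phi> \<in> test_functions \<Omega>" and g: "\<And>x. GDERIV \<phi> x :> g x"
  shows "continuous_on UNIV \<phi>" "continuous_on UNIV g" "sq_integrable \<phi>" "sq_integrable g"
proof -
  from \<phi> obtain K where s: "smooth \<phi>" and K: "compact K" "\<And>x. x \<notin> K \<Longrightarrow> \<phi> x = 0"
    by (auto simp: test_functions_def)
  show c: "continuous_on UNIV \<phi>" using s by (rule smooth_imp_continuous)
  have ch: "continuous_on UNIV (\<lambda>x. h \<bullet> g x)" for h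
  proof -
    have "smooth (\<lambda>x. frechet_derivative \<phi> (at x) h)"
      using s by (cases rule: smooth.cases) blast
    then show ?thesis
      by (auto dest!: smooth_imp_continuous simp: gradient_eq_frechet[OF g])
  qed
  have ch': "continuous_on UNIV (\<lambda>x. g x \<bullet> h)" for h
    using ch[of h] by (subst inner_commute)
  have "continuous_on UNIV (\<lambda>x. \<Sum>b\<in>Basis. (g x \<bullet> b) *\<^sub>R b)"
    by (intro continuous_on_sum continuous_on_scaleR ch' continuous_on_const)
  then show cg: "continuous_on UNIV g"
    by (simp add: euclidean_representation)
  show "sq_integrable \<phi>" by (rule sq_integrable_continuous_compact[OF c K])
  have "g x = 0" if "x \<notin> K" for x
  proof -
    have "open (- K)" using K(1) by (simp add: compact_imp_closed open_Compl)
    moreover have "((\<lambda>x. 0) has_derivative (\<lambda>h. 0)) (at x)" by simp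
    ultimately have "(\<phi> has_derivative (\<lambda>h. 0)) (at x)"
      using that K(2) has_derivative_transform_within_open[of "\<lambda>x. 0" "\<lambda>h. 0" x UNIV "- K" \<phi>]
      by simp
    from has_derivative_unique[OF g[unfolded gderiv_def, of x] this]
    have "g x \<bullet> g x = 0" by (rule fun_cong)
    then show ?thesis by simp
  qed
  then show "sq_integrable g"
    by (rule sq_integrable_continuous_compact[OF cg K(1)])
qed

lemma abs_l2_scaleR_add:
  assumes "sq_integrable f" "sq_integrable g"
  shows "abs_l2 (\<lambda>x. c *\<^sub>R f x + g x) = c *\<^sub>R abs_l2 f + abs_l2 g"
  using assms plus_l2.abs_eq scaleR_l2.abs_eq
  by (simp add: l2_eq_def plus_l2.abs_eq scaleR_l2.abs_eq sq_integrable_scaleR)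

lemma test_pairs_zero: "0 \<in> test_pairs \<Omega>"
proof -
  have "(\<lambda>x. 0) \<in> test_functions \<Omega>"
    by (auto simp: test_functions_def intro!: exI[of _ "{}"])
  moreover have "GDERIV (\<lambda>x. 0) x :> 0" for x :: "real^'n" by (rule GDERIV_const)
  ultimately show ?thesis
    unfolding test_pairs_def zero_prod_def zero_l2_def by blast
qed

lemma test_pairs_scaleR_add:
  assumes "p \<in> test_pairs \<Omega>" "q \<in> test_pairs \<Omega>"
  shows "c *\<^sub>R p + q \<in> test_pairs \<Omega>"
proof -
  from assms obtain \<phi> g \<psi> k where p: "p = (abs_l2 \<phi>, abs_l2 g)" "\<phi> \<in> test_functions \<Omega>"
      "\<And>x. GDERIV \<phi> x :> g x"
    and q: "q = (abs_l2 \<psi>, abs_l2 k)" "\<psi> \<in> test_functions \<Omega>" "\<And>x. GDERIV \<psi> x :> k x"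
    unfolding test_pairs_def by blast
  note props = test_function_props[OF p(2,3)] test_function_props[OF q(2,3)]
  let ?\<rho> = "\<lambda>x. c * \<phi> x + \<psi> x"
  from p(2) q(2) obtain K L where K: "compact K" "K \<subseteq> \<Omega>" "\<And>x. x \<notin> K \<Longrightarrow> \<phi> x = 0"
    and L: "compact L" "L \<subseteq> \<Omega>" "\<And>x. x \<notin> L \<Longrightarrow> \<psi> x = 0"
    and s: "smooth \<phi>" "smooth \<psi>"
    unfolding test_functions_def by blast
  have "compact (K \<union> L)" "K \<union> L \<subseteq> \<Omega>" "\<forall>x. x \<notin> K \<union> L \<longrightarrow> ?\<rho> x = 0"
    using K L by auto
  with smooth_scaleR_add[OF s] have "?\<rho> \<in> test_functions \<Omega>"
    unfolding test_functions_def by blast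
  moreover have "GDERIV ?\<rho> x :> (c *\<^sub>R g x + k x)" for x
    using p(3)[of x] q(3)[of x] unfolding gderiv_def inner_add_right inner_scaleR_right
    by (intro has_derivative_add has_derivative_mult_right)
  moreover have "c *\<^sub>R p + q = (abs_l2 ?\<rho>, abs_l2 (\<lambda>x. c *\<^sub>R g x + k x))"
    using props by (simp add: p(1) q(1) abs_l2_scaleR_add[symmetric])
  ultimately show ?thesis unfolding test_pairs_def by blast
qed

lemma subspace_closure_test_pairs: "subspace (closure (test_pairs \<Omega>))"
proof -
  have "subspace (test_pairs \<Omega>)"
    unfolding subspace_def
  proof (intro conjI allI ballI)
    show "0 \<in> test_pairs \<Omega>" by (rule test_pairs_zero)
  next
    fix p q assume "p \<in> test_pairs \<Omega>" "q \<in> test_pairs \<Omega>"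
    from test_pairs_scaleR_add[OF this, of 1] show "p + q \<in> test_pairs \<Omega>" by simp
  next
    fix c p assume "p \<in> test_pairs \<Omega>"
    from test_pairs_scaleR_add[OF this test_pairs_zero, of c] show "c *\<^sub>R p \<in> test_pairs \<Omega>" by simp
  qed
  note sub = this
  show ?thesis
    unfolding subspace_def
  proof (intro conjI allI ballI)
    show "0 \<in> closure (test_pairs \<Omega>)" using test_pairs_zero closure_subset by blast
  next
    fix p q assume "p \<in> closure (test_pairs \<Omega>)" "q \<in> closure (test_pairs \<Omega>)"
    then obtain P Q where "\<And>n. P n \<in> test_pairs \<Omega>" "P \<longlonglongrightarrow> p" "\<And>n. Q n \<in> test_pairs \<Omega>" "Q \<longlonglongrightarrow> q"
      unfolding closure_sequential by blast
    then have "\<forall>n. P n + Q n \<in> test_pairs \<Omega>" "(\<lambda>n. P n + Q n) \<longlonglongrightarrow> p + q"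
      using subspace_add[OF sub] tendsto_add by blast+
    then show "p + q \<in> closure (test_pairs \<Omega>)"
      unfolding closure_sequential by (intro exI[of _ "\<lambda>n. P n + Q n"] conjI)
  next
    fix c p assume "p \<in> closure (test_pairs \<Omega>)"
    then obtain P where "\<And>n. P n \<in> test_pairs \<Omega>" "P \<longlonglongrightarrow> p"
      unfolding closure_sequential by blast
    then have "\<forall>n. c *\<^sub>R P n \<in> test_pairs \<Omega>" "(\<lambda>n. c *\<^sub>R P n) \<longlonglongrightarrow> c *\<^sub>R p"
      using subspace_scale[OF sub] tendsto_scaleR[OF tendsto_const] by blast+
    then show "c *\<^sub>R p \<in> closure (test_pairs \<Omega>)"
      unfolding closure_sequential by (intro exI[of _ "\<lambda>n. c *\<^sub>R P n"] conjI)
  qed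
qed

lemma AE_lborel_shift:
  fixes h :: "'a::euclidean_space"
  assumes "AE x in lborel. P x" "{x. P x} \<in> sets borel"
  shows "AE x in lborel. P (x + h)"
proof -
  have "AE x in distr lborel borel ((+) h). P x"
    unfolding lborel_distr_plus by (rule assms(1))
  then have "AE x in lborel. P (h + x)"
    using assms(2) by (subst (asm) AE_distr_iff) auto
  then show ?thesis by (simp add: add.commute)
qed

lemma integrable_lborel_shift:
  fixes f :: "'a::euclidean_space \<Rightarrow> 'b::{banach, second_countable_topology}"
  assumes "integrable lborel f"
  shows "integrable lborel (\<lambda>x. f (x + h))"
proof -
  have "integrable (distr lborel borel ((+) h)) f"
    using assms by (simp add: lborel_distr_plus)
  then have "integrable lborel (\<lambda>x. f (h + x))"
    using assms by (subst (asm) integrable_distr_eq) auto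
  then show ?thesis by (simp add: add.commute)
qed

lemma integral_lborel_shift:
  fixes f :: "'a::euclidean_space \<Rightarrow> 'b::{banach, second_countable_topology}"
  assumes "f \<in> borel_measurable borel"
  shows "(\<integral>x. f (x + h) \<partial>lborel) = (\<integral>x. f x \<partial>lborel)"
proof -
  have "(\<integral>x. f x \<partial>lborel) = (\<integral>x. f x \<partial>distr lborel borel ((+) h))"
    by (simp add: lborel_distr_plus)
  also have "\<dots> = (\<integral>x. f (h + x) \<partial>lborel)"
    using assms by (subst integral_distr) auto
  finally show ?thesis by (simp add: add.commute)
qed

lemma nn_integral_lborel_shift:
  fixes f :: "'a::euclidean_space \<Rightarrow> ennreal"
  assumes "f \<in> borel_measurable borel"
  shows "(\<integral>\<^sup>+x. f (x + h) \<partial>lborel) = (\<integral>\<^sup>+x. f x \<partial>lborel)"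
proof -
  have "(\<integral>\<^sup>+x. f x \<partial>lborel) = (\<integral>\<^sup>+x. f x \<partial>distr lborel borel ((+) h))"
    by (simp add: lborel_distr_plus)
  also have "\<dots> = (\<integral>\<^sup>+x. f (h + x) \<partial>lborel)"
    using assms by (subst nn_integral_distr) auto
  finally show ?thesis by (simp add: add.commute)
qed

lemma sq_integrable_shift:
  assumes "sq_integrable f"
  shows "sq_integrable (\<lambda>x. f (x + h))"
proof -
  have "f \<in> borel_measurable borel" using assms by (simp add: sq_integrable_def)
  then have "(\<lambda>x. f (x + h)) \<in> borel_measurable borel" by measurable
  with assms integrable_lborel_shift[of "\<lambda>x. (norm (f x))\<^sup>2" h] show ?thesis
    by (simp add: sq_integrable_def)
qed

lift_definition shift_l2 :: "'a::euclidean_space \<Rightarrow> ('a, 'b::euclidean_space) l2 \<Rightarrow> ('a, 'b) l2" is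
  "\<lambda>h f x. f (x + h)"
proof -
  fix h :: 'a and f g :: "'a \<Rightarrow> 'b" assume fg: "l2_eq f g"
  then have [measurable]: "f \<in> borel_measurable borel" "g \<in> borel_measurable borel"
    by (auto simp: l2_eq_def sq_integrable_def)
  have "{x. f x = g x} \<in> sets borel" by measurable
  with fg AE_lborel_shift[of "\<lambda>x. f x = g x" h]
  show "l2_eq (\<lambda>x. f (x + h)) (\<lambda>x. g (x + h))"
    by (simp add: l2_eq_def sq_integrable_shift)
qed

lemma bounded_linear_shift_l2:
  "bounded_linear (shift_l2 h :: ('a::euclidean_space, 'b::euclidean_space) l2 \<Rightarrow> ('a, 'b) l2)"
proof (rule bounded_linear_intro[where K = 1])
  fix u v :: "('a, 'b) l2" and c :: real
  show "shift_l2 h (u + v) = shift_l2 h u + shift_l2 h v"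
    by transfer (simp add: l2_eq_def sq_integrable_add sq_integrable_shift)
  show "shift_l2 h (c *\<^sub>R u) = c *\<^sub>R shift_l2 h u"
    by transfer (simp add: l2_eq_def sq_integrable_scaleR sq_integrable_shift)
  have "shift_l2 h u \<bullet> shift_l2 h u = u \<bullet> u"
  proof transfer
    fix h and f :: "'a \<Rightarrow> 'b" assume "l2_eq f f"
    then have "(\<lambda>x. f x \<bullet> f x) \<in> borel_measurable borel"
      by (auto simp: l2_eq_def sq_integrable_def)
    from integral_lborel_shift[OF this, of h]
    show "(\<integral>x. f (x + h) \<bullet> f (x + h) \<partial>lborel) = (\<integral>x. f x \<bullet> f x \<partial>lborel)" .
  qed
  then show "norm (shift_l2 h u) \<le> norm u * 1"
    by (simp add: norm_eq_sqrt_inner)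
qed

lemma norm_abs_l2:
  assumes "sq_integrable f"
  shows "(norm (abs_l2 f))\<^sup>2 = (\<integral>x. (norm (f x))\<^sup>2 \<partial>lborel)"
    and "ennreal ((norm (abs_l2 f))\<^sup>2) = (\<integral>\<^sup>+x. ennreal ((norm (f x))\<^sup>2) \<partial>lborel)"
proof -
  show *: "(norm (abs_l2 f))\<^sup>2 = (\<integral>x. (norm (f x))\<^sup>2 \<partial>lborel)"
    using assms by (simp add: power2_norm_eq_inner inner_l2.abs_eq l2_eq_def)
  show "ennreal ((norm (abs_l2 f))\<^sup>2) = (\<integral>\<^sup>+x. ennreal ((norm (f x))\<^sup>2) \<partial>lborel)"
    unfolding * using assms by (intro nn_integral_eq_integral[symmetric]) (auto simp: sq_integrable_def)
qed

lemma difference_quotient_bound: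
  fixes \<phi> :: "real^'n \<Rightarrow> real"
  assumes g: "\<And>x. GDERIV \<phi> x :> g x" and cg: "continuous_on UNIV g"
  shows "ennreal ((norm (\<phi> (x + h) - \<phi> x))\<^sup>2)
    \<le> (\<integral>\<^sup>+t. indicator {0..1} t * ennreal ((norm h * norm (g (x + t *\<^sub>R h)))\<^sup>2) \<partial>lborel)"
proof -
  define k where "k t = h \<bullet> g (x + t *\<^sub>R h)" for t :: real
  define m where "m = \<phi> (x + h) - \<phi> x"
  have ck: "continuous_on UNIV k"
    unfolding k_def by (intro continuous_intros continuous_on_compose2[OF cg]) auto
  have dk: "DERIV (\<lambda>t. \<phi> (x + t *\<^sub>R h)) t :> k t" for t
  proof -
    have "((\<lambda>t. x + t *\<^sub>R h) has_derivative (\<lambda>s. s *\<^sub>R h)) (at t)"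
      by (auto intro!: derivative_eq_intros)
    from has_derivative_compose[OF this g[unfolded gderiv_def]]
    have "((\<lambda>t. \<phi> (x + t *\<^sub>R h)) has_derivative (\<lambda>s. (s *\<^sub>R h) \<bullet> g (x + t *\<^sub>R h))) (at t)" .
    moreover have "(\<lambda>s. (s *\<^sub>R h) \<bullet> g (x + t *\<^sub>R h)) = (*) (k t)"
      by (simp add: fun_eq_iff k_def)
    ultimately show ?thesis by (simp add: has_field_derivative_def)
  qed
  have int: "integrable lborel (\<lambda>t. indicator {0..1} t *\<^sub>R q t)" if "continuous_on UNIV q" for q :: "real \<Rightarrow> real"
    using that by (intro borel_integrable_compact) (auto intro: continuous_on_subset)
  have ik: "integrable lborel (\<lambda>t. indicator {0..1} t *\<^sub>R k t)"
    by (rule int[OF ck])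
  have ik2: "integrable lborel (\<lambda>t. indicator {0..1} t *\<^sub>R (k t)\<^sup>2)"
    by (rule int[OF continuous_on_power[OF ck]])
  have i1: "integrable lborel (\<lambda>t::real. indicator {0..1} t *\<^sub>R (1 :: real))"
    by (rule int[OF continuous_on_const])
  have m: "(\<integral>t. indicator {0..1} t *\<^sub>R k t \<partial>lborel) = m"
  proof -
    have "(\<integral>t. indicator {0..1} t *\<^sub>R k t \<partial>lborel) = \<phi> (x + 1 *\<^sub>R h) - \<phi> (x + 0 *\<^sub>R h)"
      by (rule integral_FTC_Icc)
        (use dk ck in \<open>auto simp: has_real_derivative_iff_has_vector_derivative[symmetric]
          intro: continuous_on_subset has_field_derivative_at_within\<close>)
    then show ?thesis by (simp add: m_def)
  qed
  have "0 \<le> (\<integral>t. indicator {0..1} t *\<^sub>R (k t - m)\<^sup>2 \<partial>lborel)"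
    by (intro integral_nonneg_AE AE_I2) auto
  also have "\<dots> = (\<integral>t. indicator {0..1} t *\<^sub>R (k t)\<^sup>2 - 2 * m * (indicator {0..1} t *\<^sub>R k t)
      + m\<^sup>2 * (indicator {0..1} t *\<^sub>R 1) \<partial>lborel)"
    by (intro Bochner_Integration.integral_cong) (auto simp: power2_eq_square algebra_simps)
  also have "\<dots> = (\<integral>t. indicator {0..1} t *\<^sub>R (k t)\<^sup>2 \<partial>lborel) - 2 * m * m
      + m\<^sup>2 * (\<integral>t. indicator {0..1} t *\<^sub>R (1::real) \<partial>(lborel :: real measure))"
    using ik ik2 i1
    by (simp only: Bochner_Integration.integral_add Bochner_Integration.integral_diff
        Bochner_Integration.integrable_diff integrable_mult_right integral_mult_right_zero m)
  also have "(\<integral>t. indicator {0..1} t *\<^sub>R (1::real) \<partial>(lborel :: real measure)) = 1"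
    by simp
  finally have "m\<^sup>2 \<le> (\<integral>t. indicator {0..1} t *\<^sub>R (k t)\<^sup>2 \<partial>lborel)"
    by (simp add: power2_eq_square)
  then have "ennreal (m\<^sup>2) \<le> ennreal (\<integral>t. indicator {0..1} t *\<^sub>R (k t)\<^sup>2 \<partial>lborel)"
    by (rule ennreal_leI)
  also have "\<dots> = (\<integral>\<^sup>+t. ennreal (indicator {0..1} t *\<^sub>R (k t)\<^sup>2) \<partial>lborel)"
    by (intro nn_integral_eq_integral[symmetric] ik2 AE_I2) auto
  also have "\<dots> \<le> (\<integral>\<^sup>+t. indicator {0..1} t * ennreal ((norm h * norm (g (x + t *\<^sub>R h)))\<^sup>2) \<partial>lborel)"
  proof (rule nn_integral_mono)
    fix t :: real
    have "(k t)\<^sup>2 \<le> (norm h * norm (g (x + t *\<^sub>R h)))\<^sup>2"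
      unfolding k_def by (rule power2_le_iff_abs_le[THEN iffD2]) (auto simp: Cauchy_Schwarz_ineq2)
    then show "ennreal (indicator {0..1} t *\<^sub>R (k t)\<^sup>2)
        \<le> indicator {0..1} t * ennreal ((norm h * norm (g (x + t *\<^sub>R h)))\<^sup>2)"
      by (auto simp: indicator_def intro: ennreal_leI)
  qed
  finally show ?thesis by (simp add: m_def)
qed

lemma test_pairs_shift:
  fixes \<Omega> :: "(real^'n) set"
  assumes "p \<in> test_pairs \<Omega>"
  shows "norm (shift_l2 h (fst p) - fst p) \<le> norm h * norm (snd p)"
proof -
  from assms obtain \<phi> g where p: "p = (abs_l2 \<phi>, abs_l2 g)" "\<phi> \<in> test_functions \<Omega>"
      and g: "\<And>x. GDERIV \<phi> x :> g x"
    unfolding test_pairs_def by blast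
  note props = test_function_props[OF p(2) g]
  have [measurable]: "g \<in> borel_measurable borel"
    using props by (simp add: sq_integrable_def)
  have sq: "sq_integrable (\<lambda>x. \<phi> (x + h))" by (rule sq_integrable_shift[OF props(3)])
  have eq: "shift_l2 h (abs_l2 \<phi>) - abs_l2 \<phi> = abs_l2 (\<lambda>x. \<phi> (x + h) - \<phi> x)"
  proof -
    have "abs_l2 (\<lambda>x. (-1) *\<^sub>R \<phi> x + \<phi> (x + h)) = (-1) *\<^sub>R abs_l2 \<phi> + abs_l2 (\<lambda>x. \<phi> (x + h))"
      by (rule abs_l2_scaleR_add[OF props(3) sq])
    moreover have "shift_l2 h (abs_l2 \<phi>) = abs_l2 (\<lambda>x. \<phi> (x + h))"
      using props(3) by (simp add: shift_l2.abs_eq l2_eq_def)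
    ultimately show ?thesis by simp
  qed
  have sqd: "sq_integrable (\<lambda>x. \<phi> (x + h) - \<phi> x)"
    using sq_integrable_add[OF sq sq_integrable_scaleR[OF props(3), of "-1"]] by simp
  let ?G = "\<lambda>x t. indicator {0..1::real} t * ennreal ((norm h * norm (g (x + t *\<^sub>R h)))\<^sup>2)"
  have "ennreal ((norm (abs_l2 (\<lambda>x. \<phi> (x + h) - \<phi> x)))\<^sup>2)
      = (\<integral>\<^sup>+x. ennreal ((norm (\<phi> (x + h) - \<phi> x))\<^sup>2) \<partial>lborel)"
    by (rule norm_abs_l2(2)[OF sqd])
  also have "\<dots> \<le> (\<integral>\<^sup>+x. (\<integral>\<^sup>+t. ?G x t \<partial>lborel) \<partial>lborel)"
    by (intro nn_integral_mono difference_quotient_bound[OF g props(2)])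
  also have "\<dots> = (\<integral>\<^sup>+t. (\<integral>\<^sup>+x. ?G x t \<partial>lborel) \<partial>lborel)"
    by (rule lborel_pair.Fubini') measurable
  also have "\<dots> = (\<integral>\<^sup>+t. indicator {0..1} t * ennreal ((norm h * norm (abs_l2 g))\<^sup>2) \<partial>(lborel :: real measure))"
  proof (rule nn_integral_cong)
    fix t :: real
    have "(\<integral>\<^sup>+x. ?G x t \<partial>lborel)
        = indicator {0..1} t * (\<integral>\<^sup>+x. ennreal ((norm h)\<^sup>2) * ennreal ((norm (g (x + t *\<^sub>R h)))\<^sup>2) \<partial>lborel)"
      by (subst nn_integral_cmult[symmetric]) (auto simp: power_mult_distrib ennreal_mult)
    also have "\<dots> = indicator {0..1} t * (ennreal ((norm h)\<^sup>2) * (\<integral>\<^sup>+x. ennreal ((norm (g x))\<^sup>2) \<partial>lborel))"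
      by (subst nn_integral_cmult, measurable)
        (subst nn_integral_lborel_shift[where f = "\<lambda>x. ennreal ((norm (g x))\<^sup>2)"], auto)
    also have "\<dots> = indicator {0..1} t * ennreal ((norm h * norm (abs_l2 g))\<^sup>2)"
      by (simp add: norm_abs_l2(2)[OF props(4), symmetric] power_mult_distrib ennreal_mult)
    finally show "(\<integral>\<^sup>+x. ?G x t \<partial>lborel)
        = indicator {0..1} t * ennreal ((norm h * norm (abs_l2 g))\<^sup>2)" .
  qed
  also have "\<dots> = ennreal ((norm h * norm (abs_l2 g))\<^sup>2)"
    by (subst nn_integral_multc) auto
  finally have "(norm (abs_l2 (\<lambda>x. \<phi> (x + h) - \<phi> x)))\<^sup>2 \<le> (norm h * norm (abs_l2 g))\<^sup>2"
    by (simp add: ennreal_le_iff)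
  then have "norm (abs_l2 (\<lambda>x. \<phi> (x + h) - \<phi> x)) \<le> norm h * norm (abs_l2 g)"
    by (rule power2_le_imp_le) simp
  then show ?thesis by (simp add: p(1) eq)
qed

lemma shift_invariant_l2_eq_0:
  fixes u :: "('a::euclidean_space, 'b::euclidean_space) l2"
  assumes "\<And>h. shift_l2 h u = u"
  shows "u = 0"
proof -
  obtain f where u: "u = abs_l2 f" and sq: "sq_integrable f"
  proof
    show "u = abs_l2 (rep_l2 u)" by (rule Quotient3_abs_rep[OF Quotient3_l2, symmetric])
    show "sq_integrable (rep_l2 u)"
      using Quotient3_rep_reflp[OF Quotient3_l2, of u] by (simp add: l2_eq_def)
  qed
  have [measurable]: "f \<in> borel_measurable borel" using sq by (simp add: sq_integrable_def)
  have inv: "AE x in lborel. f (x + h) = f x" for h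
  proof -
    have "abs_l2 (\<lambda>x. f (x + h)) = abs_l2 f"
      using assms[of h] sq by (simp add: u shift_l2.abs_eq l2_eq_def)
    then have "l2_eq (\<lambda>x. f (x + h)) f"
      using sq Quotient3_rel[OF Quotient3_l2, of "\<lambda>x. f (x + h)" f]
      by (auto simp: l2_eq_def sq_integrable_shift)
    then show ?thesis by (simp add: l2_eq_def)
  qed
  let ?n = "\<lambda>x. ennreal ((norm (f x))\<^sup>2)"
  have ball: "(\<integral>\<^sup>+x. ?n x * indicator (ball c r) x \<partial>lborel) = (\<integral>\<^sup>+x. ?n x * indicator (ball 0 r) x \<partial>lborel)" for c r
  proof -
    have "(\<integral>\<^sup>+x. ?n x * indicator (ball c r) x \<partial>lborel)
        = (\<integral>\<^sup>+x. ?n (x + c) * indicator (ball c r) (x + c) \<partial>lborel)"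
      by (rule nn_integral_lborel_shift[symmetric])
        (intro borel_measurable_times_ennreal borel_measurable_indicator, simp_all)
    also have "\<dots> = (\<integral>\<^sup>+x. ?n x * indicator (ball 0 r) x \<partial>lborel)"
      using inv[of c] by (intro nn_integral_cong_AE) (auto simp: indicator_def dist_norm)
    finally show ?thesis .
  qed
  have zero: "(\<integral>\<^sup>+x. ?n x * indicator (ball 0 r) x \<partial>lborel) = 0" if r: "r > 0" for r
  proof -
    obtain e :: 'a where e: "norm e = 1" using norm_Basis[OF SOME_Basis] by blast
    define C where "C k = ball ((3 * r * real k) *\<^sub>R e) r" for k :: nat
    have disj: "disjoint_family C"
      unfolding disjoint_family_on_def
    proof (intro ballI impI)
      fix i j :: nat assume "i \<noteq> j"
      then have "1 \<le> \<bar>real i - real j\<bar>" by linarith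
      then have "3 * r * 1 \<le> 3 * r * \<bar>real i - real j\<bar>" using r by (intro mult_left_mono) auto
      also have "\<dots> = dist ((3 * r * real i) *\<^sub>R e) ((3 * r * real j) *\<^sub>R e)"
        using r e by (simp add: dist_norm scaleR_diff_left[symmetric] right_diff_distrib[symmetric] abs_mult
            del: scaleR_left.diff)
      finally have "r + r \<le> dist ((3 * r * real i) *\<^sub>R e) ((3 * r * real j) *\<^sub>R e)" using r by simp
      then show "C i \<inter> C j = {}" unfolding C_def by (rule disjoint_ballI)
    qed
    let ?m = "\<integral>\<^sup>+x. ?n x * indicator (ball 0 r) x \<partial>lborel"
    have "(\<Sum>k. ?m) = (\<Sum>k. \<integral>\<^sup>+x. ?n x * indicator (C k) x \<partial>lborel)"
      unfolding C_def by (intro arg_cong[of _ _ suminf] ext ball[symmetric])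
    also have "\<dots> = (\<integral>\<^sup>+x. ?n x * indicator (\<Union>k. C k) x \<partial>lborel)"
      by (intro nn_integral_disjoint_family[symmetric] disj) (auto simp: C_def)
    also have "\<dots> \<le> (\<integral>\<^sup>+x. ?n x \<partial>lborel)"
      by (intro nn_integral_mono) (auto simp: indicator_def)
    also have "\<dots> < \<infinity>"
      unfolding norm_abs_l2(2)[OF sq, symmetric] by simp
    finally obtain b where b: "0 \<le> b" "(\<Sum>k::nat. ?m) = ennreal b"
      by (cases "\<Sum>k::nat. ?m") auto
    have le: "of_nat N * ?m \<le> ennreal b" for N
      using sum_le_suminf[OF summableI, of "{..<N}" "\<lambda>k. ?m"] b by simp
    from le[of 1] obtain a where a: "0 \<le> a" "?m = ennreal a"
      by (cases ?m) (auto simp: top_unique)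
    have "real N * a \<le> b" for N
      using le[of N] a b by (simp add: ennreal_of_nat_eq_real_of_nat ennreal_mult[symmetric])
    then have "\<not> 0 < a" using reals_Archimedean3[of a] by (meson not_le)
    then show ?thesis using a by simp
  qed
  have "AE x in lborel. x \<in> ball 0 (real (Suc k)) \<longrightarrow> f x = 0" for k
  proof -
    have "AE x in lborel. ?n x * indicator (ball 0 (real (Suc k))) x = 0"
      by (subst nn_integral_0_iff_AE[symmetric])
        (auto intro!: zero borel_measurable_times_ennreal borel_measurable_indicator)
    then show ?thesis by eventually_elim (auto simp: indicator_def)
  qed
  then have "AE x in lborel. \<forall>k. x \<in> ball 0 (real (Suc k)) \<longrightarrow> f x = 0"
    by (subst AE_all_countable) blast
  then have "AE x in lborel. f x = 0"
  proof eventually_elim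
    case (elim x)
    obtain k where "norm x < real k" using reals_Archimedean2 by blast
    then have "x \<in> ball 0 (real (Suc k))" by simp
    with elim show ?case by blast
  qed
  then show ?thesis
    unfolding u zero_l2_def using sq
    by (intro Quotient3_rel_abs[OF Quotient3_l2]) (simp add: l2_eq_def)
qed

lemma closure_test_pairs_gradient_0:
  fixes \<Omega> :: "(real^'n) set"
  assumes p: "p \<in> closure (test_pairs \<Omega>)" and 0: "snd p = 0"
  shows "p = 0"
proof -
  have "shift_l2 h (fst p) = fst p" for h
  proof -
    let ?S = "{p :: (real^'n, real) l2 \<times> (real^'n, real^'n) l2.
      norm (shift_l2 h (fst p) - fst p) \<le> norm h * norm (snd p)}"
    have "closed ?S"
      by (intro closed_Collect_le continuous_intros
          bounded_linear.continuous_on[OF bounded_linear_shift_l2])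
    moreover have "test_pairs \<Omega> \<subseteq> ?S" using test_pairs_shift by blast
    ultimately have "p \<in> ?S" using p closure_minimal by blast
    with 0 show ?thesis by simp
  qed
  then have "fst p = 0" by (rule shift_invariant_l2_eq_0)
  with 0 show ?thesis by (simp add: prod_eq_iff)
qed


section \<open>The Sobolev space on the whole space with the Dirichlet inner product\<close>

text \<open>The type is \<open>H\<^sup>1(\<real>\<^sup>n)\<close>, the closure of the test functions on \<open>\<real>\<^sup>n\<close>.  Its inner product is
  \<open>\<integral>\<nabla>u \<bullet> \<nabla>v\<close>, not the full \<open>H\<^sup>1\<close> inner product; it is definite because no non-zero
  square-integrable function on \<open>\<real>\<^sup>n\<close> has zero gradient.  So the library's norm, topology and
  derivative on this type are those of \<open>\<langle>\<cdot>,\<cdot>\<rangle>\<^sub>1\<close>.\<close>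

typedef 'n h1 = "closure (test_pairs (UNIV :: (real^'n::finite) set))"
  using subspace_closure_test_pairs subspace_0 by blast

setup_lifting type_definition_h1

definition h1_fun :: "'n::finite h1 \<Rightarrow> real^'n \<Rightarrow> real" where
  "h1_fun u = rep_l2 (fst (Rep_h1 u))"

definition h1_grad :: "'n::finite h1 \<Rightarrow> real^'n \<Rightarrow> real^'n" where
  "h1_grad u = rep_l2 (snd (Rep_h1 u))"

instantiation h1 :: (finite) real_vector
begin

lift_definition zero_h1 :: "'a h1" is 0
  by (rule subspace_0[OF subspace_closure_test_pairs])

lift_definition plus_h1 :: "'a h1 \<Rightarrow> 'a h1 \<Rightarrow> 'a h1" is "(+)"
  by (rule subspace_add[OF subspace_closure_test_pairs])

lift_definition scaleR_h1 :: "real \<Rightarrow> 'a h1 \<Rightarrow> 'a h1" is "(*\<^sub>R)"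
  by (rule subspace_scale[OF subspace_closure_test_pairs])

lift_definition uminus_h1 :: "'a h1 \<Rightarrow> 'a h1" is uminus
  by (rule subspace_neg[OF subspace_closure_test_pairs])

lift_definition minus_h1 :: "'a h1 \<Rightarrow> 'a h1 \<Rightarrow> 'a h1" is "(-)"
  by (rule subspace_diff[OF subspace_closure_test_pairs])

instance
  by standard (transfer; simp add: algebra_simps)+

end

instantiation h1 :: (finite) real_inner
begin

lift_definition inner_h1 :: "'a h1 \<Rightarrow> 'a h1 \<Rightarrow> real" is "\<lambda>p q. snd p \<bullet> snd q" .

definition norm_h1 :: "'a h1 \<Rightarrow> real" where "norm_h1 u = sqrt (u \<bullet> u)"

definition sgn_h1 :: "'a h1 \<Rightarrow> 'a h1" where "sgn_h1 u = u /\<^sub>R norm u"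

definition dist_h1 :: "'a h1 \<Rightarrow> 'a h1 \<Rightarrow> real" where "dist_h1 u v = norm (u - v)"

definition uniformity_h1 :: "('a h1 \<times> 'a h1) filter" where
  "uniformity_h1 = (INF e\<in>{0 <..}. principal {(u, v). dist u v < e})"

definition open_h1 :: "'a h1 set \<Rightarrow> bool" where
  "open_h1 U \<longleftrightarrow> (\<forall>u\<in>U. eventually (\<lambda>(u', v). u' = u \<longrightarrow> v \<in> U) uniformity)"

instance
proof
  fix u v w :: "'a h1" and r :: real and U :: "'a h1 set"
  show "dist u v = norm (u - v)" by (rule dist_h1_def)
  show "sgn u = u /\<^sub>R norm u" by (rule sgn_h1_def)
  show "(uniformity :: ('a h1 \<times> 'a h1) filter) = (INF e\<in>{0 <..}. principal {(u, v). dist u v < e})"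
    by (rule uniformity_h1_def)
  show "open U \<longleftrightarrow> (\<forall>u\<in>U. eventually (\<lambda>(u', v). u' = u \<longrightarrow> v \<in> U) uniformity)"
    by (rule open_h1_def)
  show "u \<bullet> v = v \<bullet> u" by transfer (rule inner_commute)
  show "(u + v) \<bullet> w = u \<bullet> w + v \<bullet> w" by transfer (simp add: inner_add_left)
  show "(r *\<^sub>R u) \<bullet> v = r * (u \<bullet> v)" by transfer simp
  show "0 \<le> u \<bullet> u" by transfer simp
  show "u \<bullet> u = 0 \<longleftrightarrow> u = 0"
    by transfer (auto dest: closure_test_pairs_gradient_0)
  show "norm u = sqrt (u \<bullet> u)" by (rule norm_h1_def)
qed

end

lemma inner_h1_eq_integral: "u \<bullet> v = (\<integral>x. h1_grad u x \<bullet> h1_grad v x \<partial>lborel)"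
proof -
  have "u \<bullet> v = abs_l2 (h1_grad u) \<bullet> abs_l2 (h1_grad v)"
    by (simp add: inner_h1.rep_eq h1_grad_def Quotient3_abs_rep[OF Quotient3_l2])
  also have "\<dots> = (\<integral>x. h1_grad u x \<bullet> h1_grad v x \<partial>lborel)"
    by (rule inner_l2.abs_eq) (auto simp: h1_grad_def Quotient3_rep_reflp[OF Quotient3_l2])
  finally show ?thesis .
qed

section \<open>The spaces \<open>X\<close> and \<open>Y\<close>\<close>

definition H10 :: "(real^'n) set \<Rightarrow> 'n::finite h1 set" where
  "H10 \<Omega> = {u. Rep_h1 u \<in> closure (test_pairs \<Omega>)}"

text \<open>A bounded functional on \<open>H\<^sup>1\<^sub>0(\<Omega>)\<close> is represented by its extension by zero to the orthogonal
  complement, which has the same norm.\<close>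

definition Hm1 :: "(real^'n) set \<Rightarrow> ('n::finite h1 \<Rightarrow>\<^sub>L real) set" where
  "Hm1 \<Omega> = {g. \<forall>z\<in>orthogonal_comp (H10 \<Omega>). blinfun_apply g z = 0}"

text \<open>The element of \<open>H\<^sup>-\<^sup>1(\<Omega>)\<close> that acts on \<open>H\<^sup>1\<^sub>0(\<Omega>)\<close> by a given formula.\<close>

definition functional :: "(real^'n) set \<Rightarrow> ('n::finite h1 \<Rightarrow> real) \<Rightarrow> 'n h1 \<Rightarrow>\<^sub>L real" where
  "functional \<Omega> l = (THE g. g \<in> Hm1 \<Omega> \<and> (\<forall>z\<in>H10 \<Omega>. blinfun_apply g z = l z))"

definition l2_functional :: "(real^'n) set \<Rightarrow> (real^'n \<Rightarrow> real) \<Rightarrow> 'n::finite h1 \<Rightarrow>\<^sub>L real" where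
  "l2_functional \<Omega> \<phi> = functional \<Omega> (\<lambda>z. LINT x:\<Omega>|lborel. \<phi> x * h1_fun z x)"

definition neg_laplace :: "'n::finite h1 \<Rightarrow> 'n h1 \<Rightarrow>\<^sub>L real" where
  "neg_laplace u = blinfun_inner_right u"

lemma neg_laplace_in_Hm1: "u \<in> H10 \<Omega> \<Longrightarrow> neg_laplace u \<in> Hm1 \<Omega>"
  by (auto simp: neg_laplace_def Hm1_def orthogonal_comp_def orthogonal_def)

definition inner_Hm1 :: "(real^'n) set \<Rightarrow> ('n::finite h1 \<Rightarrow>\<^sub>L real) \<Rightarrow> ('n h1 \<Rightarrow>\<^sub>L real) \<Rightarrow> real" where
  "inner_Hm1 \<Omega> g h = inv_into (H10 \<Omega>) neg_laplace g \<bullet> inv_into (H10 \<Omega>) neg_laplace h"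

definition proj_Hm1 :: "(real^'n) set \<Rightarrow> ('n::finite h1 \<Rightarrow>\<^sub>L real) set
    \<Rightarrow> ('n h1 \<Rightarrow>\<^sub>L real) \<Rightarrow> 'n h1 \<Rightarrow>\<^sub>L real" where
  "proj_Hm1 \<Omega> W g = (THE h. h \<in> W \<and> (\<forall>w\<in>W. inner_Hm1 \<Omega> (g - h) w = 0))"

section \<open>Domains, nonlinearities and eigenfunctions\<close>

text \<open>Near each boundary point \<open>\<Omega>\<close> is, in coordinates \<open>(x - (x \<bullet> e) e, x \<bullet> e)\<close> for some unit vector \<open>e\<close>,
  the set above the graph of a Lipschitz function on the hyperplane orthogonal to \<open>e\<close>.\<close>

definition lipschitz_boundary :: "'a::euclidean_space set \<Rightarrow> bool" where
  "lipschitz_boundary \<Omega> \<longleftrightarrow> (\<forall>p\<in>frontier \<Omega>. \<exists>r>0. \<exists>e \<gamma> L. norm e = 1 \<and>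
     L-lipschitz_on {y. y \<bullet> e = 0} \<gamma> \<and>
     \<Omega> \<inter> ball p r = {x \<in> ball p r. \<gamma> (x - (x \<bullet> e) *\<^sub>R e) < x \<bullet> e})"

text \<open>If \<open>S\<close> is a subspace, derivatives within \<open>S\<close> are required to be bounded linear on the whole type.
  This is no restriction on complete subspaces such as those below: compose with the orthogonal
  projection.\<close>

definition C1_on :: "'a::real_normed_vector set \<Rightarrow> ('a \<Rightarrow> 'b::real_normed_vector) \<Rightarrow> bool" where
  "C1_on S g \<longleftrightarrow> (\<exists>g'. (\<forall>x\<in>S. (g has_derivative blinfun_apply (g' x)) (at x within S)) \<and>
     continuous_on S g')"

definition C1_diffeomorphism ::
  "'a::real_normed_vector set \<Rightarrow> 'b::real_normed_vector set \<Rightarrow> ('a \<Rightarrow> 'b) \<Rightarrow> bool" where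
  "C1_diffeomorphism S T g \<longleftrightarrow> bij_betw g S T \<and> C1_on S g \<and> C1_on T (inv_into S g)"

definition partial2 :: "('a \<times> real \<Rightarrow> real) \<Rightarrow> 'a \<times> real \<Rightarrow> real" where
  "partial2 f p = deriv (\<lambda>t. f (fst p, t)) (snd p)"

definition appropriate :: "'a::euclidean_space set \<Rightarrow> ('a \<times> real \<Rightarrow> real) \<Rightarrow> bool" where
  "appropriate \<Omega> f \<longleftrightarrow> C1_on (\<Omega> \<times> UNIV) f \<and>
     set_integrable lborel \<Omega> (\<lambda>x. (f (x, 0))\<^sup>2) \<and>
     bounded (partial2 f ` (\<Omega> \<times> UNIV))"

definition semilinear_map ::
  "(real^'n) set \<Rightarrow> ((real^'n) \<times> real \<Rightarrow> real) \<Rightarrow> 'n::finite h1 \<Rightarrow> 'n h1 \<Rightarrow>\<^sub>L real" where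
  "semilinear_map \<Omega> f u =
     functional \<Omega> (\<lambda>z. u \<bullet> z - (LINT x:\<Omega>|lborel. f (x, h1_fun u x) * h1_fun z x))"

definition dirichlet_eigenfunction :: "(real^'n) set \<Rightarrow> real \<Rightarrow> 'n::finite h1 \<Rightarrow> bool" where
  "dirichlet_eigenfunction \<Omega> \<mu> u \<longleftrightarrow> u \<in> H10 \<Omega> \<and> u \<noteq> 0 \<and>
     (\<forall>z\<in>H10 \<Omega>. u \<bullet> z = \<mu> * (LINT x:\<Omega>|lborel. h1_fun u x * h1_fun z x))"

text \<open>The last clause says that every eigenvalue is listed, and as often as its multiplicity.
  Indices start at 0.  Orthogonality in \<open>H\<^sup>1\<^sub>0\<close> and \<open>H\<^sup>-\<^sup>1\<close> follows from that in \<open>L\<^sup>2\<close>.\<close>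

definition dirichlet_eigensystem ::
  "(real^'n) set \<Rightarrow> (nat \<Rightarrow> real) \<Rightarrow> (nat \<Rightarrow> 'n::finite h1) \<Rightarrow> bool" where
  "dirichlet_eigensystem \<Omega> lam phi \<longleftrightarrow>
     (\<forall>k. 0 < lam k) \<and> mono lam \<and>
     (\<forall>k. dirichlet_eigenfunction \<Omega> (lam k) (phi k)) \<and>
     (\<forall>i j. i \<noteq> j \<longrightarrow> (LINT x:\<Omega>|lborel. h1_fun (phi i) x * h1_fun (phi j) x) = 0) \<and>
     (\<forall>\<mu> u. dirichlet_eigenfunction \<Omega> \<mu> u \<longrightarrow> u \<in> span (phi ` {k. lam k = \<mu>}))"

section \<open>Decompositions and flatness\<close>

definition V_X :: "(nat \<Rightarrow> real) \<Rightarrow> (nat \<Rightarrow> 'n::finite h1) \<Rightarrow> real set \<Rightarrow> 'n h1 set" where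
  "V_X lam phi I = span (phi ` {i. lam i \<in> I})"

definition W_X :: "(real^'n) set \<Rightarrow> (nat \<Rightarrow> real) \<Rightarrow> (nat \<Rightarrow> 'n::finite h1) \<Rightarrow> real set \<Rightarrow> 'n h1 set" where
  "W_X \<Omega> lam phi I = H10 \<Omega> \<inter> orthogonal_comp (V_X lam phi I)"

definition V_Y :: "(real^'n) set \<Rightarrow> (nat \<Rightarrow> real) \<Rightarrow> (nat \<Rightarrow> 'n::finite h1) \<Rightarrow> real set
    \<Rightarrow> ('n h1 \<Rightarrow>\<^sub>L real) set" where
  "V_Y \<Omega> lam phi I = span ((\<lambda>i. l2_functional \<Omega> (h1_fun (phi i))) ` {i. lam i \<in> I})"

definition W_Y :: "(real^'n) set \<Rightarrow> (nat \<Rightarrow> real) \<Rightarrow> (nat \<Rightarrow> 'n::finite h1) \<Rightarrow> real set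
    \<Rightarrow> ('n h1 \<Rightarrow>\<^sub>L real) set" where
  "W_Y \<Omega> lam phi I = {g \<in> Hm1 \<Omega>. \<forall>h\<in>V_Y \<Omega> lam phi I. inner_Hm1 \<Omega> g h = 0}"

definition flat :: "(real^'n) set \<Rightarrow> ('n::finite h1 \<Rightarrow> 'n h1 \<Rightarrow>\<^sub>L real)
    \<Rightarrow> 'n h1 set \<Rightarrow> 'n h1 set \<Rightarrow> ('n h1 \<Rightarrow>\<^sub>L real) set \<Rightarrow> bool" where
  "flat \<Omega> F VX WX WY \<longleftrightarrow>
     F ` H10 \<Omega> \<subseteq> Hm1 \<Omega> \<and> C1_on (H10 \<Omega>) F \<and>
     (\<forall>v\<in>VX. C1_diffeomorphism WX WY (\<lambda>w. proj_Hm1 \<Omega> WY (F (w + v))))"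

end

theory Submission
  imports Defs "HOL-Complex_Analysis.Great_Picard"
begin

text \<open>Write \<open>q\<close> for a difference quotient of \<open>f\<close> in its second variable, so that \<open>a \<le> q \<le> b\<close> and
  \<open>F(u) - F(v) = (-\<Delta> - q)(u - v)\<close>.  Split \<open>w \<in> W\<^sub>X\<close> as \<open>w = p + m\<close> with \<open>m\<close> in the span of the
  eigenfunctions for eigenvalues below \<open>a\<close> and \<open>p\<close> orthogonal to all eigenfunctions for eigenvalues up to \<open>b\<close>.
  Testing \<open>(-\<Delta> - q) w\<close> with the reflected \<open>p - m\<close> gives
  \<open>\<parallel>p\<parallel>\<^sup>2 - \<parallel>m\<parallel>\<^sup>2 - \<integral> q (p\<^sup>2 - m\<^sup>2) \<ge> \<delta> \<parallel>w\<parallel>\<^sup>2\<close>, since the spectrum has gaps next to \<open>a\<close> and \<open>b\<close>.  So \<open>F\<^sub>v\<close>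
  followed by Riesz' isometry and the reflection is strongly monotone, Lipschitz and \<open>C\<^sup>1\<close>, hence a
  diffeomorphism.  That \<open>F\<close> itself is \<open>C\<^sup>1\<close> needs no Sobolev inequality: by Rellich's theorem the
  form \<open>\<integral> q\<^sub>n h z\<close> tends to 0 uniformly on the unit ball of \<open>H\<^sup>1\<^sub>0\<close> if the \<open>q\<^sub>n\<close> are bounded and tend to 0
  almost everywhere.\<close>

section \<open>Strongly monotone maps on complete subspaces\<close>

text \<open>The type \<open>h1\<close> carries the gradient norm on all of space, for which it is
  not complete. Hence Riesz' theorem, the solution of monotone equations and the inversion of
  coercive operators are proved for complete subspaces, and Poincare's inequality makes
  \<open>H10 \<Omega>\<close> one. Operators on a subspace become bounded operators on the whole
  type by composition with the orthogonal projection. The superposition operator need not be Frechet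
  differentiable from L2 to L2, however smooth \<open>f\<close> is. It only has to be differentiable
  between the two ends of the compact embedding of \<open>H10 \<Omega>\<close> into L2, so
  compactness takes the place of uniform convergence of the coefficients. Difference quotients in
  place of derivatives make the coercivity estimate a global monotonicity statement. Bijectivity
  then comes from one contraction, and linearisation enters only in the smoothness of the inverse.
  The hypothesis lists all eigenfunctions but provides no basis, so the gap above \<open>b\<close>
  comes from an extremal problem and not from an expansion.\<close>

lemma Riesz_representation_on:
  fixes S :: "'a::real_inner set" and l :: "'a \<Rightarrow>\<^sub>L real"
  assumes cS: "complete S" and sS: "subspace S"
  shows "\<exists>r\<in>S. \<forall>z\<in>S. l z = r \<bullet> z"
proof -
  \<comment> \<open>Dirichlet's principle: on \<open>S\<close> this functional is smallest at the
    representing vector. It is bounded below because \<open>(norm u - norm l)^2\<close> is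
    nonnegative.\<close>
  define \<phi> where "\<phi> u = (norm u)\<^sup>2 - 2 * l u" for u
  define m where "m = Inf (\<phi> ` S)"
  have lb: "- (norm l)\<^sup>2 \<le> \<phi> u" for u
  proof -
    have "l u \<le> norm l * norm u" using norm_blinfun[of l u] by simp
    moreover have "0 \<le> (norm u - norm l)\<^sup>2" by simp
    ultimately show ?thesis unfolding \<phi>_def by (simp add: power2_eq_square algebra_simps)
  qed
  have bdd: "bdd_below (\<phi> ` S)" using lb by (auto intro!: bdd_belowI)
  have ne: "\<phi> ` S \<noteq> {}" using subspace_0[OF sS] by blast
  have m: "m \<le> \<phi> u" if "u \<in> S" for u
    unfolding m_def using bdd that by (auto intro: cInf_lower)
  have "\<exists>u\<in>S. \<phi> u < m + 1 / real (Suc n)" for n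
    using cInf_lessD[OF ne, of "m + 1 / real (Suc n)"] by (auto simp: m_def)
  then obtain u where u: "\<And>n. u n \<in> S" "\<And>n. \<phi> (u n) < m + 1 / real (Suc n)" by metis
  \<comment> \<open>Parallelogram law: the midpoint of two near-minimisers cannot fall below
    \<open>m\<close>, so the two are close. This makes the minimising sequence Cauchy.\<close>
  have par: "(norm (x - y))\<^sup>2 \<le> 2 * (\<phi> x - m) + 2 * (\<phi> y - m)" if "x \<in> S" "y \<in> S" for x y
  proof -
    have "(1/2) *\<^sub>R (x + y) \<in> S" using that sS by (simp add: subspace_add subspace_scale)
    from m[OF this] have "m \<le> (norm ((1/2) *\<^sub>R (x + y)))\<^sup>2 - (l x + l y)"
      by (simp add: \<phi>_def blinfun.bilinear_simps add_divide_distrib)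
    also have "(norm ((1/2) *\<^sub>R (x + y)))\<^sup>2 = (norm (x + y))\<^sup>2 / 4"
      by (simp add: power_divide)
    finally have "4 * m + 4 * (l x + l y) \<le> (norm (x + y))\<^sup>2" by simp
    moreover have "(norm (x - y))\<^sup>2 + (norm (x + y))\<^sup>2 = 2 * (norm x)\<^sup>2 + 2 * (norm y)\<^sup>2"
      by (simp add: power2_norm_eq_inner inner_diff inner_add inner_commute)
    ultimately show ?thesis unfolding \<phi>_def by argo
  qed
  have "Cauchy u"
  proof (rule metric_CauchyI)
    fix e :: real assume e: "0 < e"
    obtain N where N: "4 / e\<^sup>2 < real N" using reals_Archimedean2 by blast
    show "\<exists>M. \<forall>i\<ge>M. \<forall>j\<ge>M. dist (u i) (u j) < e"
    proof (intro exI[of _ N] allI impI)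
      fix i j assume ij: "N \<le> i" "N \<le> j"
      have *: "1 / real (Suc k) < e\<^sup>2 / 4" if "N \<le> k" for k
      proof -
        have "4 / e\<^sup>2 < real (Suc k)" using N that by simp
        then show ?thesis using e by (simp add: field_simps)
      qed
      have "(norm (u i - u j))\<^sup>2 \<le> 2 * (\<phi> (u i) - m) + 2 * (\<phi> (u j) - m)" by (rule par[OF u(1) u(1)])
      also have "\<dots> < e\<^sup>2"
        using u(2)[of i] u(2)[of j] *[OF ij(1)] *[OF ij(2)] by simp
      finally show "dist (u i) (u j) < e"
        unfolding dist_norm using e by (auto intro: power2_less_imp_less)
    qed
  qed
  then obtain r where r: "r \<in> S" "u \<longlonglongrightarrow> r" using cS u(1) by (auto simp: complete_def)
  have "(\<lambda>n. \<phi> (u n)) \<longlonglongrightarrow> \<phi> r" unfolding \<phi>_def by (intro tendsto_intros r(2))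
  moreover have "(\<lambda>n. m + 1 / real (Suc n)) \<longlonglongrightarrow> m + 0"
    by (intro tendsto_intros LIMSEQ_Suc[OF lim_1_over_n])
  ultimately have rm: "\<phi> r \<le> m"
    using u(2) LIMSEQ_le[of "\<lambda>n. \<phi> (u n)" "\<phi> r" "\<lambda>n. m + 1 / real (Suc n)" m]
    by (auto intro: less_imp_le)
  have "l z = r \<bullet> z" if z: "z \<in> S" for z
  proof (rule ccontr)
    assume ne: "l z \<noteq> r \<bullet> z"
    define d where "d = r \<bullet> z - l z"
    \<comment> \<open>Moving from \<open>r\<close> by \<open>- s * d\<close> along \<open>z\<close>
      gains \<open>2 * s * d^2\<close> and costs \<open>s^2 * d^2 * (norm z)^2\<close>. This
      \<open>s\<close> is small enough for the gain to win.\<close>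
    define s where "s = 1 / ((norm z)\<^sup>2 + 1)"
    have s: "0 < s" "s * (norm z)\<^sup>2 < 1" by (auto simp: s_def field_simps add_pos_nonneg)
    have "r + (- s * d) *\<^sub>R z \<in> S" using r z sS by (simp add: subspace_diff subspace_scale)
    then have "\<phi> r \<le> \<phi> (r + (- s * d) *\<^sub>R z)" using m rm by fastforce
    also have "\<dots> = \<phi> r - 2 * s * d * d + s\<^sup>2 * d\<^sup>2 * (norm z)\<^sup>2"
      by (simp add: \<phi>_def d_def power2_norm_eq_inner blinfun.bilinear_simps inner_add inner_diff inner_commute)
        (simp add: power2_eq_square algebra_simps)
    finally have "2 * (s * d\<^sup>2) \<le> (s * (norm z)\<^sup>2) * (s * d\<^sup>2)"
      by (simp add: power2_eq_square algebra_simps)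
    moreover have "s * d\<^sup>2 > 0" using ne s by (simp add: d_def)
    ultimately have "2 \<le> s * (norm z)\<^sup>2" by (rule mult_right_le_imp_le)
    with s show False by simp
  qed
  with r show ?thesis by blast
qed

definition riesz_on :: "'a::real_inner set \<Rightarrow> ('a \<Rightarrow>\<^sub>L real) \<Rightarrow> 'a" where
  "riesz_on S l = (SOME r. r \<in> S \<and> (\<forall>z\<in>S. l z = r \<bullet> z))"

definition orth_proj :: "'a::real_inner set \<Rightarrow> 'a \<Rightarrow> 'a" where
  "orth_proj S x = riesz_on S (blinfun_inner_right x)"

lemma inner_eq_on_subspace_imp_eq:
  assumes "subspace S" "x \<in> S" "y \<in> S" "\<And>z. z \<in> S \<Longrightarrow> x \<bullet> z = y \<bullet> z"
  shows "x = y"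
proof -
  have "x - y \<in> S" using assms by (simp add: subspace_diff)
  then have "(x - y) \<bullet> (x - y) = 0" using assms(4) by (simp only: inner_diff_left)
  then show ?thesis by simp
qed

context
  fixes S :: "'a::real_inner set"
  assumes cS: "complete S" and sS: "subspace S"
begin

lemma riesz_on:
  fixes l :: "'a \<Rightarrow>\<^sub>L real"
  shows "riesz_on S l \<in> S" "z \<in> S \<Longrightarrow> riesz_on S l \<bullet> z = l z"
proof -
  have "\<exists>r. r \<in> S \<and> (\<forall>z\<in>S. l z = r \<bullet> z)"
    using Riesz_representation_on[OF cS sS, of l] by blast
  from someI_ex[OF this] have "riesz_on S l \<in> S \<and> (\<forall>z\<in>S. l z = riesz_on S l \<bullet> z)"
    unfolding riesz_on_def[symmetric] .
  then show "riesz_on S l \<in> S" "z \<in> S \<Longrightarrow> riesz_on S l \<bullet> z = l z" by auto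
qed

lemma riesz_on_unique:
  fixes l :: "'a \<Rightarrow>\<^sub>L real"
  shows "r \<in> S \<Longrightarrow> (\<And>z. z \<in> S \<Longrightarrow> r \<bullet> z = l z) \<Longrightarrow> riesz_on S l = r"
  by (rule inner_eq_on_subspace_imp_eq[OF sS]) (auto simp: riesz_on)

lemma bounded_linear_riesz_on: "bounded_linear (riesz_on S)"
proof (rule bounded_linear_intro[where K = 1])
  show "riesz_on S (k + l) = riesz_on S k + riesz_on S l" for k l
    by (rule riesz_on_unique) (auto simp: subspace_add[OF sS] riesz_on inner_add blinfun.bilinear_simps)
  show "riesz_on S (c *\<^sub>R l) = c *\<^sub>R riesz_on S l" for c l
    by (rule riesz_on_unique) (auto simp: subspace_scale[OF sS] riesz_on blinfun.bilinear_simps)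
  fix l
  have "norm (riesz_on S l) * norm (riesz_on S l) = l (riesz_on S l)"
    using riesz_on(2)[OF riesz_on(1), of l l] by (simp add: dot_square_norm power2_eq_square)
  also have "\<dots> \<le> norm l * norm (riesz_on S l)"
    using norm_blinfun[of l "riesz_on S l"] by simp
  finally show "norm (riesz_on S l) \<le> norm l * 1"
    by (cases "norm (riesz_on S l) = 0") (auto dest: mult_right_le_imp_le)
qed

lemma orth_proj: "orth_proj S x \<in> S" "z \<in> S \<Longrightarrow> orth_proj S x \<bullet> z = x \<bullet> z"
  by (auto simp: orth_proj_def riesz_on)

lemma orth_proj_unique: "y \<in> S \<Longrightarrow> (\<And>z. z \<in> S \<Longrightarrow> y \<bullet> z = x \<bullet> z) \<Longrightarrow> orth_proj S x = y"
  unfolding orth_proj_def by (rule riesz_on_unique) auto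

lemma orth_proj_id: "x \<in> S \<Longrightarrow> orth_proj S x = x"
  by (rule orth_proj_unique) auto

lemma bounded_linear_orth_proj: "bounded_linear (orth_proj S)"
  unfolding orth_proj_def[abs_def]
  by (rule bounded_linear_compose[OF bounded_linear_riesz_on bounded_linear_blinfun_inner_right])

lemma norm_orth_proj_le: "norm (orth_proj S x) \<le> norm x"
proof -
  have "norm (orth_proj S x) * norm (orth_proj S x) = x \<bullet> orth_proj S x"
    using orth_proj(2)[OF orth_proj(1), of x x] by (simp add: dot_square_norm power2_eq_square)
  also have "\<dots> \<le> norm x * norm (orth_proj S x)" by (rule norm_cauchy_schwarz)
  finally show ?thesis
    by (cases "norm (orth_proj S x) = 0") (auto dest: mult_right_le_imp_le)
qed

lemma strongly_monotone_norm_ge: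
  assumes "\<delta> * (norm v)\<^sup>2 \<le> y \<bullet> v"
  shows "\<delta> * norm v \<le> norm y"
proof (cases "v = 0")
  case False
  have "(\<delta> * norm v) * norm v \<le> norm y * norm v"
    using assms norm_cauchy_schwarz[of y v] by (simp add: power2_eq_square algebra_simps)
  then show ?thesis using False by (auto dest: mult_right_le_imp_le)
qed simp

text \<open>Zarantonello's theorem. Solutions of \<open>B x = g\<close> are the fixed points of
  \<open>x - \<tau> *\<^sub>R (B x - g)\<close>, and monotonicity together with the Lipschitz bound
  makes this a contraction of the complete set \<open>S\<close> for small
  \<open>\<tau>\<close>.\<close>

lemma strongly_monotone_bij:
  assumes B: "\<And>x. x \<in> S \<Longrightarrow> B x \<in> S"
    and \<delta>: "0 < \<delta>"
    and mono: "\<And>x y. x \<in> S \<Longrightarrow> y \<in> S \<Longrightarrow> \<delta> * (norm (x - y))\<^sup>2 \<le> (B x - B y) \<bullet> (x - y)"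
    and lip: "\<And>x y. x \<in> S \<Longrightarrow> y \<in> S \<Longrightarrow> norm (B x - B y) \<le> M * norm (x - y)"
  shows "bij_betw B S S"
  unfolding bij_betw_def
proof
  show "inj_on B S"
  proof (rule inj_onI)
    fix x y assume "x \<in> S" "y \<in> S" "B x = B y"
    then show "x = y" using strongly_monotone_norm_ge[OF mono[of x y]] \<delta> by (simp add: mult_le_0_iff)
  qed
  have "\<exists>x\<in>S. B x = g" if g: "g \<in> S" for g
  proof -
    \<comment> \<open>The Lipschitz constant is enlarged so that it is positive and at least
      \<delta>; then \<open>c\<close> is a real number below 1. The step \<open>\<tau>\<close>
      minimises \<open>1 - 2 * \<tau> * \<delta> + \<tau>^2 * M'^2\<close>, and the minimum is
      \<open>c^2\<close>.\<close>
    define M' where "M' = \<bar>M\<bar> + \<delta>"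
    have M': "0 < M'" "\<delta> \<le> M'" using \<delta> by (auto simp: M'_def)
    define \<tau> where "\<tau> = \<delta> / M'\<^sup>2"
    define c where "c = sqrt (1 - \<delta>\<^sup>2 / M'\<^sup>2)"
    have r: "0 < \<delta>\<^sup>2 / M'\<^sup>2" "\<delta>\<^sup>2 / M'\<^sup>2 \<le> 1" using \<delta> M' by (auto simp: power_mono)
    have \<tau>: "0 < \<tau>" using \<delta> M' by (simp add: \<tau>_def)
    have "\<exists>!x\<in>S. x - \<tau> *\<^sub>R (B x - g) = x"
    proof (rule Banach_fix[OF cS])
      show "S \<noteq> {}" using g by blast
      show "0 \<le> c" "c < 1" using r by (auto simp: c_def)
      show "(\<lambda>x. x - \<tau> *\<^sub>R (B x - g)) ` S \<subseteq> S"
        using B g sS by (auto intro!: subspace_diff subspace_scale)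
      fix x y assume xy: "x \<in> S" "y \<in> S"
      define d where "d = x - y"
      define b where "b = B x - B y"
      have "norm b \<le> M' * norm d"
      proof -
        have "norm b \<le> M * norm d" unfolding b_def d_def by (rule lip[OF xy])
        also have "\<dots> \<le> M' * norm d" using \<delta> by (intro mult_right_mono) (auto simp: M'_def)
        finally show ?thesis .
      qed
      then have b: "(norm b)\<^sup>2 \<le> M'\<^sup>2 * (norm d)\<^sup>2"
        using power_mono[of "norm b" "M' * norm d" 2] by (simp add: power_mult_distrib)
      have "(norm (d - \<tau> *\<^sub>R b))\<^sup>2 = (norm d)\<^sup>2 - 2 * \<tau> * (b \<bullet> d) + \<tau>\<^sup>2 * (norm b)\<^sup>2"
        by (simp add: power2_norm_eq_inner inner_diff inner_commute) (simp add: power2_eq_square)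
      also have "\<dots> \<le> (norm d)\<^sup>2 - 2 * \<tau> * (\<delta> * (norm d)\<^sup>2) + \<tau>\<^sup>2 * (M'\<^sup>2 * (norm d)\<^sup>2)"
        using mono[OF xy] b \<tau> by (intro add_mono diff_mono mult_left_mono) (auto simp: d_def b_def)
      also have "\<dots> = (1 - 2 * (\<tau> * \<delta>) + \<tau>\<^sup>2 * M'\<^sup>2) * (norm d)\<^sup>2"
        by (simp add: algebra_simps)
      also have "1 - 2 * (\<tau> * \<delta>) + \<tau>\<^sup>2 * M'\<^sup>2 = c\<^sup>2"
        using r M' by (simp add: c_def \<tau>_def power_divide power2_eq_square field_simps)
      finally have "(norm (d - \<tau> *\<^sub>R b))\<^sup>2 \<le> (c * norm d)\<^sup>2" by (simp add: power_mult_distrib)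
      then have "norm (d - \<tau> *\<^sub>R b) \<le> c * norm d"
        using r by (auto intro: power2_le_imp_le simp: c_def)
      moreover have "x - \<tau> *\<^sub>R (B x - g) - (y - \<tau> *\<^sub>R (B y - g)) = d - \<tau> *\<^sub>R b"
        by (simp add: d_def b_def algebra_simps)
      ultimately show "dist (x - \<tau> *\<^sub>R (B x - g)) (y - \<tau> *\<^sub>R (B y - g)) \<le> c * dist x y"
        by (simp only: dist_norm d_def)
    qed
    then obtain x where "x \<in> S" "x - \<tau> *\<^sub>R (B x - g) = x" by blast
    then show ?thesis using \<tau> by (intro bexI[of _ x]) auto
  qed
  then show "B ` S = S" using B by blast
qed

text \<open>Lax-Milgram, as the linear case of the monotone theorem. \<open>E\<close> is the inverse
  of \<open>D\<close> on \<open>S\<close> after the projection onto \<open>S\<close>, which makes it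
  an operator on the whole type, the form in which \<open>C1_on\<close> wants derivatives.\<close>

lemma coercive_operator_inverse:
  fixes D :: "'a \<Rightarrow>\<^sub>L 'a"
  assumes D: "\<And>h. h \<in> S \<Longrightarrow> D h \<in> S" and \<delta>: "0 < \<delta>"
    and coercive: "\<And>h. h \<in> S \<Longrightarrow> \<delta> * (norm h)\<^sup>2 \<le> D h \<bullet> h"
  obtains E :: "'a \<Rightarrow>\<^sub>L 'a" 
    where "\<And>k. blinfun_apply E k \<in> S" "\<And>k. D (blinfun_apply E k) = orth_proj S k" "norm E \<le> 1 / \<delta>"
proof -
  have ge: "\<delta> * norm h \<le> norm (D h)" if "h \<in> S" for h
    by (rule strongly_monotone_norm_ge[OF coercive[OF that]])
  have "bij_betw D S S"
  proof (rule strongly_monotone_bij[OF D \<delta>, where M = "norm D"])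
    fix x y assume xy: "x \<in> S" "y \<in> S"
    show "\<delta> * (norm (x - y))\<^sup>2 \<le> (D x - D y) \<bullet> (x - y)"
      using coercive[OF subspace_diff[OF sS xy]] by (simp add: blinfun.bilinear_simps)
    show "norm (D x - D y) \<le> norm D * norm (x - y)"
      using norm_blinfun[of D "x - y"] by (simp add: blinfun.bilinear_simps)
  qed
  then have ex: "\<exists>h\<in>S. D h = orth_proj S k" for k
    using orth_proj(1)[of k] by (auto simp: bij_betw_def image_iff) (metis imageE)
  then obtain E where E: "\<And>k. E k \<in> S" "\<And>k. D (E k) = orth_proj S k" by metis
  have uniq: "E k = h" if "h \<in> S" "D h = orth_proj S k" for k h
    using ge[OF subspace_diff[OF sS E(1) that(1)], of k] that E(2)[of k] \<delta>
    by (simp add: blinfun.bilinear_simps mult_le_0_iff)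
  interpret P: bounded_linear "orth_proj S" by (rule bounded_linear_orth_proj)
  have bnd: "norm (E k) \<le> norm k * (1 / \<delta>)" for k
    using ge[OF E(1), of k] E(2)[of k] norm_orth_proj_le[of k] \<delta> by (simp add: field_simps)
  have bl: "bounded_linear E"
  proof (rule bounded_linear_intro[OF _ _ bnd])
    show "E (x + y) = E x + E y" for x y
      by (rule uniq) (auto simp: subspace_add[OF sS] E blinfun.bilinear_simps P.add)
    show "E (c *\<^sub>R x) = c *\<^sub>R E x" for c x
      by (rule uniq) (auto simp: subspace_scale[OF sS] E blinfun.bilinear_simps P.scaleR)
  qed
  show ?thesis
  proof (rule that[of "Blinfun E"])
    show "norm (Blinfun E) \<le> 1 / \<delta>"
      using bnd \<delta> by (intro norm_blinfun_bound) (auto simp: bounded_linear_Blinfun_apply[OF bl] mult.commute)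
  qed (auto simp: bounded_linear_Blinfun_apply[OF bl] E)
qed

end

section \<open>C1 maps and diffeomorphisms composed with bounded linear maps\<close>

lemma C1_on_blinfun_compose:
  fixes T :: "'b::real_normed_vector \<Rightarrow>\<^sub>L 'c::real_normed_vector"
  assumes "C1_on S g"
  shows "C1_on S (\<lambda>x. T (g x))"
proof -
  obtain g' where g': "\<And>x. x \<in> S \<Longrightarrow> (g has_derivative blinfun_apply (g' x)) (at x within S)"
    and c: "continuous_on S g'"
    using assms by (auto simp: C1_on_def)
  show ?thesis
    unfolding C1_on_def
  proof (intro exI[of _ "\<lambda>x. T o\<^sub>L g' x"] conjI ballI)
    show "((\<lambda>x. T (g x)) has_derivative blinfun_apply (T o\<^sub>L g' x)) (at x within S)" if "x \<in> S" for x
      using bounded_linear.has_derivative[OF blinfun.bounded_linear_right g'[OF that]]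
      unfolding blinfun_compose.rep_eq o_def .
    show "continuous_on S (\<lambda>x. T o\<^sub>L g' x)" by (intro continuous_intros c)
  qed
qed

lemma C1_on_precompose_linear:
  fixes T :: "'c::real_normed_vector \<Rightarrow>\<^sub>L 'a::real_normed_vector"
  assumes "C1_on S g" and T: "\<And>y. y \<in> S' \<Longrightarrow> T y + v \<in> S"
  shows "C1_on S' (\<lambda>y. g (T y + v))"
proof -
  obtain g' where g': "\<And>x. x \<in> S \<Longrightarrow> (g has_derivative blinfun_apply (g' x)) (at x within S)"
    and c: "continuous_on S g'"
    using assms by (auto simp: C1_on_def)
  show ?thesis
    unfolding C1_on_def
  proof (intro exI[of _ "\<lambda>y. g' (T y + v) o\<^sub>L T"] conjI ballI)
    fix y assume y: "y \<in> S'"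
    have "((\<lambda>y. T y + v) has_derivative blinfun_apply T) (at y within S')"
      by (auto intro!: derivative_eq_intros)
    moreover have "(g has_derivative blinfun_apply (g' (T y + v))) (at (T y + v) within (\<lambda>y. T y + v) ` S')"
      using g'[OF T[OF y]] T by (auto intro: has_derivative_subset)
    ultimately show "((\<lambda>y. g (T y + v)) has_derivative blinfun_apply (g' (T y + v) o\<^sub>L T)) (at y within S')"
      unfolding blinfun_compose.rep_eq o_def by (rule has_derivative_in_compose)
  next
    show "continuous_on S' (\<lambda>y. g' (T y + v) o\<^sub>L T)"
      using T by (intro continuous_intros continuous_on_compose2[OF c]) auto
  qed
qed

lemma C1_on_cong:
  assumes "C1_on S g" "\<And>x. x \<in> S \<Longrightarrow> g x = h x"
  shows "C1_on S h"
  using assms unfolding C1_on_def by (metis (no_types, lifting) has_derivative_transform)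

lemma C1_diffeomorphism_cong:
  assumes "C1_diffeomorphism S T g" and eq: "\<And>x. x \<in> S \<Longrightarrow> g x = h x"
  shows "C1_diffeomorphism S T h"
proof -
  have "inv_into S g = inv_into S h"
    unfolding inv_into_def by (intro ext arg_cong[where f = Eps]) (auto simp: eq)
  with assms show ?thesis
    unfolding C1_diffeomorphism_def by (metis C1_on_cong bij_betw_cong)
qed

text \<open>The inverse of the composite is the inverse of \<open>g\<close> after \<open>R\<close>,
  so a bounded left inverse of \<open>T\<close> on \<open>W\<close> is enough for smoothness in both
  directions.\<close>

lemma C1_diffeomorphism_compose_linear:
  fixes T :: "'b::real_normed_vector \<Rightarrow>\<^sub>L 'c::real_normed_vector" and R :: "'c \<Rightarrow>\<^sub>L 'b"
  assumes g: "C1_diffeomorphism S W g" and RT: "\<And>w. w \<in> W \<Longrightarrow> R (T w) = w"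
  shows "C1_diffeomorphism S (T ` W) (\<lambda>x. T (g x))"
proof -
  have "bij_betw T W (T ` W)" using RT by (auto simp: bij_betw_def intro: inj_on_inverseI)
  then have bij: "bij_betw (\<lambda>x. T (g x)) S (T ` W)"
    using g bij_betw_trans[of g S W T "T ` W"] by (auto simp: C1_diffeomorphism_def o_def)
  have inv: "inv_into S g (R y + 0) = inv_into S (\<lambda>x. T (g x)) y" if "y \<in> T ` W" for y
  proof -
    from that obtain w where w: "w \<in> W" "y = T w" by blast
    then obtain x where x: "x \<in> S" "w = g x" using g by (auto simp: C1_diffeomorphism_def bij_betw_def)
    have "inv_into S (\<lambda>x. T (g x)) (T (g x)) = x"
      using bij x by (intro inv_into_f_eq) (auto simp: bij_betw_def)
    moreover have "inv_into S g (g x) = x"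
      using g x by (intro inv_into_f_eq) (auto simp: C1_diffeomorphism_def bij_betw_def)
    ultimately show ?thesis using RT w x by simp
  qed
  have "C1_on (T ` W) (\<lambda>y. inv_into S g (R y + 0))"
    using g RT by (intro C1_on_precompose_linear[where S = W]) (auto simp: C1_diffeomorphism_def)
  then have "C1_on (T ` W) (inv_into S (\<lambda>x. T (g x)))"
    by (rule C1_on_cong) (rule inv)
  with bij g show ?thesis
    by (auto simp: C1_diffeomorphism_def intro: C1_on_blinfun_compose)
qed

text \<open>Monotonicity between \<open>x\<close> and \<open>x + t *\<^sub>R h\<close>, divided by
  \<open>t^2\<close>, is the claim up to an error that vanishes with \<open>t\<close>. One
  sufficiently small \<open>t\<close> for each tolerance \<open>e\<close> suffices.\<close>

lemma strongly_monotone_derivative_coercive: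
  fixes D :: "'a::real_inner \<Rightarrow>\<^sub>L 'a"
  assumes S: "subspace S" and x: "x \<in> S"
    and B': "(B has_derivative blinfun_apply D) (at x within S)"
    and mono: "\<And>x y. x \<in> S \<Longrightarrow> y \<in> S \<Longrightarrow> \<delta> * (norm (x - y))\<^sup>2 \<le> (B x - B y) \<bullet> (x - y)"
    and h: "h \<in> S"
  shows "\<delta> * (norm h)\<^sup>2 \<le> D h \<bullet> h"
proof (cases "h = 0")
  case False
  show ?thesis
  proof (rule field_le_epsilon)
    fix e :: real assume e: "0 < e"
    define e' where "e' = e / (norm h)\<^sup>2"
    have e': "0 < e'" using e False by (simp add: e'_def)
    from B' e' obtain d where d: "0 < d"
      "\<And>y. y \<in> S \<Longrightarrow> norm (y - x) < d \<Longrightarrow> norm (B y - B x - D (y - x)) \<le> e' * norm (y - x)"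
      unfolding has_derivative_within_alt by blast
    define t where "t = d / (2 * norm h)"
    have t: "0 < t" "norm (t *\<^sub>R h) < d" using d(1) False by (auto simp: t_def)
    have S': "x + t *\<^sub>R h \<in> S" using S x h by (simp add: subspace_add subspace_scale)
    define r where "r = B (x + t *\<^sub>R h) - B x - D (t *\<^sub>R h)"
    have r: "norm r \<le> e' * norm (t *\<^sub>R h)" using d(2)[OF S'] t by (simp add: r_def)
    have "\<delta> * (norm (t *\<^sub>R h))\<^sup>2 \<le> (D (t *\<^sub>R h) + r) \<bullet> (t *\<^sub>R h)"
      using mono[OF S' x] by (simp add: r_def)
    also have "\<dots> = D (t *\<^sub>R h) \<bullet> (t *\<^sub>R h) + r \<bullet> (t *\<^sub>R h)" by (simp only: inner_add_left)
    also have "r \<bullet> (t *\<^sub>R h) \<le> e' * (norm (t *\<^sub>R h))\<^sup>2"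
      using norm_cauchy_schwarz[of r "t *\<^sub>R h"] mult_right_mono[OF r norm_ge_zero[of "t *\<^sub>R h"]]
      by (simp add: power2_eq_square algebra_simps)
    finally have "t\<^sup>2 * (\<delta> * (norm h)\<^sup>2) \<le> t\<^sup>2 * (D h \<bullet> h + e' * (norm h)\<^sup>2)"
      by (simp add: blinfun.bilinear_simps power_mult_distrib power2_eq_square algebra_simps)
    then have "\<delta> * (norm h)\<^sup>2 \<le> D h \<bullet> h + e' * (norm h)\<^sup>2" using t by simp
    then show "\<delta> * (norm h)\<^sup>2 \<le> D h \<bullet> h + e" using False by (simp add: e'_def)
  qed
qed simp

text \<open>The inverse \<open>G\<close> exists globally and is Lipschitz by monotonicity. Its
  derivative at \<open>y\<close> is the Lax-Milgram inverse of the derivative of \<open>B\<close> at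
  \<open>G y\<close>.\<close>

theorem strongly_monotone_C1_diffeomorphism:
  fixes S :: "'a::real_inner set"
  assumes S: "complete S" "subspace S"
    and B: "\<And>x. x \<in> S \<Longrightarrow> B x \<in> S"
    and \<delta>: "0 < \<delta>"
    and mono: "\<And>x y. x \<in> S \<Longrightarrow> y \<in> S \<Longrightarrow> \<delta> * (norm (x - y))\<^sup>2 \<le> (B x - B y) \<bullet> (x - y)"
    and lip: "\<And>x y. x \<in> S \<Longrightarrow> y \<in> S \<Longrightarrow> norm (B x - B y) \<le> M * norm (x - y)"
    and C1: "C1_on S B"
  shows "C1_diffeomorphism S S B"
proof -
  have bij: "bij_betw B S S" by (rule strongly_monotone_bij[OF S B \<delta> mono lip])
  define P where "P = Blinfun (orth_proj S)"
  have P: "blinfun_apply P = orth_proj S"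
    by (simp add: P_def bounded_linear_Blinfun_apply bounded_linear_orth_proj[OF S])
  have "C1_on S (\<lambda>x. P (B x))" by (rule C1_on_blinfun_compose[OF C1])
  then obtain D0 where D0: "\<And>x. x \<in> S \<Longrightarrow> ((\<lambda>x. P (B x)) has_derivative blinfun_apply (D0 x)) (at x within S)"
    and cD0: "continuous_on S D0"
    unfolding C1_on_def by blast
  \<comment> \<open>Composing with the projection puts the values of the derivative into
    \<open>S\<close>, where Lax-Milgram applies. The result is still a derivative of
    \<open>B\<close>, because \<open>P\<close> fixes the values of \<open>B\<close> on
    \<open>S\<close>.\<close>
  define D where "D x = P o\<^sub>L D0 x" for x
  have cD: "continuous_on S D" unfolding D_def by (intro continuous_intros cD0)
  have D: "(B has_derivative blinfun_apply (D x)) (at x within S)" if x: "x \<in> S" for x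
  proof -
    have "((\<lambda>x. P (P (B x))) has_derivative blinfun_apply (D x)) (at x within S)"
      using bounded_linear.has_derivative[OF blinfun.bounded_linear_right D0[OF x], of P]
      unfolding D_def blinfun_compose.rep_eq o_def .
    then show ?thesis
      by (rule has_derivative_transform[OF x, rotated]) (auto simp: P orth_proj_id[OF S] B)
  qed
  have DS: "D x h \<in> S" for x h by (simp add: D_def P orth_proj[OF S])
  have coercive: "\<delta> * (norm h)\<^sup>2 \<le> D x h \<bullet> h" if "x \<in> S" "h \<in> S" for x h
    using strongly_monotone_derivative_coercive[OF S(2) that(1) D[OF that(1)] mono that(2)] .
  have ge: "\<delta> * norm h \<le> norm (D x h)" if "x \<in> S" "h \<in> S" for x h
    by (rule strongly_monotone_norm_ge[OF S coercive[OF that]])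
  have "\<forall>x\<in>S. \<exists>E :: 'a \<Rightarrow>\<^sub>L 'a. (\<forall>k. blinfun_apply E k \<in> S) \<and>
      (\<forall>k. D x (blinfun_apply E k) = orth_proj S k) \<and> norm E \<le> 1 / \<delta>"
    using coercive_operator_inverse[OF S DS \<delta> coercive] by metis
  then obtain E where E: "\<And>x k. x \<in> S \<Longrightarrow> blinfun_apply (E x) k \<in> S"
    "\<And>x k. x \<in> S \<Longrightarrow> D x (E x k) = orth_proj S k" "\<And>x. x \<in> S \<Longrightarrow> norm (E x) \<le> 1 / \<delta>"
    by metis
  define G where "G = inv_into S B"
  have G: "G y \<in> S" "B (G y) = y" if "y \<in> S" for y
    using bij that unfolding G_def by (auto simp: bij_betw_def inv_into_into f_inv_into_f)
  have Glip: "norm (G y - G z) \<le> norm (y - z) / \<delta>" if "y \<in> S" "z \<in> S" for y z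
    using strongly_monotone_norm_ge[OF S mono[OF G(1)[OF that(1)] G(1)[OF that(2)]]] that \<delta> G(2)
    by (simp add: field_simps)
  have cG: "continuous_on S G"
    using Glip \<delta> by (intro lipschitz_on_continuous_on[of "1 / \<delta>"] lipschitz_onI) (auto simp: dist_norm)
  \<comment> \<open>Resolvent identity: \<open>D x\<close> maps \<open>E x k - E x' k\<close> to
    \<open>(D x' - D x) (E x' k)\<close>. Coercivity of \<open>D x\<close> and the uniform bound on
    \<open>E x'\<close> each cost one factor \<delta>.\<close>
  have Elip: "norm (E x - E x') \<le> norm (D x - D x') / \<delta>\<^sup>2" if x: "x \<in> S" "x' \<in> S" for x x'
  proof (rule norm_blinfun_bound)
    fix k
    have v: "E x k - E x' k \<in> S" using E x S by (simp add: subspace_diff)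
    have "\<delta> * norm (E x k - E x' k) \<le> norm (D x (E x k - E x' k))" by (rule ge[OF x(1) v])
    also have "D x (E x k - E x' k) = (D x' - D x) (E x' k)"
      using E x by (simp add: blinfun.bilinear_simps)
    also have "norm \<dots> \<le> norm (D x' - D x) * norm (E x' k)" by (rule norm_blinfun)
    also have "norm (E x' k) \<le> 1 / \<delta> * norm k"
      by (rule order_trans[OF norm_blinfun mult_right_mono[OF E(3)[OF x(2)] norm_ge_zero]])
    finally have "\<delta> * norm (E x k - E x' k) \<le> norm (D x' - D x) * (1 / \<delta> * norm k)"
      by (simp add: mult_left_mono)
    then show "norm ((E x - E x') k) \<le> norm (D x - D x') / \<delta>\<^sup>2 * norm k"
      using \<delta> by (simp add: blinfun.bilinear_simps field_simps power2_eq_square norm_minus_commute)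
  qed auto
  have cE: "continuous_on S E"
  proof (rule continuous_onI)
    fix x and e :: real assume x: "x \<in> S" and e: "0 < e"
    then have "0 < e * \<delta>\<^sup>2" using \<delta> by simp
    with cD x obtain d where d: "0 < d" "\<And>x'. x' \<in> S \<Longrightarrow> dist x' x < d \<Longrightarrow> dist (D x') (D x) < e * \<delta>\<^sup>2"
      unfolding continuous_on_iff by blast
    show "\<exists>d>0. \<forall>x'\<in>S. dist x' x < d \<longrightarrow> dist (E x') (E x) \<le> e"
    proof (intro exI[of _ d] conjI ballI impI d(1))
      fix x' assume x': "x' \<in> S" "dist x' x < d"
      have "norm (E x' - E x) \<le> norm (D x' - D x) / \<delta>\<^sup>2" by (rule Elip[OF x'(1) x])
      also have "\<dots> \<le> e" using d(2)[OF x'] \<delta> by (simp add: dist_norm field_simps)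
      finally show "dist (E x') (E x) \<le> e" by (simp add: dist_norm)
    qed
  qed
  have "C1_on S G"
    unfolding C1_on_def
  proof (intro exI[of _ "\<lambda>y. E (G y)"] conjI ballI)
    show "continuous_on S (\<lambda>y. E (G y))"
      using G by (intro continuous_on_compose2[OF cE cG]) auto
    fix y assume y: "y \<in> S"
    define x where "x = G y"
    have x: "x \<in> S" "B x = y" using G y by (auto simp: x_def)
    show "(G has_derivative blinfun_apply (E (G y))) (at y within S)"
      unfolding has_derivative_within_alt x_def[symmetric]
    proof (intro conjI allI impI blinfun.bounded_linear_right)
      fix e :: real assume e: "0 < e"
      then have "0 < e * \<delta>\<^sup>2" using \<delta> by simp
      with D[OF x(1)] obtain d where d: "0 < d" "\<And>x'. x' \<in> S \<Longrightarrow> norm (x' - x) < d \<Longrightarrow>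
          norm (B x' - B x - D x (x' - x)) \<le> (e * \<delta>\<^sup>2) * norm (x' - x)"
        unfolding has_derivative_within_alt by blast
      show "\<exists>d>0. \<forall>y'\<in>S. norm (y' - y) < d \<longrightarrow> norm (G y' - x - E x (y' - y)) \<le> e * norm (y' - y)"
      proof (intro exI[of _ "d * \<delta>"] conjI ballI impI)
        show "0 < d * \<delta>" using d \<delta> by simp
        fix y' assume y': "y' \<in> S" "norm (y' - y) < d * \<delta>"
        have x': "G y' \<in> S" "B (G y') = y'" using G y' by auto
        have l: "norm (G y' - x) \<le> norm (y' - y) / \<delta>" unfolding x_def by (rule Glip[OF y'(1) y])
        also have "\<dots> < d" using y' \<delta> by (simp add: field_simps)
        finally have l': "norm (G y' - x) < d" .
        define v where "v = G y' - x - E x (y' - y)"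
        have v: "v \<in> S" unfolding v_def using S x x' E(1) by (intro subspace_diff) auto
        \<comment> \<open>Under \<open>D x\<close> the error \<open>v\<close> becomes the negative
          of the Taylor remainder of \<open>B\<close> at \<open>x\<close>. The tolerance
          \<open>e * \<delta>^2\<close> pays one \<delta> for inverting \<open>D x\<close> and one
          for the Lipschitz bound of \<open>G\<close>.\<close>
        have "D x (E x (y' - y)) = B (G y') - B x"
          using E(2)[OF x(1)] orth_proj_id[OF S subspace_diff[OF S(2) y'(1) y]] x x' by simp
        then have "D x v = - (B (G y') - B x - D x (G y' - x))"
          by (simp add: v_def blinfun.diff_right)
        then have "\<delta> * norm v \<le> (e * \<delta>\<^sup>2) * norm (G y' - x)"
          using ge[OF x(1) v] d(2)[OF x'(1) l'] by (simp only: norm_minus_cancel)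
        also have "\<dots> \<le> (e * \<delta>\<^sup>2) * (norm (y' - y) / \<delta>)" using e l by (intro mult_left_mono) auto
        finally show "norm v \<le> e * norm (y' - y)"
          using \<delta> by (simp add: field_simps power2_eq_square)
      qed
    qed
  qed
  with bij C1 show ?thesis by (simp add: C1_diffeomorphism_def G_def)
qed

section \<open>Square-integrable functions\<close>

lemma sq_integrable_rep_l2: "sq_integrable (rep_l2 U)"
  using Quotient3_rep_reflp[OF Quotient3_l2, of U] by (simp add: l2_eq_def)

lemma borel_measurable_rep_l2 [measurable]: "rep_l2 U \<in> borel_measurable borel"
  using sq_integrable_rep_l2[of U] by (simp add: sq_integrable_def)

lemma abs_rep_l2: "abs_l2 (rep_l2 U) = U"
  by (rule Quotient3_abs_rep[OF Quotient3_l2])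

lemma abs_l2_eq_iff:
  assumes "sq_integrable f" "sq_integrable g"
  shows "abs_l2 f = abs_l2 g \<longleftrightarrow> (AE x in lborel. f x = g x)"
  using Quotient3_rel[OF Quotient3_l2, of f g] assms by (simp add: l2_eq_def)

lemma rep_abs_l2: "sq_integrable f \<Longrightarrow> AE x in lborel. rep_l2 (abs_l2 f) x = f x"
  using abs_l2_eq_iff[OF sq_integrable_rep_l2] abs_rep_l2 by blast

lemma rep_l2_scaleR_add: "AE x in lborel. rep_l2 (c *\<^sub>R U + V) x = c *\<^sub>R rep_l2 U x + rep_l2 V x"
proof -
  have "abs_l2 (\<lambda>x. c *\<^sub>R rep_l2 U x + rep_l2 V x) = c *\<^sub>R U + V"
    by (simp add: abs_l2_scaleR_add sq_integrable_rep_l2 abs_rep_l2)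
  moreover have "sq_integrable (\<lambda>x. c *\<^sub>R rep_l2 U x + rep_l2 V x)"
    by (intro sq_integrable_add sq_integrable_scaleR sq_integrable_rep_l2)
  ultimately show ?thesis using rep_abs_l2 by metis
qed

lemma rep_l2_add: "AE x in lborel. rep_l2 (U + V) x = rep_l2 U x + rep_l2 V x"
  using rep_l2_scaleR_add[of 1 U V] by simp

lemma rep_l2_diff: "AE x in lborel. rep_l2 (U - V) x = rep_l2 U x - rep_l2 V x"
  using rep_l2_scaleR_add[of "-1" V U] by simp

lemma inner_l2_eq: "U \<bullet> V = (\<integral>x. rep_l2 U x \<bullet> rep_l2 V x \<partial>lborel)"
  using inner_l2.abs_eq[of "rep_l2 U" "rep_l2 V"] by (simp add: abs_rep_l2 l2_eq_def sq_integrable_rep_l2)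

lemma inner_abs_l2:
  "sq_integrable f \<Longrightarrow> sq_integrable g \<Longrightarrow> abs_l2 f \<bullet> abs_l2 g = (\<integral>x. f x \<bullet> g x \<partial>lborel)"
  by (simp add: inner_l2.abs_eq l2_eq_def)

lemma power2_norm_l2:
  "(norm U)\<^sup>2 = (\<integral>x. (norm (rep_l2 U x))\<^sup>2 \<partial>lborel)"
  "ennreal ((norm U)\<^sup>2) = (\<integral>\<^sup>+x. ennreal ((norm (rep_l2 U x))\<^sup>2) \<partial>lborel)"
  using norm_abs_l2[OF sq_integrable_rep_l2[of U]] by (simp_all add: abs_rep_l2)

lemma power2_norm_diff_l2:
  "ennreal ((norm (U - V))\<^sup>2) = (\<integral>\<^sup>+x. ennreal ((norm (rep_l2 U x - rep_l2 V x))\<^sup>2) \<partial>lborel)"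
  unfolding power2_norm_l2(2) using rep_l2_diff[of U V] by (intro nn_integral_cong_AE) auto

text \<open>The weights \<open>2\<^sup>k\<close> make pointwise summability of the increments follow from one finite integral,
  without Minkowski's inequality.\<close>

lemma summable_increments_l2_AE_convergent:
  fixes U :: "nat \<Rightarrow> ('a::euclidean_space, 'b::euclidean_space) l2"
  assumes U: "\<And>k. norm (U (Suc k) - U k) < (1/2) ^ k"
  shows "AE x in lborel. convergent (\<lambda>k. rep_l2 (U k) x)"
proof -
  define d where "d k x = norm (rep_l2 (U (Suc k)) x - rep_l2 (U k) x)" for k x
  have [measurable]: "d k \<in> borel_measurable borel" for k unfolding d_def by measurable
  define T where "T x = (\<Sum>k. ennreal (2 ^ k * (d k x)\<^sup>2))" for x
  have [measurable]: "T \<in> borel_measurable borel" unfolding T_def by measurable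
  have "(\<integral>\<^sup>+x. T x \<partial>lborel) = (\<Sum>k. \<integral>\<^sup>+x. ennreal (2 ^ k * (d k x)\<^sup>2) \<partial>lborel)"
    unfolding T_def by (rule nn_integral_suminf) measurable
  also have "\<dots> \<le> (\<Sum>k. ennreal ((1/2) ^ k))"
  proof (intro suminf_le summableI)
    fix k
    have "(\<integral>\<^sup>+x. ennreal (2 ^ k * (d k x)\<^sup>2) \<partial>lborel) = ennreal (2 ^ k) * (\<integral>\<^sup>+x. ennreal ((d k x)\<^sup>2) \<partial>lborel)"
      by (subst nn_integral_cmult[symmetric]) (auto simp: ennreal_mult)
    also have "(\<integral>\<^sup>+x. ennreal ((d k x)\<^sup>2) \<partial>lborel) = ennreal ((norm (U (Suc k) - U k))\<^sup>2)"
      unfolding d_def by (rule power2_norm_diff_l2[symmetric])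
    also have "\<dots> \<le> ennreal (((1/2) ^ k)\<^sup>2)"
      using U[of k] by (intro ennreal_leI power_mono) auto
    also have "ennreal (2 ^ k) * ennreal (((1/2) ^ k)\<^sup>2) = ennreal ((1/2) ^ k)"
      by (simp add: ennreal_mult[symmetric] power2_eq_square power_mult_distrib[symmetric] field_simps)
    finally show "(\<integral>\<^sup>+x. ennreal (2 ^ k * (d k x)\<^sup>2) \<partial>lborel) \<le> ennreal ((1/2) ^ k)"
      by (simp add: mult_left_mono)
  qed
  also have "\<dots> = ennreal (\<Sum>k. (1/2) ^ k)"
    by (intro suminf_ennreal2) (auto intro: summable_geometric)
  finally have "(\<integral>\<^sup>+x. T x \<partial>lborel) \<noteq> \<infinity>" by (auto simp: top_unique)
  then have "AE x in lborel. T x \<noteq> \<infinity>" by (intro nn_integral_PInf_AE) auto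
  then show ?thesis
  proof eventually_elim
    case (elim x)
    obtain t where t: "0 \<le> t" "T x = ennreal t" using elim by (cases "T x") auto
    have bound: "d k x \<le> sqrt t * (sqrt (1/2)) ^ k" for k
    proof -
      have "ennreal (2 ^ k * (d k x)\<^sup>2) \<le> T x"
      proof -
        have "(\<Sum>j\<in>{k}. ennreal (2 ^ j * (d j x)\<^sup>2)) \<le> T x"
          unfolding T_def by (rule sum_le_suminf) auto
        then show ?thesis by (simp only: sum.insert finite.emptyI sum.empty empty_iff not_False_eq_True add_0_right)
      qed
      then have "2 ^ k * (d k x)\<^sup>2 \<le> t" using t by simp
      then have "(d k x)\<^sup>2 \<le> t * (1/2) ^ k" by (simp add: field_simps power_divide)
      also have "\<dots> = (sqrt t * (sqrt (1/2)) ^ k)\<^sup>2"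
        using t by (simp add: power_mult_distrib power_even_eq[symmetric] power_mult[symmetric] mult.commute[of k])
          (simp add: power_mult)
      finally show ?thesis using t by (auto intro: power2_le_imp_le)
    qed
    have "summable (\<lambda>k. sqrt t * (sqrt (1/2)) ^ k)"
      by (intro summable_mult summable_geometric) (simp add: real_sqrt_divide)
    then have "summable (\<lambda>k. rep_l2 (U (Suc k)) x - rep_l2 (U k) x)"
      by (rule summable_comparison_test'[where N = 0]) (use bound in \<open>simp add: d_def\<close>)
    then have "convergent (\<lambda>n. \<Sum>k<n. rep_l2 (U (Suc k)) x - rep_l2 (U k) x)"
      by (simp add: summable_iff_convergent)
    then have "convergent (\<lambda>n. rep_l2 (U n) x - rep_l2 (U 0) x)"
      by (simp only: sum_lessThan_telescope[of "\<lambda>k. rep_l2 (U k) x"])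
    then show ?case by (simp add: convergent_diff_const_right_iff)
  qed
qed

text \<open>Riesz-Fischer. A subsequence with increments below \<open>(1/2) ^ k\<close> converges
  almost everywhere, and Fatou's lemma bounds the L2 distance between this limit and each late term
  of the full sequence.\<close>

instance l2 :: (euclidean_space, euclidean_space) complete_space
proof
  fix U :: "nat \<Rightarrow> ('a, 'b) l2" assume "Cauchy U"
  then have "\<exists>N. \<forall>m\<ge>N. \<forall>n\<ge>N. dist (U m) (U n) < (1/2) ^ k" for k :: nat
    by (rule metric_CauchyD) simp
  then obtain N where N: "\<And>k m n. m \<ge> N k \<Longrightarrow> n \<ge> N k \<Longrightarrow> dist (U m) (U n) < (1/2) ^ k"
    by metis
  have "\<exists>r. \<forall>k. N k \<le> r k \<and> r k < r (Suc k)"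
  proof (rule dependent_nat_choice)
    show "\<exists>y. N (Suc n) \<le> y \<and> x < y" for x n
      by (rule exI[of _ "max (N (Suc n)) (Suc x)"]) auto
  qed auto
  then obtain r where r: "\<And>k. N k \<le> r k" "\<And>k. r k < r (Suc k)" by metis
  then have sm: "strict_mono r" by (simp add: strict_mono_Suc_iff)
  define f where "f x = lim (\<lambda>k. rep_l2 (U (r k)) x)" for x
  have [measurable]: "f \<in> borel_measurable borel" unfolding f_def by measurable
  have "norm (U (r (Suc k)) - U (r k)) < (1/2) ^ k" for k
    using N[of k "r (Suc k)" "r k"] r(1)[of k] r(2)[of k] by (simp add: dist_norm)
  then have "AE x in lborel. convergent (\<lambda>k. rep_l2 (U (r k)) x)"
    by (rule summable_increments_l2_AE_convergent)
  then have lim: "AE x in lborel. (\<lambda>k. rep_l2 (U (r k)) x) \<longlonglongrightarrow> f x"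
    by eventually_elim (simp add: f_def convergent_LIMSEQ_iff)
  have est: "(\<integral>\<^sup>+x. ennreal ((norm (f x - rep_l2 (U n) x))\<^sup>2) \<partial>lborel) \<le> ennreal (((1/2) ^ k)\<^sup>2)"
    if n: "N k \<le> n" for k n
  proof -
    have "(\<integral>\<^sup>+x. ennreal ((norm (f x - rep_l2 (U n) x))\<^sup>2) \<partial>lborel)
        = (\<integral>\<^sup>+x. liminf (\<lambda>j. ennreal ((norm (rep_l2 (U (r j)) x - rep_l2 (U n) x))\<^sup>2)) \<partial>lborel)"
    proof (rule nn_integral_cong_AE)
      show "AE x in lborel. ennreal ((norm (f x - rep_l2 (U n) x))\<^sup>2)
          = liminf (\<lambda>j. ennreal ((norm (rep_l2 (U (r j)) x - rep_l2 (U n) x))\<^sup>2))"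
        using lim by eventually_elim (intro lim_imp_Liminf[symmetric] tendsto_intros, auto)
    qed
    also have "\<dots> \<le> liminf (\<lambda>j. \<integral>\<^sup>+x. ennreal ((norm (rep_l2 (U (r j)) x - rep_l2 (U n) x))\<^sup>2) \<partial>lborel)"
      by (rule nn_integral_liminf) measurable
    also have "\<dots> \<le> limsup (\<lambda>j. \<integral>\<^sup>+x. ennreal ((norm (rep_l2 (U (r j)) x - rep_l2 (U n) x))\<^sup>2) \<partial>lborel)"
      by (rule Liminf_le_Limsup) simp
    also have "\<dots> \<le> ennreal (((1/2) ^ k)\<^sup>2)"
    proof (rule Limsup_bounded)
      show "\<forall>\<^sub>F j in sequentially. (\<integral>\<^sup>+x. ennreal ((norm (rep_l2 (U (r j)) x - rep_l2 (U n) x))\<^sup>2) \<partial>lborel)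
          \<le> ennreal (((1/2) ^ k)\<^sup>2)"
        using eventually_ge_at_top[of "N k"]
      proof eventually_elim
        case (elim j)
        then have "N k \<le> r j" using seq_suble[OF sm, of j] by simp
        from N[OF this n] have "(norm (U (r j) - U n))\<^sup>2 \<le> ((1/2) ^ k)\<^sup>2"
          by (intro power_mono) (auto simp: dist_norm)
        then show ?case by (simp only: power2_norm_diff_l2[symmetric]) (rule ennreal_leI)
      qed
    qed
    finally show ?thesis .
  qed
  have sqd: "sq_integrable (\<lambda>x. f x - rep_l2 (U n) x)" if "N k \<le> n" for k n
    unfolding sq_integrable_def using est[OF that]
    by (auto intro!: integrableI_bounded simp: le_less_trans)
  have "sq_integrable (\<lambda>x. (f x - rep_l2 (U (N 0)) x) + rep_l2 (U (N 0)) x)"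
    using sqd[of 0 "N 0"] by (intro sq_integrable_add sq_integrable_rep_l2) auto
  then have sqf: "sq_integrable f" by simp
  have "U \<longlonglongrightarrow> abs_l2 f"
  proof (rule metric_LIMSEQ_I)
    fix e :: real assume e: "0 < e"
    obtain k where k: "(1/2) ^ k < e" using real_arch_pow_inv[OF e, of "1/2"] by auto
    show "\<exists>N. \<forall>n\<ge>N. dist (U n) (abs_l2 f) < e"
    proof (intro exI[of _ "N k"] allI impI)
      fix n assume n: "N k \<le> n"
      have "ennreal ((norm (abs_l2 f - U n))\<^sup>2) = (\<integral>\<^sup>+x. ennreal ((norm (f x - rep_l2 (U n) x))\<^sup>2) \<partial>lborel)"
        unfolding power2_norm_diff_l2 using rep_abs_l2[OF sqf] by (intro nn_integral_cong_AE) auto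
      also have "\<dots> \<le> ennreal (((1/2) ^ k)\<^sup>2)" by (rule est[OF n])
      finally have "(norm (abs_l2 f - U n))\<^sup>2 \<le> ((1/2) ^ k)\<^sup>2" by simp
      then have "norm (abs_l2 f - U n) \<le> (1/2) ^ k" by (rule power2_le_imp_le) simp
      with k show "dist (U n) (abs_l2 f) < e" by (simp add: dist_norm norm_minus_commute)
    qed
  qed
  then show "convergent U" by (rule convergentI)
qed

text \<open>The squared distances tend to 0 in L1, hence almost everywhere along a subsequence.
  Continuity of \<open>f\<close> and of its derivative can only be used on such pointwise
  limits.\<close>

lemma tendsto_l2_AE_subseq:
  fixes U :: "nat \<Rightarrow> ('a::euclidean_space, 'b::euclidean_space) l2"
  assumes "U \<longlonglongrightarrow> V"
  obtains r where "strict_mono r" "AE x in lborel. (\<lambda>k. rep_l2 (U (r k)) x) \<longlonglongrightarrow> rep_l2 V x"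
proof -
  let ?d = "\<lambda>n x. (norm (rep_l2 (U n - V) x))\<^sup>2"
  have "(\<lambda>n. (norm (U n - V))\<^sup>2) \<longlonglongrightarrow> (norm (V - V))\<^sup>2" by (intro tendsto_intros assms)
  then have "(\<lambda>n. \<integral>x. norm (?d n x) \<partial>lborel) \<longlonglongrightarrow> 0" by (simp add: power2_norm_l2(1))
  moreover have "integrable lborel (?d n)" for n
    using sq_integrable_rep_l2[of "U n - V"] by (simp add: sq_integrable_def)
  ultimately obtain r where r: "strict_mono r" "AE x in lborel. (\<lambda>k. ?d (r k) x) \<longlonglongrightarrow> 0"
    using tendsto_L1_AE_subseq[of lborel ?d] by blast
  have "AE x in lborel. \<forall>k. rep_l2 (U (r k) - V) x = rep_l2 (U (r k)) x - rep_l2 V x"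
    by (simp add: AE_all_countable rep_l2_diff)
  with r(2) have "AE x in lborel. (\<lambda>k. rep_l2 (U (r k)) x) \<longlonglongrightarrow> rep_l2 V x"
  proof eventually_elim
    case (elim x)
    then have "(\<lambda>k. sqrt ((norm (rep_l2 (U (r k)) x - rep_l2 V x))\<^sup>2)) \<longlonglongrightarrow> sqrt 0"
      by (intro tendsto_real_sqrt) simp
    then have "(\<lambda>k. rep_l2 (U (r k)) x - rep_l2 V x) \<longlonglongrightarrow> 0"
      by (simp add: tendsto_norm_zero_iff)
    then show ?case by (simp add: LIM_zero_iff)
  qed
  with r(1) show ?thesis by (rule that)
qed

section \<open>The space \<open>H\<^sup>1\<^sub>0\<close>\<close>

lemma shift_l2_eq: "shift_l2 h U = abs_l2 (\<lambda>x. rep_l2 U (x + h))"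
  using shift_l2.abs_eq[of "rep_l2 U" h] by (simp add: abs_rep_l2 l2_eq_def sq_integrable_rep_l2)

lemma norm_shift_l2: "norm (shift_l2 h U) = norm U"
proof -
  have "shift_l2 h U \<bullet> shift_l2 h U = U \<bullet> U"
    using integral_lborel_shift[of "\<lambda>x. rep_l2 U x \<bullet> rep_l2 U x" h]
    by (simp add: shift_l2_eq inner_abs_l2 sq_integrable_shift sq_integrable_rep_l2 inner_l2_eq[of U U])
  then show ?thesis by (simp add: norm_eq_sqrt_inner)
qed

lemma shift_shift_l2: "shift_l2 y (shift_l2 z U) = shift_l2 (y + z) U"
  by transfer (simp add: l2_eq_def sq_integrable_shift add.assoc)

lemma sq_integrable_indicator:
  assumes "A \<in> sets borel" "emeasure lborel A < \<infinity>"
  shows "sq_integrable (indicator A :: 'a::euclidean_space \<Rightarrow> real)"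
proof -
  have "(\<lambda>x. (norm (indicator A x :: real))\<^sup>2) = indicator A" by (auto simp: indicator_def)
  then show ?thesis using assms by (simp add: sq_integrable_def)
qed

text \<open>The inclusion of H1 into L2. It is linear but unbounded for the gradient norm of the
  whole type; on \<open>H10 \<Omega>\<close> with bounded \<Omega> it becomes bounded.\<close>

definition l2_of :: "'n::finite h1 \<Rightarrow> (real^'n, real) l2" where
  "l2_of u = fst (Rep_h1 u)"

lemma l2_of_simps [simp]:
  "l2_of (u + v) = l2_of u + l2_of v" "l2_of (u - v) = l2_of u - l2_of v"
  "l2_of (c *\<^sub>R u) = c *\<^sub>R l2_of u" "l2_of 0 = 0"
  by (simp_all add: l2_of_def plus_h1.rep_eq minus_h1.rep_eq scaleR_h1.rep_eq zero_h1.rep_eq)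

lemma norm_h1_eq: "norm u = norm (snd (Rep_h1 u))"
  by (simp add: norm_eq_sqrt_inner inner_h1.rep_eq)

lemma test_pairs_mono: "\<Omega> \<subseteq> \<Omega>' \<Longrightarrow> test_pairs \<Omega> \<subseteq> test_pairs \<Omega>'"
  unfolding test_pairs_def test_functions_def by blast

text \<open>The inequality is a closed condition on pairs, so it passes from test functions to
  limits. It is the modulus of continuity behind Rellich's theorem.\<close>

lemma shift_l2_of: "norm (shift_l2 h (l2_of u) - l2_of u) \<le> norm h * norm u"
proof -
  let ?S = "{p :: (real^'a, real) l2 \<times> (real^'a, real^'a) l2.
    norm (shift_l2 h (fst p) - fst p) \<le> norm h * norm (snd p)}"
  have "closed ?S"
    by (intro closed_Collect_le continuous_intros
        bounded_linear.continuous_on[OF bounded_linear_shift_l2])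
  moreover have "test_pairs UNIV \<subseteq> ?S" using test_pairs_shift by blast
  ultimately have "Rep_h1 u \<in> ?S" using Rep_h1[of u] closure_minimal by blast
  then show ?thesis by (simp add: l2_of_def norm_h1_eq)
qed

lemma subspace_H10: "subspace (H10 \<Omega>)"
  using subspace_closure_test_pairs[of \<Omega>]
  by (simp add: subspace_def H10_def zero_h1.rep_eq plus_h1.rep_eq scaleR_h1.rep_eq)

text \<open>A test function on a bounded set and its translate by more than the diameter have disjoint
  supports, so the translation estimate bounds the norm itself.\<close>

lemma Poincare:
  fixes \<Omega> :: "(real^'n::finite) set"
  assumes "bounded \<Omega>"
  obtains C where "0 < C" "\<And>u. u \<in> H10 \<Omega> \<Longrightarrow> norm (l2_of u) \<le> C * norm u"
proof -
  obtain R where R: "0 < R" "\<And>x. x \<in> \<Omega> \<Longrightarrow> norm x < R"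
    using bounded_pos_less[THEN iffD1, OF assms] by blast
  obtain e :: "real^'n" where e: "norm e = 1" using norm_Basis[OF SOME_Basis] by blast
  define h where "h = (2 * R) *\<^sub>R e"
  have h: "norm h = 2 * R" using R e by (simp add: h_def)
  let ?S = "{p :: (real^'n, real) l2 \<times> (real^'n, real^'n) l2. norm (fst p) \<le> 2 * R * norm (snd p)}"
  have "closed ?S" by (intro closed_Collect_le continuous_intros)
  moreover have "test_pairs \<Omega> \<subseteq> ?S"
  proof
    fix p assume p: "p \<in> test_pairs \<Omega>"
    then obtain \<phi> g where \<phi>: "p = (abs_l2 \<phi>, abs_l2 g)" "\<phi> \<in> test_functions \<Omega>" "\<And>x. GDERIV \<phi> x :> g x"
      unfolding test_pairs_def by blast
    note sq = test_function_props(3)[OF \<phi>(2,3)]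
    have z: "x \<in> \<Omega>" if "\<phi> x \<noteq> 0" for x
      using \<phi>(2) that by (auto simp: test_functions_def)
    have disj: "\<phi> (x + h) * \<phi> x = 0" for x
    proof (rule ccontr)
      assume "\<phi> (x + h) * \<phi> x \<noteq> 0"
      then have "norm (x + h) < R" "norm x < R" using z R by auto
      then show False using norm_triangle_ineq4[of "x + h" x] h by simp
    qed
    have "shift_l2 h (abs_l2 \<phi>) \<bullet> abs_l2 \<phi> = (\<integral>x. \<phi> (x + h) * \<phi> x \<partial>lborel)"
      using sq by (simp add: shift_l2.abs_eq l2_eq_def inner_abs_l2 sq_integrable_shift)
    also have "\<dots> = 0" by (simp only: disj Bochner_Integration.integral_zero)
    finally have "(norm (shift_l2 h (abs_l2 \<phi>) - abs_l2 \<phi>))\<^sup>2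
        = (norm (shift_l2 h (abs_l2 \<phi>)))\<^sup>2 + (norm (abs_l2 \<phi>))\<^sup>2"
      by (simp add: power2_norm_eq_inner inner_diff inner_commute)
    then have "(norm (abs_l2 \<phi>))\<^sup>2 \<le> (norm (shift_l2 h (abs_l2 \<phi>) - abs_l2 \<phi>))\<^sup>2" by simp
    then have "norm (abs_l2 \<phi>) \<le> norm (shift_l2 h (abs_l2 \<phi>) - abs_l2 \<phi>)"
      by (rule power2_le_imp_le) simp
    also have "\<dots> \<le> norm h * norm (snd p)" using test_pairs_shift[OF p, of h] by (simp add: \<phi>(1))
    finally show "p \<in> ?S" by (simp add: \<phi>(1) h)
  qed
  ultimately have "closure (test_pairs \<Omega>) \<subseteq> ?S" by (intro closure_minimal)
  then have "norm (l2_of u) \<le> 2 * R * norm u" if "u \<in> H10 \<Omega>" for u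
    using that by (auto simp: H10_def l2_of_def norm_h1_eq)
  with R(1) show ?thesis by (intro that[of "2 * R"]) auto
qed

text \<open>A limit needs a function and a gradient, while the norm controls the gradient alone.
  Poincare's inequality makes the functions Cauchy in L2 too, and the pair of limits stays in the
  closure of the test pairs.\<close>

lemma complete_H10:
  fixes \<Omega> :: "(real^'n::finite) set"
  assumes "bounded \<Omega>"
  shows "complete (H10 \<Omega>)"
  unfolding complete_def
proof (intro allI impI, elim conjE)
  fix u assume u: "\<forall>n. u n \<in> H10 \<Omega>" and Cu: "Cauchy u"
  obtain C where C: "0 < C" "\<And>u. u \<in> H10 \<Omega> \<Longrightarrow> norm (l2_of u) \<le> C * norm u"
    using Poincare[OF assms] by blast
  have "Cauchy (\<lambda>n. snd (Rep_h1 (u n)))"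
    using Cu unfolding Cauchy_def dist_norm norm_h1_eq minus_h1.rep_eq snd_diff .
  then obtain b where b: "(\<lambda>n. snd (Rep_h1 (u n))) \<longlonglongrightarrow> b"
    using Cauchy_convergent convergent_def by blast
  have "Cauchy (\<lambda>n. l2_of (u n))"
  proof (rule metric_CauchyI)
    fix e :: real assume "0 < e"
    then have "0 < e / C" using C by simp
    from metric_CauchyD[OF Cu this] obtain N where N: "\<And>m n. m \<ge> N \<Longrightarrow> n \<ge> N \<Longrightarrow> dist (u m) (u n) < e / C"
      by blast
    show "\<exists>N. \<forall>m\<ge>N. \<forall>n\<ge>N. dist (l2_of (u m)) (l2_of (u n)) < e"
    proof (intro exI[of _ N] allI impI)
      fix m n assume "N \<le> m" "N \<le> n"
      then have "C * norm (u m - u n) < e" using N[of m n] C by (simp add: dist_norm field_simps)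
      moreover have "u m - u n \<in> H10 \<Omega>" using u by (intro subspace_diff[OF subspace_H10]) auto
      ultimately show "dist (l2_of (u m)) (l2_of (u n)) < e"
        using C(2)[of "u m - u n"] by (simp add: dist_norm)
    qed
  qed
  then obtain a where a: "(\<lambda>n. fst (Rep_h1 (u n))) \<longlonglongrightarrow> a"
    using Cauchy_convergent convergent_def unfolding l2_of_def by blast
  have "(\<lambda>n. Rep_h1 (u n)) \<longlonglongrightarrow> (a, b)"
    using tendsto_Pair[OF a b] by simp
  then have ab: "(a, b) \<in> closure (test_pairs \<Omega>)"
    using u closed_sequentially[OF closed_closure, of "\<lambda>n. Rep_h1 (u n)"] by (simp add: H10_def)
  then have "(a, b) \<in> closure (test_pairs UNIV)"
    using closure_mono[OF test_pairs_mono[of \<Omega> UNIV]] by blast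
  then have r: "Rep_h1 (Abs_h1 (a, b)) = (a, b)" by (rule Abs_h1_inverse)
  have "u \<longlonglongrightarrow> Abs_h1 (a, b)"
    using b unfolding tendsto_iff dist_norm norm_h1_eq minus_h1.rep_eq r by simp
  moreover have "Abs_h1 (a, b) \<in> H10 \<Omega>" using ab by (simp add: H10_def r)
  ultimately show "\<exists>l\<in>H10 \<Omega>. u \<longlonglongrightarrow> l" by blast
qed

text \<open>Approximating test functions vanish off \<Omega>, so the mass of \<open>u\<close> there
  is at most the squared L2 error of the approximation, which can be made arbitrarily small.\<close>

lemma H10_zero_outside:
  fixes \<Omega> :: "(real^'n::finite) set"
  assumes "open \<Omega>" and u: "u \<in> H10 \<Omega>"
  shows "AE x in lborel. x \<notin> \<Omega> \<longrightarrow> h1_fun u x = 0"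
proof -
  have [measurable]: "\<Omega> \<in> sets borel" using assms by simp
  have h [measurable]: "h1_fun u \<in> borel_measurable borel"
    unfolding h1_fun_def by measurable
  let ?I = "\<integral>\<^sup>+x. ennreal ((norm (h1_fun u x))\<^sup>2) * indicator (- \<Omega>) x \<partial>lborel"
  have le: "?I \<le> ennreal (e\<^sup>2)" if e: "0 < e" for e
  proof -
    obtain p where p: "p \<in> test_pairs \<Omega>" "dist p (Rep_h1 u) < e"
      using u e unfolding H10_def closure_approachable by blast
    then obtain \<phi> g where \<phi>: "p = (abs_l2 \<phi>, abs_l2 g)" "\<phi> \<in> test_functions \<Omega>" "\<And>x. GDERIV \<phi> x :> g x"
      unfolding test_pairs_def by blast
    note sq = test_function_props(3)[OF \<phi>(2,3)]
    have z: "\<phi> x = 0" if "x \<notin> \<Omega>" for x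
      using \<phi>(2) that by (auto simp: test_functions_def)
    have "?I \<le> (\<integral>\<^sup>+x. ennreal ((norm (rep_l2 (abs_l2 \<phi>) x - rep_l2 (l2_of u) x))\<^sup>2) \<partial>lborel)"
    proof (rule nn_integral_mono_AE)
      show "AE x in lborel. ennreal ((norm (h1_fun u x))\<^sup>2) * indicator (- \<Omega>) x
          \<le> ennreal ((norm (rep_l2 (abs_l2 \<phi>) x - rep_l2 (l2_of u) x))\<^sup>2)"
        using rep_abs_l2[OF sq]
        by eventually_elim (auto simp: indicator_def z h1_fun_def l2_of_def)
    qed
    also have "\<dots> = ennreal ((norm (abs_l2 \<phi> - l2_of u))\<^sup>2)" by (rule power2_norm_diff_l2[symmetric])
    also have "\<dots> \<le> ennreal (e\<^sup>2)"
    proof (intro ennreal_leI power_mono)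
      have "dist (fst p) (fst (Rep_h1 u)) \<le> dist p (Rep_h1 u)" by (rule dist_fst_le)
      with p(2) show "norm (abs_l2 \<phi> - l2_of u) \<le> e" by (simp add: \<phi>(1) l2_of_def dist_norm)
    qed simp
    finally show ?thesis .
  qed
  have "?I \<le> 0"
  proof (rule ennreal_le_epsilon)
    fix e :: real assume "0 < e"
    then show "?I \<le> 0 + ennreal e" using le[of "sqrt e"] by simp
  qed
  then have "AE x in lborel. ennreal ((norm (h1_fun u x))\<^sup>2) * indicator (- \<Omega>) x = 0"
    by (subst nn_integral_0_iff_AE[symmetric]) auto
  then show ?thesis by eventually_elim (auto simp: indicator_def)
qed

section \<open>Rellich's theorem\<close>

text \<open>The mean of \<open>U\<close> over the ball of radius \<open>r\<close> around
  \<open>x\<close>. As an inner product with a translate it is defined on classes at every point,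
  and Cauchy-Schwarz yields its bounds.\<close>

definition ball_avg :: "real \<Rightarrow> ('a::euclidean_space, real) l2 \<Rightarrow> 'a \<Rightarrow> real" where
  "ball_avg r U x = (abs_l2 (indicator (ball 0 r)) \<bullet> shift_l2 x U) / measure lborel (ball (0::'a) r)"

lemma sq_integrable_indicator_ball: "sq_integrable (indicator (ball c r) :: 'a::euclidean_space \<Rightarrow> real)"
  by (rule sq_integrable_indicator[OF _ emeasure_lborel_ball_finite]) simp

lemma norm_abs_indicator_ball:
  "norm (abs_l2 (indicator (ball (0::'a::euclidean_space) r)) :: ('a, real) l2) = sqrt (measure lborel (ball (0::'a) r))"
proof -
  have "(norm (abs_l2 (indicator (ball (0::'a) r)) :: ('a, real) l2))\<^sup>2
      = (\<integral>x. (norm (indicator (ball (0::'a) r) x :: real))\<^sup>2 \<partial>lborel)"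
    by (rule norm_abs_l2(1)[OF sq_integrable_indicator_ball])
  also have "\<dots> = (\<integral>x. indicator (ball (0::'a) r) x \<partial>lborel)"
    by (intro Bochner_Integration.integral_cong) (auto simp: indicator_def)
  also have "\<dots> = measure lborel (ball (0::'a) r)" by simp
  finally show ?thesis using real_sqrt_unique by (metis norm_ge_zero)
qed

lemma measure_ball_pos: "0 < r \<Longrightarrow> 0 < measure lborel (ball (0::'a::euclidean_space) r)"
  by (rule content_ball_pos)

lemma ball_avg_le:
  fixes U :: "('a::euclidean_space, real) l2"
  shows "\<bar>ball_avg r U x\<bar> \<le> norm U / sqrt (measure lborel (ball (0::'a) r))"
proof (cases "0 < r")
  case True
  then have "0 < measure lborel (ball (0::'a) r)" by (rule measure_ball_pos)
  moreover have "\<bar>abs_l2 (indicator (ball 0 r)) \<bullet> shift_l2 x U\<bar> \<le> sqrt (measure lborel (ball (0::'a) r)) * norm U"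
    using Cauchy_Schwarz_ineq2[of "abs_l2 (indicator (ball 0 r))" "shift_l2 x U"]
    by (simp add: norm_abs_indicator_ball norm_shift_l2)
  from mult_right_mono[OF this, of "sqrt (measure lborel (ball (0::'a) r))"]
  have "\<bar>abs_l2 (indicator (ball 0 r)) \<bullet> shift_l2 x U\<bar> * sqrt (measure lborel (ball (0::'a) r))
      \<le> measure lborel (ball (0::'a) r) * norm U"
    by (simp add: mult_ac)
  ultimately show ?thesis
    unfolding ball_avg_def abs_divide by (simp add: divide_simps mult_ac)
qed (simp add: ball_avg_def ball_empty)

lemma ball_avg_diff_le:
  fixes U :: "('a::euclidean_space, real) l2"
  shows "\<bar>ball_avg r U x - ball_avg r U y\<bar>
    \<le> norm (shift_l2 (x - y) U - U) / sqrt (measure lborel (ball (0::'a) r))"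
proof -
  have "shift_l2 x U - shift_l2 y U = shift_l2 y (shift_l2 (x - y) U - U)"
    by (simp add: linear_diff[OF bounded_linear.linear[OF bounded_linear_shift_l2]] shift_shift_l2)
  then have "ball_avg r U x - ball_avg r U y = ball_avg r (shift_l2 (x - y) U - U) y"
    unfolding ball_avg_def diff_divide_distrib[symmetric] inner_diff_right[symmetric] by simp
  then show ?thesis using ball_avg_le[of r "shift_l2 (x - y) U - U" y] by simp
qed

text \<open>The error is the mean of \<open>rep_l2 U (x + y) - rep_l2 U x\<close> over the ball, and
  by Cauchy-Schwarz the square of a mean is at most the mean of the squares.\<close>

lemma ball_avg_pointwise_error:
  fixes U :: "('a::euclidean_space, real) l2"
  assumes "0 < r"
  shows "ennreal ((rep_l2 U x - ball_avg r U x)\<^sup>2) \<le> ennreal (1 / measure lborel (ball (0::'a) r))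
    * (\<integral>\<^sup>+y. indicator (ball 0 r) y * ennreal ((rep_l2 U (x + y) - rep_l2 U x)\<^sup>2) \<partial>lborel)"
proof -
  define V where "V = measure lborel (ball (0::'a) r)"
  have V: "0 < V" unfolding V_def by (rule measure_ball_pos[OF assms])
  define b where "b = (indicator (ball (0::'a) r) :: 'a \<Rightarrow> real)"
  have sqb: "sq_integrable b"
    unfolding b_def by (rule sq_integrable_indicator_ball)
  \<comment> \<open>The cut-off \<open>b\<close> keeps the constant \<open>rep_l2 U x\<close>
    square-integrable, so that the deviation is an element of L2.\<close>
  define k where "k y = b y * (rep_l2 U (y + x) - rep_l2 U x)" for y
  have sqs: "sq_integrable (\<lambda>y. rep_l2 U (y + x))"
    by (intro sq_integrable_shift sq_integrable_rep_l2)
  have [measurable]: "b \<in> borel_measurable borel" using sqb by (simp add: sq_integrable_def)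
  have sqbs: "sq_integrable (\<lambda>y. b y * rep_l2 U (y + x))"
    unfolding sq_integrable_def
  proof
    show "integrable lborel (\<lambda>y. (norm (b y * rep_l2 U (y + x)))\<^sup>2)"
    proof (rule Bochner_Integration.integrable_bound)
      show "integrable lborel (\<lambda>y. (norm (rep_l2 U (y + x)))\<^sup>2)" using sqs by (simp add: sq_integrable_def)
    qed (auto simp: b_def indicator_def)
  qed measurable
  have k: "k = (\<lambda>y. (- rep_l2 U x) *\<^sub>R b y + b y * rep_l2 U (y + x))"
    by (auto simp: k_def algebra_simps)
  have sqk: "sq_integrable k"
    unfolding k by (intro sq_integrable_add sq_integrable_scaleR sqb sqbs)
  have bk: "b y * k y = - rep_l2 U x * b y + b y * rep_l2 U (y + x)" for y
    by (simp add: k_def b_def indicator_def)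
  have "abs_l2 b \<bullet> abs_l2 k = (\<integral>y. - rep_l2 U x * b y + b y * rep_l2 U (y + x) \<partial>lborel)"
    by (simp add: inner_abs_l2 sqb sqk bk)
  also have "\<dots> = - rep_l2 U x * (\<integral>y. b y \<partial>lborel) + (\<integral>y. b y * rep_l2 U (y + x) \<partial>lborel)"
    using sq_integrable_inner[OF sqb sqs]
      integrable_real_indicator[OF _ emeasure_lborel_ball_finite, of "0::'a" r]
    by (subst Bochner_Integration.integral_add) (auto simp: b_def)
  also have "(\<integral>y. b y \<partial>lborel) = V" by (simp add: b_def V_def)
  also have "(\<integral>y. b y * rep_l2 U (y + x) \<partial>lborel) = V * ball_avg r U x"
    using V by (simp add: ball_avg_def V_def b_def[symmetric] shift_l2_eq inner_abs_l2 sqb sqs)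
  finally have "V * (ball_avg r U x - rep_l2 U x) = abs_l2 b \<bullet> abs_l2 k"
    by (simp add: algebra_simps)
  then have "\<bar>V * (ball_avg r U x - rep_l2 U x)\<bar> \<le> sqrt V * norm (abs_l2 k)"
    using Cauchy_Schwarz_ineq2[of "abs_l2 b" "abs_l2 k"]
    by (simp add: norm_abs_indicator_ball b_def V_def)
  then have "(V * (ball_avg r U x - rep_l2 U x))\<^sup>2 \<le> (sqrt V * norm (abs_l2 k))\<^sup>2"
    by (rule power2_le_iff_abs_le[THEN iffD2, rotated]) (use V in auto)
  then have "V * (V * (rep_l2 U x - ball_avg r U x)\<^sup>2) \<le> V * (norm (abs_l2 k))\<^sup>2"
    using V by (simp add: power_mult_distrib power2_commute[of "ball_avg r U x"] power2_eq_square[of V] mult.assoc)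
  then have "V * (rep_l2 U x - ball_avg r U x)\<^sup>2 \<le> (norm (abs_l2 k))\<^sup>2"
    using V by (simp only: mult_le_cancel_left_pos)
  then have "(rep_l2 U x - ball_avg r U x)\<^sup>2 \<le> 1 / V * (norm (abs_l2 k))\<^sup>2"
    using V by (simp add: field_simps)
  then have "ennreal ((rep_l2 U x - ball_avg r U x)\<^sup>2) \<le> ennreal (1 / V) * ennreal ((norm (abs_l2 k))\<^sup>2)"
    using V by (simp add: ennreal_mult[symmetric] ennreal_leI)
  also have "ennreal ((norm (abs_l2 k))\<^sup>2) = (\<integral>\<^sup>+y. ennreal ((norm (k y))\<^sup>2) \<partial>lborel)"
    by (rule norm_abs_l2(2)[OF sqk])
  also have "\<dots> = (\<integral>\<^sup>+y. indicator (ball 0 r) y * ennreal ((rep_l2 U (x + y) - rep_l2 U x)\<^sup>2) \<partial>lborel)"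
    by (intro nn_integral_cong) (auto simp: k_def b_def indicator_def add.commute)
  finally show ?thesis unfolding V_def .
qed

lemma continuous_on_ball_avg: "continuous_on UNIV (ball_avg r (l2_of u))"
proof (rule lipschitz_on_continuous_on, rule lipschitz_onI)
  fix x y
  show "dist (ball_avg r (l2_of u) x) (ball_avg r (l2_of u) y)
      \<le> (norm u / sqrt (measure lborel (ball (0::real^'a) r))) * dist x y"
    using ball_avg_diff_le[of r "l2_of u" x y]
      divide_right_mono[OF shift_l2_of[of "x - y" u], of "sqrt (measure lborel (ball (0::real^'a) r))"]
    by (simp add: dist_norm mult.commute)
qed simp

text \<open>After exchanging the integrals, each fixed \<open>y\<close> in the ball contributes the
  squared L2 norm of a translation difference, at most \<open>(r * norm u)^2\<close>. The mean over
  \<open>y\<close> keeps this bound.\<close>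

lemma ball_avg_error:
  fixes u :: "'n::finite h1"
  assumes r: "0 < r"
  shows "(\<integral>\<^sup>+x. ennreal ((h1_fun u x - ball_avg r (l2_of u) x)\<^sup>2) \<partial>lborel) \<le> ennreal ((r * norm u)\<^sup>2)"
proof -
  define U where "U = l2_of u"
  have hU: "h1_fun u = rep_l2 U" by (simp add: h1_fun_def U_def l2_of_def)
  define V where "V = measure lborel (ball (0::real^'n) r)"
  have V: "0 < V" unfolding V_def by (rule measure_ball_pos[OF r])
  let ?B = "indicator (ball (0::real^'n) r)"
  have [measurable]: "(\<lambda>y. ?B y :: ennreal) \<in> borel_measurable borel"
    by (intro borel_measurable_indicator) simp
  have "(\<integral>\<^sup>+x. ennreal ((h1_fun u x - ball_avg r U x)\<^sup>2) \<partial>lborel)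
      \<le> (\<integral>\<^sup>+x. ennreal (1 / V) * (\<integral>\<^sup>+y. ?B y * ennreal ((rep_l2 U (x + y) - rep_l2 U x)\<^sup>2) \<partial>lborel) \<partial>lborel)"
    unfolding hU V_def by (intro nn_integral_mono ball_avg_pointwise_error r)
  also have "\<dots> = ennreal (1 / V) *
      (\<integral>\<^sup>+x. (\<integral>\<^sup>+y. ?B y * ennreal ((rep_l2 U (x + y) - rep_l2 U x)\<^sup>2) \<partial>lborel) \<partial>lborel)"
    by (rule nn_integral_cmult) measurable
  also have "(\<integral>\<^sup>+x. (\<integral>\<^sup>+y. ?B y * ennreal ((rep_l2 U (x + y) - rep_l2 U x)\<^sup>2) \<partial>lborel) \<partial>lborel)
      = (\<integral>\<^sup>+y. (\<integral>\<^sup>+x. ?B y * ennreal ((rep_l2 U (x + y) - rep_l2 U x)\<^sup>2) \<partial>lborel) \<partial>lborel)"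
    by (rule lborel_pair.Fubini') measurable
  also have "\<dots> \<le> (\<integral>\<^sup>+y. ennreal ((r * norm u)\<^sup>2) * ?B y \<partial>lborel)"
  proof (rule nn_integral_mono)
    fix y
    show "(\<integral>\<^sup>+x. ?B y * ennreal ((rep_l2 U (x + y) - rep_l2 U x)\<^sup>2) \<partial>lborel) \<le> ennreal ((r * norm u)\<^sup>2) * ?B y"
    proof (cases "y \<in> ball 0 r")
      case True
      have "(\<integral>\<^sup>+x. ennreal ((rep_l2 U (x + y) - rep_l2 U x)\<^sup>2) \<partial>lborel)
          = ennreal ((norm (shift_l2 y U - U))\<^sup>2)"
      proof -
        have "AE x in lborel. rep_l2 (shift_l2 y U) x = rep_l2 U (x + y)"
          unfolding shift_l2_eq by (intro rep_abs_l2 sq_integrable_shift sq_integrable_rep_l2)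
        then show ?thesis
          unfolding power2_norm_diff_l2 by (intro nn_integral_cong_AE) auto
      qed
      also have "\<dots> \<le> ennreal ((r * norm u)\<^sup>2)"
      proof (intro ennreal_leI power_mono)
        have "norm (shift_l2 y U - U) \<le> norm y * norm u" unfolding U_def by (rule shift_l2_of)
        also have "\<dots> \<le> r * norm u" using True by (intro mult_right_mono) auto
        finally show "norm (shift_l2 y U - U) \<le> r * norm u" .
      qed simp
      finally show ?thesis using True by simp
    qed simp
  qed
  also have "\<dots> = ennreal ((r * norm u)\<^sup>2) * emeasure lborel (ball (0::real^'n) r)"
    by (rule nn_integral_cmult_indicator) simp
  also have "emeasure lborel (ball (0::real^'n) r) = ennreal V"
    unfolding V_def by (rule emeasure_eq_ennreal_measure) (metis emeasure_lborel_ball_finite infinity_ennreal_def less_irrefl)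
  also have "ennreal (1 / V) * (ennreal ((r * norm u)\<^sup>2) * ennreal V) = ennreal ((r * norm u)\<^sup>2)"
    using V by (simp add: ennreal_mult[symmetric])
  finally show ?thesis unfolding U_def by (simp add: mult_left_mono)
qed

text \<open>Averages over small balls are close in L2 to the functions themselves, and they are
  uniformly bounded and equicontinuous. Arzela-Ascoli finds two averages that are uniformly close on
  a ball containing \<Omega>; off \<Omega> both functions vanish.\<close>

lemma Rellich_pair:
  fixes \<Omega> :: "(real^'n::finite) set" and u :: "nat \<Rightarrow> 'n h1"
  assumes \<Omega>: "open \<Omega>" "bounded \<Omega>" and u: "\<And>i. u i \<in> H10 \<Omega>" "\<And>i. norm (u i) \<le> 1" and e: "0 < e"
  shows "\<exists>i j. i < j \<and> dist (l2_of (u i)) (l2_of (u j)) < e"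
proof -
  obtain C where C: "0 < C" "\<And>u. u \<in> H10 \<Omega> \<Longrightarrow> norm (l2_of u) \<le> C * norm u"
    using Poincare[OF \<Omega>(2)] by blast
  obtain R where "\<And>x. x \<in> \<Omega> \<Longrightarrow> norm x < R"
    using bounded_pos_less[THEN iffD1, OF \<Omega>(2)] by blast
  then have R: "\<Omega> \<subseteq> cball 0 R" by (intro subsetI) (simp add: less_imp_le)
  have [measurable]: "\<Omega> \<in> sets borel" using \<Omega> by simp
  define r where "r = e / 4"
  have r: "0 < r" using e by (simp add: r_def)
  define V where "V = measure lborel (ball (0::real^'n) r)"
  have V: "0 < V" unfolding V_def by (rule measure_ball_pos[OF r])
  define m where "m i = ball_avg r (l2_of (u i))" for i
  have cm: "continuous_on UNIV (m i)" for i unfolding m_def by (rule continuous_on_ball_avg)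
  then have [measurable]: "m i \<in> borel_measurable borel" for i
    by (rule borel_measurable_continuous_onI)
  have bound: "norm (m i x) \<le> C / sqrt V" for i x
  proof -
    have "norm (m i x) \<le> norm (l2_of (u i)) / sqrt V"
      unfolding m_def V_def real_norm_def by (rule ball_avg_le)
    also have "norm (l2_of (u i)) \<le> C"
      using C(1) by (intro order_trans[OF C(2)[OF u(1)] mult_left_le[OF u(2)]]) simp
    finally show ?thesis using V by (simp add: divide_right_mono)
  qed
  have lip: "norm (m i x - m i y) \<le> norm (x - y) / sqrt V" for i x y
  proof -
    have "norm (m i x - m i y) \<le> norm (shift_l2 (x - y) (l2_of (u i)) - l2_of (u i)) / sqrt V"
      unfolding m_def V_def real_norm_def by (rule ball_avg_diff_le)
    also have "norm (shift_l2 (x - y) (l2_of (u i)) - l2_of (u i)) \<le> norm (x - y) * norm (u i)"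
      by (rule shift_l2_of)
    also have "\<dots> \<le> norm (x - y)" using u(2) by (simp add: mult_left_le)
    finally show ?thesis using V by (simp add: divide_right_mono)
  qed
  obtain g k where gk: "strict_mono (k :: nat \<Rightarrow> nat)"
    "\<And>\<eta>. 0 < \<eta> \<Longrightarrow> \<exists>N. \<forall>n x. n \<ge> N \<and> x \<in> cball (0::real^'n) R \<longrightarrow> norm (m (k n) x - g x) < \<eta>"
  proof (rule Arzela_Ascoli[of "cball (0::real^'n) R" m "C / sqrt V"])
    fix x :: "real^'n" and \<eta> :: real assume \<eta>: "0 < \<eta>"
    show "\<exists>d>0. \<forall>n y. y \<in> cball 0 R \<and> norm (x - y) < d \<longrightarrow> norm (m n x - m n y) < \<eta>"
    proof (intro exI[of _ "\<eta> * sqrt V"] conjI allI impI)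
      show "0 < \<eta> * sqrt V" using \<eta> V by simp
      fix n y assume "y \<in> cball 0 R \<and> norm (x - y) < \<eta> * sqrt V"
      then have "norm (x - y) / sqrt V < \<eta>" using V by (simp add: field_simps)
      with lip[of n x y] show "norm (m n x - m n y) < \<eta>" by linarith
    qed
  qed (use bound in auto)
  define L where "L = measure lborel (cball (0::real^'n) R)"
  have L: "0 \<le> L" by (simp add: L_def)
  \<comment> \<open>Splitting the difference into three terms costs a factor 3 on each square. With
    \<open>r = e / 4\<close> and this \<eta>, each of the three squared norms is at most
    \<open>e^2 / 16\<close>, giving at most \<open>9 / 16\<close> of \<open>e^2\<close>. The
    \<open>+ 1\<close> covers a ball of measure 0.\<close>
  define \<eta> where "\<eta> = e / (8 * sqrt (L + 1))"
  have \<eta>: "0 < \<eta>" using e L by (simp add: \<eta>_def)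
  from gk(2)[OF this] obtain N where N: "\<And>n x. n \<ge> N \<Longrightarrow> x \<in> cball (0::real^'n) R \<Longrightarrow> norm (m (k n) x - g x) < \<eta>"
    by blast
  define i where "i = k N"
  define j where "j = k (Suc N)"
  have ij: "i < j" using gk(1) by (simp add: i_def j_def strict_mono_def)
  have mm: "\<bar>m i x - m j x\<bar> \<le> 2 * \<eta>" if "x \<in> cball 0 R" for x
    using N[of N x] N[of "Suc N" x] that by (simp add: i_def j_def)
  let ?E = "\<lambda>i x. ennreal ((h1_fun (u i) x - m i x)\<^sup>2)"
  have [measurable]: "h1_fun (u i) \<in> borel_measurable borel" for i
    unfolding h1_fun_def by measurable
  have [measurable]: "(indicator (cball (0::real^'n) R) :: _ \<Rightarrow> ennreal) \<in> borel_measurable borel"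
    by (intro borel_measurable_indicator) simp
  have E: "(\<integral>\<^sup>+x. ?E i x \<partial>lborel) \<le> ennreal (r\<^sup>2)" for i
  proof -
    have "(\<integral>\<^sup>+x. ?E i x \<partial>lborel) \<le> ennreal ((r * norm (u i))\<^sup>2)"
      unfolding m_def by (rule ball_avg_error[OF r])
    also have "\<dots> \<le> ennreal (r\<^sup>2)"
      using u(2)[of i] r by (intro ennreal_leI power_mono) (auto simp: mult_left_le)
    finally show ?thesis .
  qed
  have sq3: "(a + b + c)\<^sup>2 \<le> 3 * a\<^sup>2 + 3 * b\<^sup>2 + 3 * c\<^sup>2" for a b c :: real
    using sum_squares_ge_zero[of "a - b" "b - c"] zero_le_power2[of "a - c"]
    by (simp add: power2_eq_square algebra_simps)
  have "ennreal ((norm (l2_of (u i) - l2_of (u j)))\<^sup>2)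
      = (\<integral>\<^sup>+x. ennreal ((h1_fun (u i) x - h1_fun (u j) x)\<^sup>2) \<partial>lborel)"
    by (simp add: power2_norm_diff_l2 h1_fun_def l2_of_def)
  also have "\<dots> \<le> (\<integral>\<^sup>+x. 3 * ?E i x + ennreal (3 * (2 * \<eta>)\<^sup>2) * indicator (cball 0 R) x + 3 * ?E j x \<partial>lborel)"
  proof (rule nn_integral_mono_AE)
    show "AE x in lborel. ennreal ((h1_fun (u i) x - h1_fun (u j) x)\<^sup>2)
        \<le> 3 * ?E i x + ennreal (3 * (2 * \<eta>)\<^sup>2) * indicator (cball 0 R) x + 3 * ?E j x"
      using H10_zero_outside[OF \<Omega>(1) u(1)[of i]] H10_zero_outside[OF \<Omega>(1) u(1)[of j]]
    proof eventually_elim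
      case (elim x)
      show ?case
      proof (cases "x \<in> \<Omega>")
        case True
        then have x: "x \<in> cball 0 R" using R by blast
        define p q s where "p = h1_fun (u i) x - m i x" "q = m i x - m j x" "s = m j x - h1_fun (u j) x"
        have "(h1_fun (u i) x - h1_fun (u j) x)\<^sup>2 = (p + q + s)\<^sup>2" by (simp add: p_q_s_def)
        also have "\<dots> \<le> 3 * p\<^sup>2 + 3 * q\<^sup>2 + 3 * s\<^sup>2" by (rule sq3)
        also have "\<dots> \<le> 3 * p\<^sup>2 + 3 * (2 * \<eta>)\<^sup>2 + 3 * s\<^sup>2"
        proof -
          have "q\<^sup>2 \<le> (2 * \<eta>)\<^sup>2"
            using mm[OF x] \<eta> by (intro power2_le_iff_abs_le[THEN iffD2]) (auto simp: p_q_s_def)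
          then show ?thesis by simp
        qed
        finally have "ennreal ((h1_fun (u i) x - h1_fun (u j) x)\<^sup>2)
            \<le> ennreal (3 * p\<^sup>2 + 3 * (2 * \<eta>)\<^sup>2 + 3 * s\<^sup>2)" by (rule ennreal_leI)
        also have "\<dots> = 3 * ennreal (p\<^sup>2) + ennreal (3 * (2 * \<eta>)\<^sup>2) + 3 * ennreal (s\<^sup>2)"
          by (simp add: ennreal_plus ennreal_mult ennreal_numeral[symmetric] del: ennreal_numeral)
        finally show ?thesis using x by (simp add: p_q_s_def power2_commute[of "m j x"])
      next
        case False
        with elim show ?thesis by simp
      qed
    qed
  qed
  also have "\<dots> = 3 * (\<integral>\<^sup>+x. ?E i x \<partial>lborel) + ennreal (3 * (2 * \<eta>)\<^sup>2) * emeasure lborel (cball (0::real^'n) R)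
      + 3 * (\<integral>\<^sup>+x. ?E j x \<partial>lborel)"
    by (simp add: nn_integral_add nn_integral_cmult nn_integral_cmult_indicator)
  also have "emeasure lborel (cball (0::real^'n) R) = ennreal L"
    unfolding L_def
    by (rule emeasure_eq_ennreal_measure) (metis emeasure_lborel_cball_finite infinity_ennreal_def less_irrefl)
  also have "3 * (\<integral>\<^sup>+x. ?E i x \<partial>lborel) + ennreal (3 * (2 * \<eta>)\<^sup>2) * ennreal L + 3 * (\<integral>\<^sup>+x. ?E j x \<partial>lborel)
      \<le> 3 * ennreal (r\<^sup>2) + ennreal (3 * (2 * \<eta>)\<^sup>2) * ennreal L + 3 * ennreal (r\<^sup>2)"
    by (intro add_mono mult_left_mono E) auto
  also have "\<dots> = ennreal (3 * r\<^sup>2 + 3 * (2 * \<eta>)\<^sup>2 * L + 3 * r\<^sup>2)"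
  proof -
    have "3 * ennreal (r\<^sup>2) = ennreal (3 * r\<^sup>2)" by (simp add: ennreal_mult)
    moreover have "ennreal (3 * (2 * \<eta>)\<^sup>2) * ennreal L = ennreal (3 * (2 * \<eta>)\<^sup>2 * L)"
      using L by (intro ennreal_mult[symmetric]) auto
    moreover have "ennreal x + ennreal y + ennreal x = ennreal (x + y + x)" if "0 \<le> x" "0 \<le> y" for x y
      using that by (simp only: ennreal_plus add_nonneg_nonneg)
    ultimately show ?thesis using L by simp
  qed
  finally have "(norm (l2_of (u i) - l2_of (u j)))\<^sup>2 \<le> 3 * r\<^sup>2 + 3 * (2 * \<eta>)\<^sup>2 * L + 3 * r\<^sup>2"
    using L by (subst (asm) ennreal_le_iff) auto
  also have "\<dots> < e\<^sup>2"
  proof -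
    have "(2 * \<eta>)\<^sup>2 * L = e\<^sup>2 / 16 * (L / (L + 1))"
      using L by (simp add: \<eta>_def power_divide power_mult_distrib)
    also have "\<dots> \<le> e\<^sup>2 / 16 * 1" using L by (intro mult_left_mono) auto
    finally have "(2 * \<eta>)\<^sup>2 * L \<le> e\<^sup>2 / 16" by (simp only: mult_1_right)
    moreover have "r\<^sup>2 = e\<^sup>2 / 16" by (simp add: r_def power_divide)
    moreover have "0 < e\<^sup>2" using e by simp
    ultimately show ?thesis unfolding mult.assoc[of 3] by linarith
  qed
  finally have "dist (l2_of (u i)) (l2_of (u j)) < e"
    unfolding dist_norm using e by (auto intro: power2_less_imp_less)
  with ij show ?thesis by blast
qed

text \<open>If no finite net exists, greedy selection yields a sequence with all mutual distances at
  least \<open>e\<close>.\<close>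

lemma totally_bounded_if_close_pairs:
  fixes S :: "'a::metric_space set"
  assumes "\<And>x. (\<And>n::nat. x n \<in> S) \<Longrightarrow> \<exists>i j. i < j \<and> dist (x i) (x j) < e"
  shows "\<exists>k. finite k \<and> k \<subseteq> S \<and> S \<subseteq> (\<Union>x\<in>k. ball x e)"
proof (rule ccontr)
  assume "\<not> (\<exists>k. finite k \<and> k \<subseteq> S \<and> S \<subseteq> (\<Union>x\<in>k. ball x e))"
  then have *: "\<And>k. finite k \<Longrightarrow> k \<subseteq> S \<Longrightarrow> \<not> S \<subseteq> (\<Union>x\<in>k. ball x e)" by blast
  let ?Q = "\<lambda>x n r. r \<in> S \<and> (\<forall>m < (n::nat). \<not> (dist (x m) r < e))"
  have "\<exists>x. \<forall>n::nat. ?Q x n (x n)"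
  proof (rule dependent_wellorder_choice)
    fix n and x :: "nat \<Rightarrow> 'a" assume "\<And>y. y < n \<Longrightarrow> ?Q x y (x y)"
    then have "\<not> S \<subseteq> (\<Union>z\<in>x ` {0..<n}. ball z e)"
      using *[of "x ` {0 ..< n}"] by (auto simp: subset_eq)
    then show "\<exists>r. ?Q x n r" by fastforce
  qed simp
  then show False using assms by blast
qed

lemma Rellich_finite_net:
  fixes \<Omega> :: "(real^'n::finite) set"
  assumes "open \<Omega>" "bounded \<Omega>" "0 < e"
  obtains K where "finite K" "K \<subseteq> l2_of ` (H10 \<Omega> \<inter> cball 0 1)"
    "l2_of ` (H10 \<Omega> \<inter> cball 0 1) \<subseteq> (\<Union>y\<in>K. ball y e)"
proof -
  have "\<exists>k. finite k \<and> k \<subseteq> l2_of ` (H10 \<Omega> \<inter> cball 0 1) \<and> l2_of ` (H10 \<Omega> \<inter> cball 0 1) \<subseteq> (\<Union>x\<in>k. ball x e)"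
  proof (rule totally_bounded_if_close_pairs)
    fix x assume x: "\<And>n::nat. x n \<in> l2_of ` (H10 \<Omega> \<inter> cball 0 1)"
    have "\<exists>u. u \<in> H10 \<Omega> \<and> norm u \<le> 1 \<and> x n = l2_of u" for n using x[of n] by auto
    then obtain u where "\<And>n. u n \<in> H10 \<Omega>" "\<And>n. norm (u n) \<le> 1" "\<And>n. x n = l2_of (u n)" by metis
    with Rellich_pair[OF assms(1,2) _ _ assms(3), of u] show "\<exists>i j. i < j \<and> dist (x i) (x j) < e" by simp
  qed
  then show ?thesis using that by blast
qed

lemma Rellich:
  fixes \<Omega> :: "(real^'n::finite) set"
  assumes "open \<Omega>" "bounded \<Omega>"
  shows "compact (closure (l2_of ` (H10 \<Omega> \<inter> cball 0 1)))"
  unfolding compact_eq_totally_bounded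
proof (intro conjI allI impI)
  let ?S = "l2_of ` (H10 \<Omega> \<inter> cball 0 1)"
  show "complete (closure ?S)" by (simp add: complete_eq_closed)
  fix e :: real assume e: "0 < e"
  then obtain K where K: "finite K" "?S \<subseteq> (\<Union>y\<in>K. ball y (e/2))"
    using Rellich_finite_net[OF assms, of "e/2"] by (metis half_gt_zero)
  \<comment> \<open>A finite union of closed balls is closed and therefore covers the closure too;
    the halved radius leaves room to return to open balls.\<close>
  have "closure ?S \<subseteq> (\<Union>y\<in>K. cball y (e/2))"
  proof (rule closure_minimal)
    show "?S \<subseteq> (\<Union>y\<in>K. cball y (e/2))" using K(2) ball_subset_cball by blast
  qed (intro closed_UN K(1) ballI closed_cball)
  also have "\<dots> \<subseteq> (\<Union>y\<in>K. ball y e)" using e by (intro UN_mono) auto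
  finally show "\<exists>k. finite k \<and> closure ?S \<subseteq> (\<Union>x\<in>k. ball x e)" using K(1) by blast
qed

section \<open>The superposition operator\<close>

definition mult_l2 :: "('a::euclidean_space \<Rightarrow> real) \<Rightarrow> ('a, real) l2 \<Rightarrow> ('a, real) l2" where
  "mult_l2 q U = abs_l2 (\<lambda>x. q x * rep_l2 U x)"

context
  fixes q :: "'a::euclidean_space \<Rightarrow> real" and M :: real
  assumes q [measurable]: "q \<in> borel_measurable borel" and M: "\<And>x. \<bar>q x\<bar> \<le> M"
begin

lemma mult_l2_bound_nonneg: "0 \<le> M"
  using M[of undefined] by linarith

lemma sq_integrable_mult:
  assumes "sq_integrable (v :: 'a \<Rightarrow> real)"
  shows "sq_integrable (\<lambda>x. q x * v x)"
proof -
  have [measurable]: "v \<in> borel_measurable borel" using assms by (simp add: sq_integrable_def)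
  have "integrable lborel (\<lambda>x. (norm (q x * v x))\<^sup>2)"
  proof (rule Bochner_Integration.integrable_bound)
    show "integrable lborel (\<lambda>x. M\<^sup>2 * (norm (v x))\<^sup>2)" using assms by (simp add: sq_integrable_def)
    have "norm ((norm (q x * v x))\<^sup>2) \<le> norm (M\<^sup>2 * (norm (v x))\<^sup>2)" for x
      using mult_right_mono[OF power_mono[OF M[of x], of 2], of "(v x)\<^sup>2"] by (simp add: power_mult_distrib)
    then show "AE x in lborel. norm ((norm (q x * v x))\<^sup>2) \<le> norm (M\<^sup>2 * (norm (v x))\<^sup>2)" by simp
  qed measurable
  then show ?thesis by (simp add: sq_integrable_def)
qed

lemma inner_mult_l2: "mult_l2 q U \<bullet> V = (\<integral>x. q x * rep_l2 U x * rep_l2 V x \<partial>lborel)"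
  using inner_abs_l2[OF sq_integrable_mult[OF sq_integrable_rep_l2[of U]] sq_integrable_rep_l2[of V]]
  by (simp add: mult_l2_def abs_rep_l2)

lemma integrable_mult_l2: "integrable lborel (\<lambda>x. q x * rep_l2 U x * rep_l2 V x)"
  using sq_integrable_inner[OF sq_integrable_mult[OF sq_integrable_rep_l2[of U]] sq_integrable_rep_l2[of V]]
  by simp

lemma norm_mult_l2_le: "norm (mult_l2 q U) \<le> M * norm U"
proof -
  have "(norm (mult_l2 q U))\<^sup>2 = (\<integral>x. (norm (q x * rep_l2 U x))\<^sup>2 \<partial>lborel)"
    unfolding mult_l2_def by (rule norm_abs_l2(1)[OF sq_integrable_mult[OF sq_integrable_rep_l2]])
  also have "\<dots> \<le> (\<integral>x. M\<^sup>2 * (norm (rep_l2 U x))\<^sup>2 \<partial>lborel)"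
  proof (rule integral_mono)
    show "(norm (q x * rep_l2 U x))\<^sup>2 \<le> M\<^sup>2 * (norm (rep_l2 U x))\<^sup>2" for x
      using mult_right_mono[OF power_mono[OF M[of x], of 2], of "(rep_l2 U x)\<^sup>2"] by (simp add: power_mult_distrib)
  qed (use sq_integrable_mult[OF sq_integrable_rep_l2[of U]] sq_integrable_rep_l2[of U]
      in \<open>auto simp: sq_integrable_def\<close>)
  also have "\<dots> = (M * norm U)\<^sup>2" by (simp add: power2_norm_l2(1) power_mult_distrib)
  finally show ?thesis using mult_l2_bound_nonneg by (auto intro: power2_le_imp_le)
qed

lemma bounded_linear_mult_l2: "bounded_linear (mult_l2 q)"
proof (rule bounded_linear_intro[where K = M])
  show "mult_l2 q (U + V) = mult_l2 q U + mult_l2 q V" for U V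
  proof -
    have "mult_l2 q U + mult_l2 q V = abs_l2 (\<lambda>x. 1 *\<^sub>R (q x * rep_l2 U x) + q x * rep_l2 V x)"
      unfolding abs_l2_scaleR_add[OF sq_integrable_mult[OF sq_integrable_rep_l2] sq_integrable_mult[OF sq_integrable_rep_l2]]
      by (simp add: mult_l2_def)
    also have "\<dots> = mult_l2 q (U + V)"
      unfolding mult_l2_def
      by (subst abs_l2_eq_iff)
        (use rep_l2_add[of U V] in \<open>auto intro!: sq_integrable_mult sq_integrable_rep_l2 sq_integrable_add simp: distrib_left\<close>)
    finally show ?thesis by simp
  qed
  show "mult_l2 q (c *\<^sub>R U) = c *\<^sub>R mult_l2 q U" for c U
  proof -
    have "c *\<^sub>R mult_l2 q U = abs_l2 (\<lambda>x. c *\<^sub>R (q x * rep_l2 U x) + 0)"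
      using abs_l2_scaleR_add[OF sq_integrable_mult[OF sq_integrable_rep_l2[of U]] sq_integrable_zero, of c]
      by (simp add: mult_l2_def zero_l2_def[symmetric])
    also have "\<dots> = mult_l2 q (c *\<^sub>R U)"
      unfolding mult_l2_def
      by (subst abs_l2_eq_iff)
        (use rep_l2_scaleR_add[of c U 0] rep_abs_l2[OF sq_integrable_zero] in
          \<open>auto intro!: sq_integrable_mult sq_integrable_rep_l2 sq_integrable_scaleR[where 'b = real, simplified]
            simp: zero_l2_def[symmetric] elim!: eventually_elim2\<close>)
    finally show ?thesis by simp
  qed
  show "norm (mult_l2 q U) \<le> norm U * M" for U using norm_mult_l2_le[of U] by (simp add: mult.commute)
qed

end

text \<open>The projection makes the embedding into L2 bounded on the whole type and zero on the
  orthogonal complement, as required of functionals in \<open>Hm1 \<Omega>\<close>.\<close>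

definition H10_l2 :: "(real^'n) set \<Rightarrow> 'n::finite h1 \<Rightarrow>\<^sub>L (real^'n, real) l2" where
  "H10_l2 \<Omega> = Blinfun (\<lambda>u. l2_of (orth_proj (H10 \<Omega>) u))"

text \<open>The bilinear form \<open>(h, z) \<mapsto> \<integral> q h z\<close> on \<open>H\<^sup>1\<^sub>0(\<Omega>)\<close>, extended by zero to the orthogonal complement.\<close>

definition mult_form :: "(real^'n) set \<Rightarrow> (real^'n \<Rightarrow> real) \<Rightarrow> 'n::finite h1 \<Rightarrow>\<^sub>L 'n h1 \<Rightarrow>\<^sub>L real" where
  "mult_form \<Omega> q = Blinfun (\<lambda>h. blinfun_inner_right (mult_l2 q (H10_l2 \<Omega> h)) o\<^sub>L H10_l2 \<Omega>)"

text \<open>L2 convergence gives pointwise convergence along subsequences only; this principle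
  recovers the limit of the full sequence.\<close>

lemma tendsto_zero_if_subseq:
  fixes X :: "nat \<Rightarrow> real"
  assumes "\<And>r :: nat \<Rightarrow> nat. strict_mono r \<Longrightarrow> \<exists>s :: nat \<Rightarrow> nat. strict_mono s \<and> (\<lambda>n. X (r (s n))) \<longlonglongrightarrow> 0"
  shows "X \<longlonglongrightarrow> 0"
proof (rule ccontr)
  assume "\<not> X \<longlonglongrightarrow> 0"
  then obtain e where e: "0 < e" "\<And>N. \<exists>n\<ge>N. e \<le> norm (X n)"
    unfolding LIMSEQ_iff by (metis diff_zero not_le)
  then have "infinite {n. e \<le> norm (X n)}"
    unfolding infinite_nat_iff_unbounded_le by blast
  then obtain r :: "nat \<Rightarrow> nat" where r: "strict_mono r" "\<And>n. e \<le> norm (X (r n))"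
    using infinite_enumerate by blast
  then obtain s where "(\<lambda>n. X (r (s n))) \<longlonglongrightarrow> 0" using assms[OF r(1)] by blast
  then have "\<exists>n. norm (X (r (s n))) < e" using e(1) unfolding LIMSEQ_iff by (metis diff_zero order_refl)
  with r(2) show False by (metis not_le)
qed

section \<open>The forms with bounded coefficients and their convergence through compactness\<close>

context
  fixes \<Omega> :: "(real^'n::finite) set"
  assumes open_\<Omega>: "open \<Omega>" and bounded_\<Omega>: "bounded \<Omega>"
begin

lemmas H10_complete_subspace = complete_H10[OF bounded_\<Omega>] subspace_H10[of \<Omega>]

lemma blinfun_apply_H10_l2: "blinfun_apply (H10_l2 \<Omega>) u = l2_of (orth_proj (H10 \<Omega>) u)"
proof -
  obtain C where C: "0 < C" "\<And>u. u \<in> H10 \<Omega> \<Longrightarrow> norm (l2_of u) \<le> C * norm u"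
    using Poincare[OF bounded_\<Omega>] by blast
  interpret P: bounded_linear "orth_proj (H10 \<Omega>)"
    by (rule bounded_linear_orth_proj[OF H10_complete_subspace])
  have "bounded_linear (\<lambda>u. l2_of (orth_proj (H10 \<Omega>) u))"
  proof (rule bounded_linear_intro[where K = C])
    fix u
    have "norm (l2_of (orth_proj (H10 \<Omega>) u)) \<le> C * norm (orth_proj (H10 \<Omega>) u)"
      by (rule C(2)) (rule orth_proj(1)[OF H10_complete_subspace])
    also have "\<dots> \<le> C * norm u"
      using C(1) by (intro mult_left_mono norm_orth_proj_le H10_complete_subspace) auto
    finally show "norm (l2_of (orth_proj (H10 \<Omega>) u)) \<le> norm u * C" by (simp add: mult.commute)
  qed (simp_all add: P.add P.scaleR)
  then show ?thesis by (simp add: H10_l2_def bounded_linear_Blinfun_apply)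
qed

lemma H10_l2_H10: "u \<in> H10 \<Omega> \<Longrightarrow> blinfun_apply (H10_l2 \<Omega>) u = l2_of u"
  by (simp add: blinfun_apply_H10_l2 orth_proj_id[OF H10_complete_subspace])

lemma H10_l2_orthogonal_comp: "z \<in> orthogonal_comp (H10 \<Omega>) \<Longrightarrow> blinfun_apply (H10_l2 \<Omega>) z = 0"
proof -
  assume "z \<in> orthogonal_comp (H10 \<Omega>)"
  then have "orth_proj (H10 \<Omega>) z = 0"
    by (intro orth_proj_unique[OF H10_complete_subspace] subspace_0 subspace_H10)
      (auto simp: orthogonal_comp_def orthogonal_def inner_commute)
  then show ?thesis by (simp add: blinfun_apply_H10_l2)
qed

lemma blinfun_apply_mult_form:
  assumes "q \<in> borel_measurable borel" "\<And>x. \<bar>q x\<bar> \<le> M"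
  shows "blinfun_apply (mult_form \<Omega> q) h = blinfun_inner_right (mult_l2 q (H10_l2 \<Omega> h)) o\<^sub>L H10_l2 \<Omega>"
proof -
  have "bounded_linear (\<lambda>h. blinfun_inner_right (mult_l2 q (H10_l2 \<Omega> h)) o\<^sub>L H10_l2 \<Omega>)"
    by (intro bounded_linear_compose[OF bounded_bilinear.bounded_linear_left[OF bounded_bilinear_blinfun_compose]]
        bounded_linear_compose[OF bounded_linear_blinfun_inner_right]
        bounded_linear_compose[OF bounded_linear_mult_l2[OF assms]] blinfun.bounded_linear_right)
  then show ?thesis by (simp add: mult_form_def bounded_linear_Blinfun_apply)
qed

lemma mult_form_apply:
  assumes "q \<in> borel_measurable borel" "\<And>x. \<bar>q x\<bar> \<le> M"
  shows "mult_form \<Omega> q h z = mult_l2 q (H10_l2 \<Omega> h) \<bullet> H10_l2 \<Omega> z"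
  by (simp add: blinfun_apply_mult_form[OF assms])

lemma mult_form_diff:
  assumes "q \<in> borel_measurable borel" "\<And>x. \<bar>q x\<bar> \<le> M" "q' \<in> borel_measurable borel" "\<And>x. \<bar>q' x\<bar> \<le> M'"
  shows "mult_form \<Omega> q - mult_form \<Omega> q' = mult_form \<Omega> (\<lambda>x. q x - q' x)"
proof (intro blinfun_eqI)
  fix h z
  have m: "(\<lambda>x. q x - q' x) \<in> borel_measurable borel" using assms(1,3) by (rule borel_measurable_diff)
  have b: "\<bar>q x - q' x\<bar> \<le> M + M'" for x
    using assms(2,4)[of x] by linarith
  let ?U = "rep_l2 (H10_l2 \<Omega> h)" and ?V = "rep_l2 (H10_l2 \<Omega> z)"
  have "(\<integral>x. q x * ?U x * ?V x \<partial>lborel) - (\<integral>x. q' x * ?U x * ?V x \<partial>lborel)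
      = (\<integral>x. q x * ?U x * ?V x - q' x * ?U x * ?V x \<partial>lborel)"
    by (rule Bochner_Integration.integral_diff[symmetric])
      (rule integrable_mult_l2[OF assms(1,2)] integrable_mult_l2[OF assms(3,4)])+
  also have "\<dots> = (\<integral>x. (q x - q' x) * ?U x * ?V x \<partial>lborel)"
    by (simp add: left_diff_distrib)
  finally show "(mult_form \<Omega> q - mult_form \<Omega> q') h z = mult_form \<Omega> (\<lambda>x. q x - q' x) h z"
    unfolding blinfun.diff_left mult_form_apply[OF m b] mult_form_apply[OF assms(1,2)] mult_form_apply[OF assms(3,4)]
      inner_mult_l2[OF m b] inner_mult_l2[OF assms(1,2)] inner_mult_l2[OF assms(3,4)] .
qed

text \<open>For two fixed L2 functions this is dominated convergence. Rellich's theorem replaces the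
  image of the unit ball by a finite net, so finitely many such limits control the operator
  norm.\<close>

lemma mult_form_tendsto_0:
  assumes Q: "\<And>n. Q n \<in> borel_measurable borel" and M: "\<And>n x. \<bar>Q n x\<bar> \<le> M"
    and lim: "AE x in lborel. (\<lambda>n. Q n x) \<longlonglongrightarrow> 0"
  shows "(\<lambda>n. norm (mult_form \<Omega> (Q n))) \<longlonglongrightarrow> 0"
proof -
  obtain C where C: "0 < C" "\<And>u. u \<in> H10 \<Omega> \<Longrightarrow> norm (l2_of u) \<le> C * norm u"
    using Poincare[OF bounded_\<Omega>] by blast
  have M0: "0 \<le> M" using M[of undefined undefined] by linarith
  define T where "T = l2_of ` (H10 \<Omega> \<inter> cball 0 1)"
  have TC: "norm y \<le> C" if "y \<in> T" for y
    using that C(1) by (auto simp: T_def intro!: order_trans[OF C(2) mult_left_le])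
  note [measurable] = Q
  have lim_inner: "(\<lambda>n. mult_l2 (Q n) y \<bullet> w) \<longlonglongrightarrow> 0" for y w
  proof -
    have i: "integrable lborel (\<lambda>x. rep_l2 y x * rep_l2 w x)"
      using sq_integrable_inner[OF sq_integrable_rep_l2[of y] sq_integrable_rep_l2[of w]] by simp
    have "(\<lambda>n. \<integral>x. Q n x * rep_l2 y x * rep_l2 w x \<partial>lborel) \<longlonglongrightarrow> (\<integral>x. 0 \<partial>(lborel :: (real^'n) measure))"
    proof (rule integral_dominated_convergence[where w = "\<lambda>x. M * \<bar>rep_l2 y x * rep_l2 w x\<bar>"])
      show "integrable lborel (\<lambda>x. M * \<bar>rep_l2 y x * rep_l2 w x\<bar>)" using i by auto
      show "AE x in lborel. (\<lambda>n. Q n x * rep_l2 y x * rep_l2 w x) \<longlonglongrightarrow> 0"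
        using lim by eventually_elim (auto intro!: tendsto_mult_left_zero)
      show "AE x in lborel. norm (Q n x * rep_l2 y x * rep_l2 w x) \<le> M * \<bar>rep_l2 y x * rep_l2 w x\<bar>" for n
        using M[of n] by (auto simp: abs_mult mult.assoc intro!: mult_right_mono)
    qed measurable
    then show ?thesis by (simp add: inner_mult_l2[OF Q M])
  qed
  show ?thesis
  proof (rule tendstoI)
    fix e :: real assume e: "0 < e"
    \<comment> \<open>Replacing each argument by a net point costs at most
      \<open>M * C * \<eta>\<close>, hence \<open>e / 8\<close>. Together with \<open>e / 4\<close>
      on the net this gives \<open>e / 2\<close>. The \<open>+ 1\<close> keeps the quotient defined
      for \<open>M = 0\<close>.\<close>
    define \<eta> where "\<eta> = e / (8 * (M * C + 1))"
    have MC: "0 \<le> M * C" using M0 C by simp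
    have \<eta>: "0 < \<eta>" using e MC by (simp add: \<eta>_def)
    have "M * C * \<eta> = e / 8 * (M * C / (M * C + 1))" by (simp add: \<eta>_def)
    also have "\<dots> \<le> e / 8 * 1" using e MC by (intro mult_left_mono) auto
    finally have \<eta>': "M * C * \<eta> \<le> e / 8" by simp
    obtain K where K: "finite K" "K \<subseteq> T" "T \<subseteq> (\<Union>y\<in>K. ball y \<eta>)"
      unfolding T_def by (rule Rellich_finite_net[OF open_\<Omega> bounded_\<Omega> \<eta>])
    have "\<forall>\<^sub>F n in sequentially. \<forall>y\<in>K. \<forall>w\<in>K. \<bar>mult_l2 (Q n) y \<bullet> w\<bar> < e / 4"
    proof (intro eventually_ball_finite K(1) ballI)
      fix y w
      have "0 < e / 4" using e by simp
      from tendstoD[OF lim_inner[of y w] this]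
      show "\<forall>\<^sub>F n in sequentially. \<bar>mult_l2 (Q n) y \<bullet> w\<bar> < e / 4" by simp
    qed
    then show "\<forall>\<^sub>F n in sequentially. dist (norm (mult_form \<Omega> (Q n))) 0 < e"
    proof eventually_elim
      case (elim n)
      interpret m: bounded_linear "mult_l2 (Q n)" by (rule bounded_linear_mult_l2[OF Q M])
      have net: "\<exists>y'\<in>K. norm (y - y') \<le> \<eta>" if "y \<in> T" for y
      proof -
        obtain y' where "y' \<in> K" "y \<in> ball y' \<eta>" using K(3) \<open>y \<in> T\<close> by blast
        then show ?thesis by (intro bexI[of _ y']) (auto simp: dist_norm norm_minus_commute)
      qed
      have unit: "\<bar>mult_l2 (Q n) y \<bullet> w\<bar> \<le> e / 2" if yw: "y \<in> T" "w \<in> T" for y w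
      proof -
        obtain y' where y': "y' \<in> K" "norm (y - y') \<le> \<eta>"
          using net[OF yw(1)] by blast
        obtain w' where w': "w' \<in> K" "norm (w - w') \<le> \<eta>"
          using net[OF yw(2)] by blast
        have b: "\<bar>mult_l2 (Q n) a \<bullet> c\<bar> \<le> M * norm a * norm c" for a c
          using Cauchy_Schwarz_ineq2[of "mult_l2 (Q n) a" c]
            mult_right_mono[OF norm_mult_l2_le[OF Q M, of n a] norm_ge_zero[of c]] by linarith
        have "\<bar>mult_l2 (Q n) (y - y') \<bullet> w\<bar> \<le> M * \<eta> * C"
          using M0 y' TC[OF yw(2)] \<eta> by (intro order_trans[OF b] mult_mono) auto
        moreover have "\<bar>mult_l2 (Q n) y' \<bullet> (w - w')\<bar> \<le> M * C * \<eta>"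
          using M0 w' TC[of y'] y' K(2) \<eta> C(1) by (intro order_trans[OF b] mult_mono) auto
        moreover have "\<bar>mult_l2 (Q n) y' \<bullet> w'\<bar> < e / 4" using elim y' w' by blast
        moreover have "mult_l2 (Q n) y \<bullet> w
            = mult_l2 (Q n) y' \<bullet> w' + mult_l2 (Q n) (y - y') \<bullet> w + mult_l2 (Q n) y' \<bullet> (w - w')"
          by (simp add: m.diff inner_diff)
        moreover have "M * \<eta> * C = M * C * \<eta>" by simp
        ultimately show ?thesis using \<eta>' by linarith
      qed
      \<comment> \<open>Homogeneity reduces general arguments to the image of the unit ball.
        Dividing by \<open>norm h\<close> is enough because the projection does not increase
        norms.\<close>
      have scale: "\<exists>y\<in>T. H10_l2 \<Omega> h = norm h *\<^sub>R y" for h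
      proof (cases "h = 0")
        case True
        have "l2_of 0 \<in> T" unfolding T_def by (intro imageI) (simp add: subspace_0[OF subspace_H10])
        then show ?thesis using True by auto
      next
        case False
        let ?p = "orth_proj (H10 \<Omega>) h"
        have "(1 / norm h) *\<^sub>R ?p \<in> H10 \<Omega> \<inter> cball 0 1"
          using False norm_orth_proj_le[OF H10_complete_subspace, of h] orth_proj(1)[OF H10_complete_subspace, of h]
          by (auto simp: subspace_scale[OF subspace_H10] divide_simps)
        then have "l2_of ((1 / norm h) *\<^sub>R ?p) \<in> T" unfolding T_def by (rule imageI)
        moreover have "H10_l2 \<Omega> h = norm h *\<^sub>R l2_of ((1 / norm h) *\<^sub>R ?p)"
          using False by (simp add: blinfun_apply_H10_l2)
        ultimately show ?thesis by blast
      qed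
      have "norm (mult_form \<Omega> (Q n)) \<le> e / 2"
      proof (intro norm_blinfun_bound)
        fix h z
        obtain y w where "y \<in> T" "H10_l2 \<Omega> h = norm h *\<^sub>R y" "w \<in> T" "H10_l2 \<Omega> z = norm z *\<^sub>R w"
          using scale by metis
        then show "norm (mult_form \<Omega> (Q n) h z) \<le> e / 2 * norm h * norm z"
          using mult_right_mono[OF unit[of y w], of "norm h * norm z"]
          by (simp add: mult_form_apply[OF Q M] m.scaleR abs_mult mult_ac)
      qed (use e in auto)
      then show ?case using e by simp
    qed
  qed
qed

lemma tendsto_l2_of:
  assumes "\<And>n. U n \<in> H10 \<Omega>" "u \<in> H10 \<Omega>" "U \<longlonglongrightarrow> u"
  shows "(\<lambda>n. l2_of (U n)) \<longlonglongrightarrow> l2_of u"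
  using blinfun.tendsto[OF tendsto_const[of "H10_l2 \<Omega>"] assms(3)] assms(1,2) by (simp add: H10_l2_H10)

text \<open>Serves both the differentiability of the semilinear map and the continuity of its
  derivative. Every subsequence of \<open>U\<close> has a further one converging almost everywhere,
  and along it \<open>k\<close> tends to 0 pointwise.\<close>

lemma mult_form_superposition_tendsto_0:
  assumes k: "\<And>w. (\<lambda>x. indicator \<Omega> x * k x (h1_fun w x)) \<in> borel_measurable borel"
    and M: "\<And>x t. x \<in> \<Omega> \<Longrightarrow> \<bar>k x t\<bar> \<le> M"
    and lim: "\<And>x t. x \<in> \<Omega> \<Longrightarrow> t \<longlonglongrightarrow> h1_fun u x \<Longrightarrow> (\<lambda>n::nat. k x (t n)) \<longlonglongrightarrow> 0"
    and U: "\<And>n. U n \<in> H10 \<Omega>" "u \<in> H10 \<Omega>" "U \<longlonglongrightarrow> u"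
  shows "(\<lambda>n. norm (mult_form \<Omega> (\<lambda>x. indicator \<Omega> x * k x (h1_fun (U n) x)))) \<longlonglongrightarrow> 0"
proof (rule tendsto_zero_if_subseq)
  fix r :: "nat \<Rightarrow> nat" assume r: "strict_mono r"
  have "(\<lambda>n. l2_of (U (r n))) \<longlonglongrightarrow> l2_of u"
    using LIMSEQ_subseq_LIMSEQ[OF tendsto_l2_of[OF U] r] by (simp add: o_def)
  then obtain s where s: "strict_mono s"
    "AE x in lborel. (\<lambda>n. rep_l2 (l2_of (U (r (s n)))) x) \<longlonglongrightarrow> rep_l2 (l2_of u) x"
    by (rule tendsto_l2_AE_subseq)
  from s(2) have "AE x in lborel. (\<lambda>n. indicator \<Omega> x * k x (h1_fun (U (r (s n))) x)) \<longlonglongrightarrow> 0"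
  proof eventually_elim
    case (elim x)
    then show ?case by (cases "x \<in> \<Omega>") (auto intro!: lim simp: h1_fun_def l2_of_def)
  qed
  moreover have "\<bar>indicator \<Omega> x * k x t\<bar> \<le> \<bar>M\<bar>" for x t
    using M[of x t] by (cases "x \<in> \<Omega>") auto
  ultimately have "(\<lambda>n. norm (mult_form \<Omega> (\<lambda>x. indicator \<Omega> x * k x (h1_fun (U (r (s n))) x)))) \<longlonglongrightarrow> 0"
    by (intro mult_form_tendsto_0[where M = "\<bar>M\<bar>"] k)
  with s(1) show "\<exists>s. strict_mono s \<and>
      (\<lambda>n. norm (mult_form \<Omega> (\<lambda>x. indicator \<Omega> x * k x (h1_fun (U (r (s n))) x)))) \<longlonglongrightarrow> 0"
    by blast
qed

text \<open>Uniqueness behind the description operator: \<open>x\<close> splits into its projection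
  to \<open>H10 \<Omega>\<close>, where the values are prescribed, and a part in the complement,
  where members of \<open>Hm1 \<Omega>\<close> vanish.\<close>

lemma functional_eqI:
  assumes g: "g \<in> Hm1 \<Omega>" "\<And>z. z \<in> H10 \<Omega> \<Longrightarrow> blinfun_apply g z = l z"
  shows "functional \<Omega> l = g"
  unfolding functional_def
proof (rule the_equality)
  show "g \<in> Hm1 \<Omega> \<and> (\<forall>z\<in>H10 \<Omega>. blinfun_apply g z = l z)" using g by blast
  fix g' assume g': "g' \<in> Hm1 \<Omega> \<and> (\<forall>z\<in>H10 \<Omega>. blinfun_apply g' z = l z)"
  show "g' = g"
  proof (rule blinfun_eqI)
    fix x
    let ?p = "orth_proj (H10 \<Omega>) x"
    have p: "?p \<in> H10 \<Omega>" by (rule orth_proj(1)[OF H10_complete_subspace])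
    have "x - ?p \<in> orthogonal_comp (H10 \<Omega>)"
      using orth_proj(2)[OF H10_complete_subspace]
      by (auto simp: orthogonal_comp_def orthogonal_def inner_diff inner_commute)
    then have "g' (x - ?p) = 0" "g (x - ?p) = 0" using g g' by (auto simp: Hm1_def)
    moreover have "g' ?p = g ?p" using g g' p by simp
    ultimately show "g' x = g x" by (simp add: blinfun.bilinear_simps)
  qed
qed

end

section \<open>Difference quotients of the nonlinearity and the superposition operator\<close>

text \<open>The diagonal value is the limit of the quotients, so the range bounds and the
  convergence at the diagonal hold there as well.\<close>

definition slope :: "('a \<times> real \<Rightarrow> real) \<Rightarrow> 'a \<Rightarrow> real \<Rightarrow> real \<Rightarrow> real" where
  "slope f x s t = (if s = t then partial2 f (x, s) else (f (x, s) - f (x, t)) / (s - t))"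

lemma slope_eq: "f (x, s) - f (x, t) = slope f x s t * (s - t)"
  by (simp add: slope_def)

definition nemytskii :: "(real^'n) set \<Rightarrow> ((real^'n) \<times> real \<Rightarrow> real) \<Rightarrow> 'n::finite h1 \<Rightarrow> (real^'n, real) l2" where
  "nemytskii \<Omega> f u = abs_l2 (\<lambda>x. indicator \<Omega> x * f (x, h1_fun u x))"

lemma borel_measurable_h1_fun [measurable]: "h1_fun u \<in> borel_measurable borel"
  unfolding h1_fun_def by measurable

text \<open>\<open>g\<close> is controlled on \<Omega> only. Its extension by zero off the open set
  \<open>\<Omega> \<times> UNIV\<close> is Borel, and the map \<open>x\<close> to
  \<open>(x, v x)\<close> is measurable.\<close>

lemma borel_measurable_superposition:
  fixes \<Omega> :: "'a::euclidean_space set" and g :: "'a \<times> real \<Rightarrow> real"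
  assumes \<Omega>: "open \<Omega>" and g: "continuous_on (\<Omega> \<times> UNIV) g" and v [measurable]: "v \<in> borel_measurable borel"
  shows "(\<lambda>x. indicator \<Omega> x * g (x, v x)) \<in> borel_measurable borel"
proof -
  have "\<Omega> \<times> (UNIV :: real set) \<in> sets borel" using \<Omega> by (intro borel_open open_Times) auto
  then have [measurable]: "(\<lambda>p. indicator (\<Omega> \<times> UNIV) p *\<^sub>R g p) \<in> borel_measurable borel"
    by (rule borel_measurable_continuous_on_indicator[OF _ g])
  have "(\<lambda>x. indicator (\<Omega> \<times> UNIV) (x, v x) *\<^sub>R g (x, v x)) \<in> borel_measurable borel"
    by measurable
  then show ?thesis by (simp add: indicator_def of_bool_def)
qed

context
  fixes \<Omega> :: "(real^'n::finite) set" and f :: "(real^'n) \<times> real \<Rightarrow> real" and a b :: real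
  assumes open_\<Omega>: "open \<Omega>" and bounded_\<Omega>: "bounded \<Omega>" and appropriate: "appropriate \<Omega> f"
    and partial2_range: "\<forall>x\<in>\<Omega>. \<forall>t. a \<le> partial2 f (x, t) \<and> partial2 f (x, t) \<le> b"
begin

lemma partial2_bounds: "x \<in> \<Omega> \<Longrightarrow> a \<le> partial2 f (x, t) \<and> partial2 f (x, t) \<le> b"
  using partial2_range by blast

lemma DERIV_partial2: "x \<in> \<Omega> \<Longrightarrow> ((\<lambda>t. f (x, t)) has_real_derivative partial2 f (x, t)) (at t)"
    and continuous_on_partial2: "continuous_on (\<Omega> \<times> UNIV) (partial2 f)"
    and continuous_on_appropriate: "continuous_on (\<Omega> \<times> UNIV) f"
proof -
  obtain f' where f': "\<And>p. p \<in> \<Omega> \<times> UNIV \<Longrightarrow> (f has_derivative blinfun_apply (f' p)) (at p within \<Omega> \<times> UNIV)"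
    and c: "continuous_on (\<Omega> \<times> UNIV) f'"
    using appropriate by (auto simp: appropriate_def C1_on_def)
  have o: "open (\<Omega> \<times> (UNIV :: real set))" using open_\<Omega> by (intro open_Times) auto
  have d: "((\<lambda>t. f (x, t)) has_real_derivative f' (x, t) (0, 1)) (at t)" if "x \<in> \<Omega>" for x t
  proof -
    have "(f has_derivative blinfun_apply (f' (x, t))) (at (x, t))"
      using f'[of "(x, t)"] that at_within_open[OF _ o, of "(x, t)"] by simp
    moreover have "((\<lambda>t. (x, t)) has_derivative (\<lambda>h. (0, h))) (at t)"
      by (auto intro!: derivative_eq_intros)
    ultimately have "((\<lambda>t. f (x, t)) has_derivative (\<lambda>h. f' (x, t) (0, h))) (at t)"
      by (rule has_derivative_compose[rotated])
    moreover have "(\<lambda>h. f' (x, t) (0, h)) = (*) (f' (x, t) (0, 1))"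
    proof
      show "f' (x, t) (0, h) = f' (x, t) (0, 1) * h" for h
        using blinfun.scaleR_right[of "f' (x, t)" h "(0, 1)"] by simp
    qed
    ultimately show ?thesis by (simp only: has_field_derivative_def)
  qed
  have p: "partial2 f p = f' p (0, 1)" if "p \<in> \<Omega> \<times> UNIV" for p
    using that DERIV_imp_deriv[OF d] by (auto simp: partial2_def)
  show "x \<in> \<Omega> \<Longrightarrow> ((\<lambda>t. f (x, t)) has_real_derivative partial2 f (x, t)) (at t)"
    using d p by simp
  have "continuous_on (\<Omega> \<times> UNIV) (\<lambda>p. f' p (0, 1))" by (intro continuous_intros c)
  then show "continuous_on (\<Omega> \<times> UNIV) (partial2 f)" by (rule continuous_on_eq) (simp add: p)
  show "continuous_on (\<Omega> \<times> UNIV) f"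
    unfolding continuous_on_eq_continuous_within using has_derivative_continuous[OF f'] by blast
qed

lemma slope_bounds:
  assumes x: "x \<in> \<Omega>"
  shows "a \<le> slope f x s t \<and> slope f x s t \<le> b"
proof -
  have *: "a \<le> slope f x s t \<and> slope f x s t \<le> b" if st: "s < t" for s t
  proof -
    obtain z where "f (x, t) - f (x, s) = (t - s) * partial2 f (x, z)"
      using MVT2[OF st, of "\<lambda>t. f (x, t)" "\<lambda>t. partial2 f (x, t)"] DERIV_partial2[OF x] by blast
    then have "slope f x s t = partial2 f (x, z)" using st by (simp add: slope_def field_simps)
    then show ?thesis using partial2_bounds[OF x] by simp
  qed
  have sym: "slope f x s t = slope f x t s"
    by (simp add: slope_def) (metis minus_diff_eq minus_divide_divide)
  show ?thesis
    using *[of s t] *[of t s] sym partial2_bounds[OF x, of s]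
    by (cases s t rule: linorder_cases) (auto simp: slope_def)
qed

text \<open>For fixed \<open>t\<close> the quotient in its first argument is exactly Caratheodory's
  function for the derivative at \<open>t\<close>, which is continuous there.\<close>

lemma slope_tendsto:
  assumes x: "x \<in> \<Omega>" and t: "X \<longlonglongrightarrow> t"
  shows "(\<lambda>n. slope f x (X n) t) \<longlonglongrightarrow> partial2 f (x, t)"
proof -
  obtain g where g: "\<And>z. f (x, z) - f (x, t) = g z * (z - t)" "isCont g t" "g t = partial2 f (x, t)"
    using DERIV_partial2[OF x, of t, unfolded CARAT_DERIV] by blast
  have "g z = slope f x z t" for z
    using g(1)[of z] g(3) by (simp add: slope_def)
  then show ?thesis using isCont_tendsto_compose[OF g(2) t] g(3) by simp
qed

abbreviation (input) bnd :: real where "bnd \<equiv> max \<bar>a\<bar> \<bar>b\<bar>"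

definition slope_coeff :: "'n h1 \<Rightarrow> 'n h1 \<Rightarrow> real^'n \<Rightarrow> real" where
  "slope_coeff u v x = indicator \<Omega> x * slope f x (h1_fun u x) (h1_fun v x)"

definition partial2_coeff :: "'n h1 \<Rightarrow> real^'n \<Rightarrow> real" where
  "partial2_coeff u x = indicator \<Omega> x * partial2 f (x, h1_fun u x)"

lemma nemytskii_measurable [measurable]:
  "(\<lambda>x. indicator \<Omega> x * f (x, h1_fun u x)) \<in> borel_measurable borel"
  "partial2_coeff u \<in> borel_measurable borel"
  "slope_coeff u v \<in> borel_measurable borel"
proof -
  show 1: "(\<lambda>x. indicator \<Omega> x * f (x, h1_fun u x)) \<in> borel_measurable borel" for u
    by (rule borel_measurable_superposition[OF open_\<Omega> continuous_on_appropriate borel_measurable_h1_fun])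
  show 2: "partial2_coeff u \<in> borel_measurable borel" for u
    unfolding partial2_coeff_def[abs_def]
    by (rule borel_measurable_superposition[OF open_\<Omega> continuous_on_partial2 borel_measurable_h1_fun])
  note [measurable] = 1 2
  \<comment> \<open>Measurability comes from measurable pieces: the derivative where
    \<open>u\<close> and \<open>v\<close> agree, a quotient of measurable functions
    elsewhere.\<close>
  have "slope_coeff u v = (\<lambda>x. if h1_fun u x = h1_fun v x then partial2_coeff u x
      else (indicator \<Omega> x * f (x, h1_fun u x) - indicator \<Omega> x * f (x, h1_fun v x)) / (h1_fun u x - h1_fun v x))"
    by (auto simp: slope_coeff_def slope_def partial2_coeff_def indicator_def)
  also have "\<dots> \<in> borel_measurable borel" by measurable
  finally show "slope_coeff u v \<in> borel_measurable borel" .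
qed

lemma coeff_bounds: "\<bar>slope_coeff u v x\<bar> \<le> bnd" "\<bar>partial2_coeff u x\<bar> \<le> bnd"
  using slope_bounds[of x "h1_fun u x" "h1_fun v x"] partial2_bounds[of x "h1_fun u x"]
  by (auto simp: slope_coeff_def partial2_coeff_def indicator_def)

text \<open>Linear growth: \<open>f (x, u)\<close> is \<open>f (x, 0)\<close>, square-integrable by
  hypothesis, plus a bounded difference quotient times \<open>u\<close>.\<close>

lemma sq_integrable_nemytskii: "sq_integrable (\<lambda>x. indicator \<Omega> x * f (x, h1_fun u x))"
proof -
  have h0: "sq_integrable (\<lambda>x. indicator \<Omega> x * f (x, 0))"
  proof -
    have "(\<lambda>x. indicator \<Omega> x * f (x, 0)) \<in> borel_measurable borel"
      by (rule borel_measurable_superposition[OF open_\<Omega> continuous_on_appropriate]) simp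
    moreover have "integrable lborel (\<lambda>x. indicator \<Omega> x *\<^sub>R (f (x, 0))\<^sup>2)"
      using appropriate by (simp add: appropriate_def set_integrable_def)
    moreover have "(\<lambda>x. (norm (indicator \<Omega> x * f (x, 0)))\<^sup>2) = (\<lambda>x. indicator \<Omega> x *\<^sub>R (f (x, 0))\<^sup>2)"
      by (auto simp: indicator_def)
    ultimately show ?thesis by (simp add: sq_integrable_def)
  qed
  define q where "q x = indicator \<Omega> x * slope f x (h1_fun u x) 0" for x
  have q: "indicator \<Omega> x * f (x, h1_fun u x) = q x * h1_fun u x + indicator \<Omega> x * f (x, 0)" for x
    using slope_eq[of f x "h1_fun u x" 0] by (simp add: q_def indicator_def)
  have bq: "\<bar>q x\<bar> \<le> bnd" for x
    using slope_bounds[of x "h1_fun u x" 0] by (auto simp: q_def indicator_def)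
  have [measurable]: "(\<lambda>x. indicator \<Omega> x * f (x, 0)) \<in> borel_measurable borel"
    using h0 by (simp add: sq_integrable_def)
  have "sq_integrable (\<lambda>x. q x * h1_fun u x)"
    unfolding sq_integrable_def
  proof
    have "(\<lambda>x. q x * h1_fun u x) = (\<lambda>x. indicator \<Omega> x * f (x, h1_fun u x) - indicator \<Omega> x * f (x, 0))"
      by (simp add: q)
    then show m [measurable]: "(\<lambda>x. q x * h1_fun u x) \<in> borel_measurable lborel" by simp
    show "integrable lborel (\<lambda>x. (norm (q x * h1_fun u x))\<^sup>2)"
    proof (rule Bochner_Integration.integrable_bound)
      show "integrable lborel (\<lambda>x. bnd\<^sup>2 * (norm (h1_fun u x))\<^sup>2)"
        using sq_integrable_rep_l2[of "fst (Rep_h1 u)"] by (simp add: sq_integrable_def h1_fun_def)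
      have "norm ((norm (q x * h1_fun u x))\<^sup>2) \<le> norm (bnd\<^sup>2 * (norm (h1_fun u x))\<^sup>2)" for x
        using mult_right_mono[OF power_mono[OF bq[of x], of 2], of "(h1_fun u x)\<^sup>2"]
        by (simp add: power_mult_distrib)
      then show "AE x in lborel. norm ((norm (q x * h1_fun u x))\<^sup>2) \<le> norm (bnd\<^sup>2 * (norm (h1_fun u x))\<^sup>2)"
        by simp
    qed measurable
  qed
  then show ?thesis unfolding q by (rule sq_integrable_add[OF _ h0])
qed

lemma nemytskii_diff: "nemytskii \<Omega> f u - nemytskii \<Omega> f v = mult_l2 (slope_coeff u v) (l2_of (u - v))"
proof -
  let ?F = "\<lambda>u x. indicator \<Omega> x * f (x, h1_fun u x)"
  have "nemytskii \<Omega> f u - nemytskii \<Omega> f v = abs_l2 (\<lambda>x. (-1) *\<^sub>R ?F v x + ?F u x)"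
    unfolding abs_l2_scaleR_add[OF sq_integrable_nemytskii sq_integrable_nemytskii]
    by (simp add: nemytskii_def)
  also have "\<dots> = mult_l2 (slope_coeff u v) (l2_of (u - v))"
    unfolding mult_l2_def
  proof (subst abs_l2_eq_iff)
    show "sq_integrable (\<lambda>x. (-1) *\<^sub>R ?F v x + ?F u x)"
      by (intro sq_integrable_add sq_integrable_scaleR sq_integrable_nemytskii)
    show "sq_integrable (\<lambda>x. slope_coeff u v x * rep_l2 (l2_of (u - v)) x)"
      by (intro sq_integrable_mult[OF nemytskii_measurable(3) coeff_bounds(1)] sq_integrable_rep_l2)
    show "AE x in lborel. (-1) *\<^sub>R ?F v x + ?F u x = slope_coeff u v x * rep_l2 (l2_of (u - v)) x"
      using rep_l2_diff[of "l2_of u" "l2_of v"]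
    proof eventually_elim
      case (elim x)
      then show ?case
        using slope_eq[of f x "h1_fun u x" "h1_fun v x"]
        by (simp add: slope_coeff_def h1_fun_def l2_of_def[symmetric] indicator_def)
    qed
  qed
  finally show ?thesis .
qed

section \<open>The semilinear map and its derivative\<close>

lemma semilinear_map_eq:
  assumes u: "u \<in> H10 \<Omega>"
  shows "semilinear_map \<Omega> f u = neg_laplace u - (blinfun_inner_right (nemytskii \<Omega> f u) o\<^sub>L H10_l2 \<Omega>)"
  unfolding semilinear_map_def
proof (rule functional_eqI[OF open_\<Omega> bounded_\<Omega>])
  show "neg_laplace u - (blinfun_inner_right (nemytskii \<Omega> f u) o\<^sub>L H10_l2 \<Omega>) \<in> Hm1 \<Omega>"
    using neg_laplace_in_Hm1[OF u]
    by (auto simp: Hm1_def blinfun.bilinear_simps H10_l2_orthogonal_comp[OF open_\<Omega> bounded_\<Omega>])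
  fix z :: "'n h1" assume z: "z \<in> H10 \<Omega>"
  have "nemytskii \<Omega> f u \<bullet> l2_of z = nemytskii \<Omega> f u \<bullet> abs_l2 (h1_fun z)"
    by (simp add: h1_fun_def abs_rep_l2 l2_of_def)
  also have "\<dots> = (\<integral>x. (indicator \<Omega> x * f (x, h1_fun u x)) * h1_fun z x \<partial>lborel)"
    using inner_abs_l2[OF sq_integrable_nemytskii[of u] sq_integrable_rep_l2[of "l2_of z"]]
    by (simp add: nemytskii_def h1_fun_def l2_of_def)
  also have "\<dots> = (LINT x:\<Omega>|lborel. f (x, h1_fun u x) * h1_fun z x)"
    by (simp add: set_lebesgue_integral_def mult.assoc)
  finally show "(neg_laplace u - (blinfun_inner_right (nemytskii \<Omega> f u) o\<^sub>L H10_l2 \<Omega>)) z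
      = u \<bullet> z - (LINT x:\<Omega>|lborel. f (x, h1_fun u x) * h1_fun z x)"
    by (simp add: neg_laplace_def blinfun.bilinear_simps H10_l2_H10[OF open_\<Omega> bounded_\<Omega> z])
qed

lemma semilinear_map_in_Hm1:
  assumes u: "u \<in> H10 \<Omega>"
  shows "semilinear_map \<Omega> f u \<in> Hm1 \<Omega>"
  using neg_laplace_in_Hm1[OF u]
  by (auto simp: Hm1_def semilinear_map_eq[OF u] blinfun.bilinear_simps H10_l2_orthogonal_comp[OF open_\<Omega> bounded_\<Omega>])

lemma semilinear_map_diff:
  assumes u: "u \<in> H10 \<Omega>" and v: "v \<in> H10 \<Omega>"
  shows "semilinear_map \<Omega> f u - semilinear_map \<Omega> f v
    = neg_laplace (u - v) - mult_form \<Omega> (slope_coeff u v) (u - v)"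
proof -
  have uv: "u - v \<in> H10 \<Omega>" by (rule subspace_diff[OF subspace_H10 u v])
  have "mult_form \<Omega> (slope_coeff u v) (u - v)
      = blinfun_inner_right (nemytskii \<Omega> f u - nemytskii \<Omega> f v) o\<^sub>L H10_l2 \<Omega>"
    by (simp add: blinfun_apply_mult_form[OF open_\<Omega> bounded_\<Omega> nemytskii_measurable(3) coeff_bounds(1)]
        nemytskii_diff H10_l2_H10[OF open_\<Omega> bounded_\<Omega> uv] del: l2_of_simps)
  then show ?thesis
    unfolding semilinear_map_eq[OF u] semilinear_map_eq[OF v]
    by (intro blinfun_eqI) (simp add: neg_laplace_def blinfun.bilinear_simps inner_diff)
qed

definition semilinear_deriv :: "'n h1 \<Rightarrow> 'n h1 \<Rightarrow>\<^sub>L 'n h1 \<Rightarrow>\<^sub>L real" where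
  "semilinear_deriv u = Blinfun blinfun_inner_right - mult_form \<Omega> (partial2_coeff u)"

lemma semilinear_deriv_apply:
  "semilinear_deriv u h = neg_laplace h - mult_form \<Omega> (partial2_coeff u) h"
  by (simp add: semilinear_deriv_def blinfun.bilinear_simps neg_laplace_def
      bounded_linear_Blinfun_apply[OF bounded_linear_blinfun_inner_right])

text \<open>The Taylor remainder at \<open>X n\<close> is, up to sign, the form with coefficient
  quotient minus derivative applied to \<open>X n - u\<close>. So the relative error is bounded by
  the norm of a form whose coefficient is bounded and tends to 0 pointwise.\<close>

lemma C1_on_semilinear_map: "C1_on (H10 \<Omega>) (semilinear_map \<Omega> f)"
  unfolding C1_on_def
proof (intro exI[of _ semilinear_deriv] conjI ballI)
  fix u assume u: "u \<in> H10 \<Omega>"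
  show "(semilinear_map \<Omega> f has_derivative blinfun_apply (semilinear_deriv u)) (at u within H10 \<Omega>)"
    unfolding has_derivative_iff_norm tendsto_at_iff_sequentially
  proof (intro conjI allI impI blinfun.bounded_linear_right)
    fix X assume X: "\<forall>i. X i \<in> H10 \<Omega> - {u}" "X \<longlonglongrightarrow> u"
    let ?k = "\<lambda>x t. slope f x t (h1_fun u x) - partial2 f (x, h1_fun u x)"
    have k: "(\<lambda>x. slope_coeff w u x - partial2_coeff u x) = (\<lambda>x. indicator \<Omega> x * ?k x (h1_fun w x))" for w
      by (simp add: slope_coeff_def partial2_coeff_def right_diff_distrib)
    have lim: "(\<lambda>n. norm (mult_form \<Omega> (\<lambda>x. indicator \<Omega> x * ?k x (h1_fun (X n) x)))) \<longlonglongrightarrow> 0"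
    proof (rule mult_form_superposition_tendsto_0[OF open_\<Omega> bounded_\<Omega>, where M = "2 * bnd" and u = u])
      show "(\<lambda>x. indicator \<Omega> x * ?k x (h1_fun w x)) \<in> borel_measurable borel" for w
        unfolding k[symmetric] by measurable
      show "\<bar>?k x t\<bar> \<le> 2 * bnd" if "x \<in> \<Omega>" for x t
        using slope_bounds[OF that, of t "h1_fun u x"] partial2_bounds[OF that, of "h1_fun u x"] by linarith
      show "(\<lambda>n. ?k x (t n)) \<longlonglongrightarrow> 0" if "x \<in> \<Omega>" "t \<longlonglongrightarrow> h1_fun u x" for x and t :: "nat \<Rightarrow> real"
        using slope_tendsto[OF that] by (simp add: LIM_zero_iff)
    qed (use X u in auto)
    show "((\<lambda>y. norm (semilinear_map \<Omega> f y - semilinear_map \<Omega> f u - semilinear_deriv u (y - u)) / norm (y - u)) \<circ> X)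
        \<longlonglongrightarrow> 0"
      unfolding o_def
    proof (rule Lim_null_comparison[OF always_eventually lim], rule allI)
      fix n
      have Xn: "X n \<in> H10 \<Omega>" "X n \<noteq> u" using X by auto
      have "semilinear_map \<Omega> f (X n) - semilinear_map \<Omega> f u - semilinear_deriv u (X n - u)
          = - (mult_form \<Omega> (slope_coeff (X n) u) - mult_form \<Omega> (partial2_coeff u)) (X n - u)"
        unfolding semilinear_map_diff[OF Xn(1) u] semilinear_deriv_apply
        by (simp only: blinfun.diff_left) simp
      also have "mult_form \<Omega> (slope_coeff (X n) u) - mult_form \<Omega> (partial2_coeff u)
          = mult_form \<Omega> (\<lambda>x. indicator \<Omega> x * ?k x (h1_fun (X n) x))"
        unfolding k[symmetric]
        by (rule mult_form_diff[OF open_\<Omega> bounded_\<Omega> nemytskii_measurable(3) coeff_bounds(1) nemytskii_measurable(2) coeff_bounds(2)])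
      finally show "norm (norm (semilinear_map \<Omega> f (X n) - semilinear_map \<Omega> f u - semilinear_deriv u (X n - u))
            / norm (X n - u)) \<le> norm (mult_form \<Omega> (\<lambda>x. indicator \<Omega> x * ?k x (h1_fun (X n) x)))"
        using norm_blinfun[of "mult_form \<Omega> (\<lambda>x. indicator \<Omega> x * ?k x (h1_fun (X n) x))" "X n - u"] Xn(2)
        by (simp only: norm_minus_cancel) (simp add: divide_simps)
    qed
  qed
next
  show "continuous_on (H10 \<Omega>) semilinear_deriv"
    unfolding continuous_on_sequentially
  proof (intro allI impI ballI, elim conjE)
    fix U u assume u: "u \<in> H10 \<Omega>" and U: "\<forall>n. U n \<in> H10 \<Omega>" "U \<longlonglongrightarrow> u"
    let ?k = "\<lambda>x t. partial2 f (x, t) - partial2 f (x, h1_fun u x)"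
    have k: "(\<lambda>x. partial2_coeff w x - partial2_coeff u x) = (\<lambda>x. indicator \<Omega> x * ?k x (h1_fun w x))" for w
      by (simp add: partial2_coeff_def right_diff_distrib)
    have lim: "(\<lambda>n. norm (mult_form \<Omega> (\<lambda>x. indicator \<Omega> x * ?k x (h1_fun (U n) x)))) \<longlonglongrightarrow> 0"
    proof (rule mult_form_superposition_tendsto_0[OF open_\<Omega> bounded_\<Omega>, where M = "2 * bnd" and u = u])
      show "(\<lambda>x. indicator \<Omega> x * ?k x (h1_fun w x)) \<in> borel_measurable borel" for w
        unfolding k[symmetric] by measurable
      show "\<bar>?k x t\<bar> \<le> 2 * bnd" if "x \<in> \<Omega>" for x t
        using partial2_bounds[OF that, of t] partial2_bounds[OF that, of "h1_fun u x"] by linarith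
      show "(\<lambda>n. ?k x (t n)) \<longlonglongrightarrow> 0" if x: "x \<in> \<Omega>" and t: "t \<longlonglongrightarrow> h1_fun u x" for x and t :: "nat \<Rightarrow> real"
      proof -
        have "(\<lambda>n. partial2 f (x, t n)) \<longlonglongrightarrow> partial2 f (x, h1_fun u x)"
          using x by (intro continuous_on_tendsto_compose[OF continuous_on_partial2] tendsto_intros t) auto
        then show ?thesis by (simp add: LIM_zero_iff)
      qed
    qed (use U u in auto)
    have "semilinear_deriv u - semilinear_deriv (U n) = mult_form \<Omega> (\<lambda>x. indicator \<Omega> x * ?k x (h1_fun (U n) x))" for n
      unfolding semilinear_deriv_def k[symmetric]
      by (subst mult_form_diff[OF open_\<Omega> bounded_\<Omega> nemytskii_measurable(2) coeff_bounds(2) nemytskii_measurable(2) coeff_bounds(2), symmetric]) simp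
    then have "(\<lambda>n. norm (semilinear_deriv (U n) - semilinear_deriv u)) \<longlonglongrightarrow> 0"
      using lim by (simp add: norm_minus_commute)
    then show "(semilinear_deriv \<circ> U) \<longlonglongrightarrow> semilinear_deriv u"
      by (simp add: o_def tendsto_norm_zero_iff LIM_zero_iff)
  qed
qed

end

section \<open>The Dirichlet eigenfunctions\<close>

lemma complete_Int_orthogonal_comp:
  fixes S :: "'a::real_inner set"
  assumes "complete S"
  shows "complete (S \<inter> orthogonal_comp V)"
proof (rule complete_closed_subset[OF _ Int_lower1 assms])
  have "orthogonal_comp V = (\<Inter>y\<in>V. {x. y \<bullet> x = 0})"
    by (auto simp: orthogonal_comp_def orthogonal_def)
  moreover have "closed (\<Inter>y\<in>V. {x. y \<bullet> x = 0})"
    by (intro closed_INT ballI closed_Collect_eq continuous_intros)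
  ultimately show "closed (S \<inter> orthogonal_comp V)"
    using complete_imp_closed[OF assms] by (simp add: closed_Int)
qed

text \<open>The orthogonal projection onto the span of a finite orthogonal family. The quotients are
  needed because the eigenfunctions are not normalised.\<close>

definition orth_sum :: "('i \<Rightarrow> 'a::real_inner) \<Rightarrow> 'i set \<Rightarrow> 'a \<Rightarrow> 'a" where
  "orth_sum e N x = (\<Sum>i\<in>N. ((x \<bullet> e i) / (e i \<bullet> e i)) *\<^sub>R e i)"

lemma bounded_linear_orth_sum: "bounded_linear (orth_sum e N)"
  unfolding orth_sum_def[abs_def] divide_inverse
  by (intro bounded_linear_sum bounded_linear_scaleR_left[THEN bounded_linear_compose]
      bounded_linear_mult_left[THEN bounded_linear_compose] bounded_linear_inner_left)

lemma orth_sum_in_span: "orth_sum e N x \<in> span (e ` N)"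
  unfolding orth_sum_def by (intro span_sum span_scale span_base) auto

lemma inner_orth_sum_commute: "orth_sum e N x \<bullet> y = x \<bullet> orth_sum e N y"
  unfolding orth_sum_def by (simp add: inner_sum_left inner_sum_right inner_commute mult.commute)

lemma orth_sum_inner:
  assumes "finite N" "pairwise (\<lambda>i j. orthogonal (e i) (e j)) N" "j \<in> N" "e j \<noteq> 0"
  shows "orth_sum e N x \<bullet> e j = x \<bullet> e j"
proof -
  have "orth_sum e N x \<bullet> e j = (\<Sum>i\<in>N. ((x \<bullet> e i) / (e i \<bullet> e i)) * (e i \<bullet> e j))"
    by (simp add: orth_sum_def inner_sum_left)
  also have "\<dots> = (\<Sum>i\<in>N. if i = j then x \<bullet> e j else 0)"
    using assms(2-4) by (intro sum.cong) (auto simp: pairwise_def orthogonal_def)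
  finally show ?thesis using assms(1,3) by simp
qed

lemma orth_sum_orthogonal:
  assumes "\<And>i. i \<in> N \<Longrightarrow> x \<bullet> e i = 0"
  shows "orth_sum e N x = 0"
  using assms by (simp add: orth_sum_def)

lemma orthogonal_span_image:
  fixes u :: "'a::real_inner"
  assumes "\<And>i. i \<in> N \<Longrightarrow> u \<bullet> e i = 0" "m \<in> span (e ` N)"
  shows "u \<bullet> m = 0"
  using assms orthogonal_to_span[of m "e ` N" u] by (auto simp: orthogonal_def)

lemma quadratic_nonneg_imp_linear_zero:
  fixes c k :: real
  assumes "\<And>t. 0 \<le> 2 * t * c + t\<^sup>2 * k"
  shows "c = 0"
proof (rule ccontr)
  assume "c \<noteq> 0"
  \<comment> \<open>At \<open>t = - s * c\<close> the linear term is \<open>- 2 * s * c^2\<close>,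
    and the quadratic one is at most half as large since \<open>s * k\<close> is at most 1.\<close>
  define s where "s = 1 / (\<bar>k\<bar> + 1)"
  have "0 < \<bar>k\<bar> + 1" "k \<le> \<bar>k\<bar> + 1" by (simp_all add: order_trans[OF abs_ge_self])
  then have "0 < s" "s * k \<le> 1" by (simp_all add: s_def)
  then have s: "0 < s" "s * k < 2" by simp_all
  have "0 \<le> 2 * (- s * c) * c + (- s * c)\<^sup>2 * k" by (rule assms)
  also have "\<dots> = (s * c\<^sup>2) * (s * k - 2)" by (simp add: power2_eq_square algebra_simps)
  also have "\<dots> < 0" using s \<open>c \<noteq> 0\<close> by (intro mult_pos_neg) auto
  finally show False by simp
qed

section \<open>Discreteness of the spectrum and the spectral gaps\<close>

context
  fixes \<Omega> :: "(real^'n::finite) set" and lam :: "nat \<Rightarrow> real" and phi :: "nat \<Rightarrow> 'n h1"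
  assumes open_\<Omega>: "open \<Omega>" and bounded_\<Omega>: "bounded \<Omega>"
    and eigensystem: "dirichlet_eigensystem \<Omega> lam phi"
begin

lemma set_integral_h1_fun:
  assumes u: "u \<in> H10 \<Omega>"
  shows "(LINT x:\<Omega>|lborel. h1_fun u x * h1_fun z x) = l2_of u \<bullet> l2_of z"
proof -
  have [measurable]: "\<Omega> \<in> sets borel" using open_\<Omega> by simp
  have "(LINT x:\<Omega>|lborel. h1_fun u x * h1_fun z x) = (\<integral>x. h1_fun u x * h1_fun z x \<partial>lborel)"
    unfolding set_lebesgue_integral_def
  proof (rule integral_cong_AE)
    show "AE x in lborel. indicator \<Omega> x *\<^sub>R (h1_fun u x * h1_fun z x) = h1_fun u x * h1_fun z x"
      using H10_zero_outside[OF open_\<Omega> u] by eventually_elim (auto simp: indicator_def)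
  qed measurable
  then show ?thesis by (simp add: inner_l2_eq h1_fun_def l2_of_def)
qed

lemma dirichlet_eigenfunction_iff:
  "dirichlet_eigenfunction \<Omega> \<mu> u \<longleftrightarrow>
    u \<in> H10 \<Omega> \<and> u \<noteq> 0 \<and> (\<forall>z\<in>H10 \<Omega>. u \<bullet> z = \<mu> * (l2_of u \<bullet> l2_of z))"
  unfolding dirichlet_eigenfunction_def using set_integral_h1_fun by auto

lemma lam_pos: "0 < lam k"
  and phi_H10: "phi k \<in> H10 \<Omega>"
  and phi_nonzero: "phi k \<noteq> 0"
  and inner_phi: "z \<in> H10 \<Omega> \<Longrightarrow> phi k \<bullet> z = lam k * (l2_of (phi k) \<bullet> l2_of z)"
  using eigensystem dirichlet_eigenfunction_iff by (auto simp: dirichlet_eigensystem_def)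

lemma l2_orthogonal_phi: "i \<noteq> j \<Longrightarrow> l2_of (phi i) \<bullet> l2_of (phi j) = 0"
  using eigensystem set_integral_h1_fun[OF phi_H10, of i "phi j"] by (auto simp: dirichlet_eigensystem_def)

lemma orthogonal_phi: "i \<noteq> j \<Longrightarrow> phi i \<bullet> phi j = 0"
  by (simp add: inner_phi phi_H10 l2_orthogonal_phi)

lemma pairwise_orthogonal_phi: "pairwise (\<lambda>i j. orthogonal (phi i) (phi j)) N"
  by (simp add: pairwise_def orthogonal_def orthogonal_phi)

lemma l2_orthogonal_if_orthogonal_phi: "z \<in> H10 \<Omega> \<Longrightarrow> z \<bullet> phi k = 0 \<Longrightarrow> l2_of z \<bullet> l2_of (phi k) = 0"
  using inner_phi[of z k] lam_pos[of k] by (simp add: inner_commute)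

lemma power2_norm_phi: "(norm (phi k))\<^sup>2 = lam k * (norm (l2_of (phi k)))\<^sup>2"
  by (simp add: power2_norm_eq_inner inner_phi phi_H10)

lemma eigenfunction_in_span: "dirichlet_eigenfunction \<Omega> \<mu> u \<Longrightarrow> u \<in> span (phi ` {k. lam k = \<mu>})"
  using eigensystem by (auto simp: dirichlet_eigensystem_def)

lemma span_phi_subset: "span (phi ` N) \<subseteq> H10 \<Omega>"
  by (intro span_minimal subspace_H10) (auto simp: phi_H10)

text \<open>Eigenfunctions normalised in \<open>H10 \<Omega>\<close> have squared L2 norm
  \<open>1 / lam i\<close>, at least \<open>1 / b\<close>. Being orthogonal in L2, infinitely many
  of them would be uniformly separated, against Rellich's theorem.\<close>

lemma finite_eigenvalues_le: "finite {i. lam i \<le> b}"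
proof (rule ccontr)
  assume "infinite {i. lam i \<le> b}"
  then obtain r :: "nat \<Rightarrow> nat" where r: "strict_mono r" "\<And>n. lam (r n) \<le> b"
    using infinite_enumerate by blast
  have b: "0 < b" using lam_pos[of "r 0"] r(2)[of 0] by linarith
  define e where "e n = (1 / norm (phi (r n))) *\<^sub>R phi (r n)" for n
  have e: "e n \<in> H10 \<Omega>" "norm (e n) \<le> 1" for n
    by (auto simp: e_def phi_H10 subspace_scale[OF subspace_H10])
  obtain i j where ij: "i < j" "dist (l2_of (e i)) (l2_of (e j)) < sqrt (1 / b)"
    using Rellich_pair[OF open_\<Omega> bounded_\<Omega>, of e "sqrt (1 / b)"] e b by auto
  have "l2_of (phi (r i)) \<noteq> 0" using power2_norm_phi[of "r i"] phi_nonzero[of "r i"] by auto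
  then have "(norm (l2_of (e i)))\<^sup>2 = 1 / lam (r i)"
    using power2_norm_phi[of "r i"] lam_pos[of "r i"] phi_nonzero[of "r i"]
    by (simp add: e_def power_divide field_simps)
  moreover have "1 / b \<le> 1 / lam (r i)" using r(2) lam_pos by (intro divide_left_mono) (auto simp: b)
  moreover have "(norm (l2_of (e i) - l2_of (e j)))\<^sup>2 = (norm (l2_of (e i)))\<^sup>2 + (norm (l2_of (e j)))\<^sup>2"
  proof -
    have "r i \<noteq> r j" using strict_mono_less[OF r(1), of i j] ij(1) by simp
    then have "l2_of (e i) \<bullet> l2_of (e j) = 0" by (simp add: e_def l2_orthogonal_phi)
    then show ?thesis by (simp add: power2_norm_eq_inner inner_diff inner_commute)
  qed
  ultimately have "1 / b \<le> (norm (l2_of (e i) - l2_of (e j)))\<^sup>2"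
    using zero_le_power2[of "norm (l2_of (e j))"] by linarith
  then have "sqrt (1 / b) \<le> norm (l2_of (e i) - l2_of (e j))" by (intro real_le_lsqrt) auto
  with ij(2) show False by (simp add: dist_norm)
qed

text \<open>On the \<open>i\<close>-th eigenfunction the right-hand side is
  \<open>a / lam i - 1\<close> times the squared norm. Orthogonality in both inner products lets
  these identities add up.\<close>

lemma spectral_gap_below:
  assumes N: "finite N" "\<And>i. i \<in> N \<Longrightarrow> lam i < a"
  obtains \<delta> where "0 < \<delta>"
    "\<And>x. \<delta> * (norm (orth_sum phi N x))\<^sup>2 \<le> a * (norm (l2_of (orth_sum phi N x)))\<^sup>2 - (norm (orth_sum phi N x))\<^sup>2"
proof -
  \<comment> \<open>The extra element 1 gives the minimum a meaning when no eigenvalue lies below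
    \<open>a\<close>.\<close>
  define \<delta> where "\<delta> = Min (insert 1 ((\<lambda>i. a / lam i - 1) ` N))"
  have pos: "0 < a / lam i - 1" if "i \<in> N" for i
    using N(2)[OF that] lam_pos[of i] by simp
  have \<delta>: "0 < \<delta>" "\<And>i. i \<in> N \<Longrightarrow> \<delta> \<le> a / lam i - 1"
    unfolding \<delta>_def using N(1) pos by (auto intro: Min_le)
  have "\<delta> * (norm (orth_sum phi N x))\<^sup>2 \<le> a * (norm (l2_of (orth_sum phi N x)))\<^sup>2 - (norm (orth_sum phi N x))\<^sup>2" for x
  proof -
    define c where "c i = (x \<bullet> phi i) / (phi i \<bullet> phi i)" for i
    have n1: "(norm (orth_sum phi N x))\<^sup>2 = (\<Sum>i\<in>N. (norm (c i *\<^sub>R phi i))\<^sup>2)"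
      unfolding orth_sum_def c_def[symmetric]
      by (rule norm_sum_Pythagorean[OF N(1)]) (auto simp: pairwise_def orthogonal_def orthogonal_phi)
    have "l2_of (orth_sum phi N x) = (\<Sum>i\<in>N. c i *\<^sub>R l2_of (phi i))"
      unfolding orth_sum_def c_def[symmetric] using N(1) by (induction N rule: finite_induct) auto
    then have n2: "(norm (l2_of (orth_sum phi N x)))\<^sup>2 = (\<Sum>i\<in>N. (norm (c i *\<^sub>R l2_of (phi i)))\<^sup>2)"
      by (simp only:) (rule norm_sum_Pythagorean[OF N(1)],
          auto simp: pairwise_def orthogonal_def l2_orthogonal_phi)
    have "\<delta> * (\<Sum>i\<in>N. (norm (c i *\<^sub>R phi i))\<^sup>2)
        \<le> (\<Sum>i\<in>N. a * (norm (c i *\<^sub>R l2_of (phi i)))\<^sup>2 - (norm (c i *\<^sub>R phi i))\<^sup>2)"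
      unfolding sum_distrib_left
    proof (rule sum_mono)
      fix i assume i: "i \<in> N"
      have "\<delta> * (norm (c i *\<^sub>R phi i))\<^sup>2 \<le> (a / lam i - 1) * (norm (c i *\<^sub>R phi i))\<^sup>2"
        by (intro mult_right_mono \<delta>(2)[OF i]) auto
      also have "\<dots> = a * (norm (c i *\<^sub>R l2_of (phi i)))\<^sup>2 - (norm (c i *\<^sub>R phi i))\<^sup>2"
        using lam_pos[of i] by (simp add: power_mult_distrib power2_norm_phi field_simps)
      finally show "\<delta> * (norm (c i *\<^sub>R phi i))\<^sup>2
          \<le> a * (norm (c i *\<^sub>R l2_of (phi i)))\<^sup>2 - (norm (c i *\<^sub>R phi i))\<^sup>2" .
    qed
    then show ?thesis by (simp only: n1 n2 sum_subtractf sum_distrib_left)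
  qed
  with \<delta>(1) show ?thesis by (rule that)
qed

text \<open>The Rayleigh quotient \<open>\<parallel>u\<parallel>\<^sup>2\<^sub>L\<^sub>2 / \<parallel>u\<parallel>\<^sup>2\<close> attains its supremum \<open>s\<close> on the complement of the
  eigenfunctions up to \<open>b\<close>; a maximiser is an eigenfunction for \<open>1 / s\<close>, so \<open>1 / s > b\<close>.\<close>

lemma spectral_gap_above:
  obtains \<delta> where "0 < \<delta>"
    "\<And>p. p \<in> H10 \<Omega> \<Longrightarrow> (\<And>i. lam i \<le> b \<Longrightarrow> p \<bullet> phi i = 0)
      \<Longrightarrow> \<delta> * (norm p)\<^sup>2 \<le> (norm p)\<^sup>2 - b * (norm (l2_of p))\<^sup>2"
proof (cases "b \<le> 0")
  case True
  show ?thesis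
    by (rule that[of 1]) (use True in \<open>auto simp: mult_nonpos_nonneg\<close>)
next
  case False
  then have b: "0 < b" by simp
  obtain C where C: "0 < C" "\<And>u. u \<in> H10 \<Omega> \<Longrightarrow> norm (l2_of u) \<le> C * norm u"
    using Poincare[OF bounded_\<Omega>] by blast
  define N where "N = {i. lam i \<le> b}"
  define W where "W = H10 \<Omega> \<inter> orthogonal_comp (phi ` N)"
  have W_iff: "p \<in> W \<longleftrightarrow> p \<in> H10 \<Omega> \<and> (\<forall>i. lam i \<le> b \<longrightarrow> p \<bullet> phi i = 0)" for p
    by (auto simp: W_def N_def orthogonal_comp_def orthogonal_def inner_commute)
  have cW: "complete W" unfolding W_def by (rule complete_Int_orthogonal_comp[OF complete_H10[OF bounded_\<Omega>]])
  have sW: "subspace W" unfolding W_def by (intro subspace_inter subspace_H10 subspace_orthogonal_comp)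
  have WH: "W \<subseteq> H10 \<Omega>" by (auto simp: W_def)
  define s where "s = (SUP u\<in>W \<inter> cball 0 1. (norm (l2_of u))\<^sup>2)"
  have bdd: "bdd_above ((\<lambda>u. (norm (l2_of u))\<^sup>2) ` (W \<inter> cball 0 1))"
  proof (rule bdd_aboveI2)
    fix u assume "u \<in> W \<inter> cball 0 1"
    then have "norm (l2_of u) \<le> C"
      using WH C(1) by (auto intro!: order_trans[OF C(2) mult_left_le])
    then show "(norm (l2_of u))\<^sup>2 \<le> C\<^sup>2" by (intro power_mono) auto
  qed
  have ne: "W \<inter> cball 0 1 \<noteq> {}" using subspace_0[OF sW] by force
  have s_upper: "(norm (l2_of u))\<^sup>2 \<le> s" if "u \<in> W" "norm u \<le> 1" for u
    unfolding s_def using that by (intro cSUP_upper bdd) auto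
  have le_s: "(norm (l2_of u))\<^sup>2 \<le> s * (norm u)\<^sup>2" if u: "u \<in> W" for u
  proof (cases "u = 0")
    case False
    have "(norm (l2_of ((1 / norm u) *\<^sub>R u)))\<^sup>2 \<le> s"
      using u False by (intro s_upper) (auto simp: subspace_scale[OF sW])
    then show ?thesis using False by (simp add: power_divide field_simps)
  qed simp
  have "b * s < 1"
  proof (rule ccontr)
    assume "\<not> b * s < 1"
    then have s1: "1 \<le> b * s" by simp
    then have s: "0 < s" using b by (metis less_le_trans zero_less_mult_pos zero_less_one)
    \<comment> \<open>By the choice of \<open>s\<close> this form is nonnegative on
      \<open>W\<close>, and a maximising sequence drives it to 0. A limit is therefore a null vector
      of \<open>A\<close>.\<close>
    define A where "A u z = s * (u \<bullet> z) - l2_of u \<bullet> l2_of z" for u z :: "'n h1"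
    have A_nonneg: "0 \<le> A u u" if "u \<in> W" for u
      using le_s[OF that] by (simp add: A_def power2_norm_eq_inner)
    have "\<exists>u\<in>W \<inter> cball 0 1. s - 1 / real (Suc n) < (norm (l2_of u))\<^sup>2" for n
      using less_cSUP_iff[OF ne bdd, of "s - 1 / real (Suc n)"] unfolding s_def[symmetric] by simp
    then obtain u where u: "\<And>n. u n \<in> W" "\<And>n. norm (u n) \<le> 1"
        "\<And>n. s - 1 / real (Suc n) < (norm (l2_of (u n)))\<^sup>2"
      by (metis IntD1 IntD2 mem_cball_0)
    have "l2_of (u n) \<in> closure (l2_of ` (H10 \<Omega> \<inter> cball 0 1))" for n
      using u(1,2)[of n] WH by (intro closure_subset[THEN subsetD] imageI) auto
    then obtain y r where r: "strict_mono (r :: nat \<Rightarrow> nat)" "((\<lambda>n. l2_of (u n)) \<circ> r) \<longlonglongrightarrow> y"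
      using Rellich[OF open_\<Omega> bounded_\<Omega>] unfolding compact_def by meson
    have A_small: "A (u (r n)) (u (r n)) \<le> 1 / real (Suc n)" for n
    proof -
      have "A (u (r n)) (u (r n)) = s * (norm (u (r n)))\<^sup>2 - (norm (l2_of (u (r n))))\<^sup>2"
        by (simp add: A_def power2_norm_eq_inner)
      also have "\<dots> \<le> s * 1 - (s - 1 / real (Suc (r n)))"
        using u(3)[of "r n"] s u(2)[of "r n"] by (intro diff_mono mult_left_mono) (auto simp: power_le_one)
      also have "\<dots> \<le> 1 / real (Suc n)"
        using seq_suble[OF r(1), of n] by (simp add: divide_left_mono)
      finally show ?thesis .
    qed
    have Cy: "Cauchy (\<lambda>n. l2_of (u (r n)))" using r(2) LIMSEQ_imp_Cauchy by (auto simp: o_def)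
    \<comment> \<open>Parallelogram law for \<open>A\<close> with the nonnegative value at the sum
      dropped. Rellich gives convergence in L2 only; this lifts it to the Dirichlet norm.\<close>
    have diff_bound: "s * (norm (u (r m) - u (r n)))\<^sup>2
        \<le> 2 / real (Suc m) + 2 / real (Suc n) + (norm (l2_of (u (r m)) - l2_of (u (r n))))\<^sup>2" for m n
    proof -
      have "0 \<le> A (u (r m) + u (r n)) (u (r m) + u (r n))" by (intro A_nonneg subspace_add[OF sW] u(1))
      then have "A (u (r m) - u (r n)) (u (r m) - u (r n))
          \<le> 2 * A (u (r m)) (u (r m)) + 2 * A (u (r n)) (u (r n))"
        by (simp add: A_def inner_diff inner_add inner_commute algebra_simps)
      also have "\<dots> \<le> 2 / real (Suc m) + 2 / real (Suc n)" using A_small[of m] A_small[of n] by simp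
      finally show ?thesis by (simp add: A_def power2_norm_eq_inner)
    qed
    have "Cauchy (\<lambda>n. u (r n))"
    proof (rule metric_CauchyI)
      fix e :: real assume e: "0 < e"
      define d where "d = sqrt (s * e\<^sup>2 / 4)"
      have d: "0 < d" "d\<^sup>2 = s * e\<^sup>2 / 4" using e s by (auto simp: d_def)
      obtain N1 where N1: "\<And>m n. m \<ge> N1 \<Longrightarrow> n \<ge> N1 \<Longrightarrow> dist (l2_of (u (r m))) (l2_of (u (r n))) < d"
        using metric_CauchyD[OF Cy d(1)] by blast
      obtain N2 where N2: "8 / (s * e\<^sup>2) < real N2" using reals_Archimedean2 by blast
      have small: "2 / real (Suc m) < s * e\<^sup>2 / 4" if "m \<ge> N2" for m
      proof -
        have "8 / (s * e\<^sup>2) < real (Suc m)" using N2 that by simp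
        then show ?thesis using e s by (simp add: field_simps)
      qed
      show "\<exists>M. \<forall>m\<ge>M. \<forall>n\<ge>M. dist (u (r m)) (u (r n)) < e"
      proof (intro exI[of _ "max N1 N2"] allI impI)
        fix m n assume mn: "max N1 N2 \<le> m" "max N1 N2 \<le> n"
        have "(norm (l2_of (u (r m)) - l2_of (u (r n))))\<^sup>2 \<le> d\<^sup>2"
          using N1[of m n] mn by (intro power_mono) (auto simp: dist_norm)
        then have "s * (norm (u (r m) - u (r n)))\<^sup>2 < s * e\<^sup>2"
        proof -
          have "2 / real (Suc m) < s * e\<^sup>2 / 4" "2 / real (Suc n) < s * e\<^sup>2 / 4"
            using mn by (simp_all only: small max.bounded_iff)
          moreover have "0 < s * e\<^sup>2" using s e by simp
          moreover note diff_bound[of m n] \<open>(norm (l2_of (u (r m)) - l2_of (u (r n))))\<^sup>2 \<le> d\<^sup>2\<close> d(2)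
          ultimately show ?thesis by linarith
        qed
        then have "(norm (u (r m) - u (r n)))\<^sup>2 < e\<^sup>2" using s by simp
        then show "dist (u (r m)) (u (r n)) < e"
          unfolding dist_norm using e by (auto intro: power2_less_imp_less)
      qed
    qed
    then obtain w where w: "w \<in> W" "(\<lambda>n. u (r n)) \<longlonglongrightarrow> w"
      using cW u(1) unfolding complete_def by meson
    have wH: "w \<in> H10 \<Omega>" using w(1) WH by blast
    have lw: "(\<lambda>n. l2_of (u (r n))) \<longlonglongrightarrow> l2_of w"
      by (rule tendsto_l2_of[OF open_\<Omega> bounded_\<Omega> _ wH w(2)]) (use u(1) WH in blast)
    have "(\<lambda>n. A (u (r n)) (u (r n))) \<longlonglongrightarrow> A w w"
      unfolding A_def by (intro tendsto_intros w(2) lw)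
    then have "A w w \<le> 0"
      using A_small LIMSEQ_Suc[OF lim_1_over_n] by (intro LIMSEQ_le[where X = "\<lambda>n. A (u (r n)) (u (r n))" and Y = "\<lambda>n. 1 / real (Suc n)"]) auto
    then have Aw: "A w w = 0" using A_nonneg[OF w(1)] by simp
    have "(\<lambda>n. (norm (l2_of (u (r n))))\<^sup>2) \<longlonglongrightarrow> (norm (l2_of w))\<^sup>2"
      by (intro tendsto_intros lw)
    moreover have "(\<lambda>n. s - 1 / real (Suc n)) \<longlonglongrightarrow> s - 0"
      by (intro tendsto_intros LIMSEQ_Suc[OF lim_1_over_n])
    moreover have "s - 1 / real (Suc n) \<le> (norm (l2_of (u (r n))))\<^sup>2" for n
    proof -
      have "1 / real (Suc (r n)) \<le> 1 / real (Suc n)"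
        using seq_suble[OF r(1), of n] by (simp add: divide_left_mono)
      with u(3)[of "r n"] show ?thesis by linarith
    qed
    ultimately have "s \<le> (norm (l2_of w))\<^sup>2"
      by (intro LIMSEQ_le[where X = "\<lambda>n. s - 1 / real (Suc n)" and Y = "\<lambda>n. (norm (l2_of (u (r n))))\<^sup>2"]) auto
    then have w0: "w \<noteq> 0" using s by auto
    \<comment> \<open>\<open>A\<close> attains its minimum 0 on \<open>W\<close> at
      \<open>w\<close>, so its first variation vanishes in every direction of
      \<open>W\<close>.\<close>
    have AW: "A w z = 0" if z: "z \<in> W" for z
    proof (rule quadratic_nonneg_imp_linear_zero[where k = "A z z"])
      fix t
      have "0 \<le> A (w + t *\<^sub>R z) (w + t *\<^sub>R z)"
        by (intro A_nonneg subspace_add[OF sW] subspace_scale[OF sW] w(1) z)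
      also have "\<dots> = A w w + 2 * t * A w z + t\<^sup>2 * A z z"
        by (simp add: A_def inner_add inner_commute algebra_simps power2_eq_square)
      finally show "0 \<le> 2 * t * A w z + t\<^sup>2 * A z z" by (simp add: Aw)
    qed
    have wphi: "w \<bullet> phi i = 0" if "lam i \<le> b" for i using w(1) that W_iff by blast
    \<comment> \<open>To leave \<open>W\<close>, remove from \<open>z\<close> its part along the
      eigenfunctions up to \<open>b\<close>. There \<open>A w\<close> vanishes because
      \<open>w\<close> is orthogonal to them in both inner products.\<close>
    have "A w z = 0" if z: "z \<in> H10 \<Omega>" for z
    proof -
      let ?m = "orth_sum phi N z"
      have fN: "finite N" unfolding N_def by (rule finite_eigenvalues_le)
      have mH: "?m \<in> H10 \<Omega>" using orth_sum_in_span span_phi_subset by blast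
      have "z - ?m \<in> W"
        using orth_sum_inner[OF fN pairwise_orthogonal_phi _ phi_nonzero, of _ z]
        by (auto simp: W_iff N_def inner_diff_left intro!: subspace_diff[OF subspace_H10 z mH[unfolded N_def]])
      then have "A w (z - ?m) = 0" by (rule AW)
      moreover have "A w ?m = 0"
      proof -
        have "l2_of ?m = (\<Sum>i\<in>N. ((z \<bullet> phi i) / (phi i \<bullet> phi i)) *\<^sub>R l2_of (phi i))"
          unfolding orth_sum_def using fN by (induction N rule: finite_induct) auto
        moreover have "l2_of w \<bullet> l2_of (phi i) = 0" if "i \<in> N" for i
          using that wphi l2_orthogonal_if_orthogonal_phi[OF wH] by (simp add: N_def)
        ultimately have "l2_of w \<bullet> l2_of ?m = 0" by (simp add: inner_sum_right)
        moreover have "w \<bullet> ?m = 0"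
          using wphi by (intro orthogonal_span_image[OF _ orth_sum_in_span]) (auto simp: N_def)
        ultimately show ?thesis by (simp add: A_def)
      qed
      ultimately show ?thesis by (simp add: A_def inner_diff algebra_simps)
    qed
    then have "dirichlet_eigenfunction \<Omega> (1 / s) w"
      using s wH w0 by (auto simp: dirichlet_eigenfunction_iff A_def field_simps)
    \<comment> \<open>Exhaustiveness of the list enters here: the new eigenfunction lies in the span
      of listed ones with eigenvalue at most \<open>b\<close>, to all of which it is
      orthogonal.\<close>
    then have span: "w \<in> span (phi ` {k. lam k = 1 / s})" by (rule eigenfunction_in_span)
    have "1 / s \<le> b" using s1 s by (simp add: field_simps)
    then have "w \<bullet> phi i = 0" if "i \<in> {k. lam k = 1 / s}" for i using that by (intro wphi) simp
    then have "w \<bullet> w = 0" by (rule orthogonal_span_image[OF _ span])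
    with w0 show False by simp
  qed
  show ?thesis
  proof (rule that[of "1 - b * s"])
    show "0 < 1 - b * s" using \<open>b * s < 1\<close> by simp
    fix p assume "p \<in> H10 \<Omega>" "\<And>i. lam i \<le> b \<Longrightarrow> p \<bullet> phi i = 0"
    then have "(norm (l2_of p))\<^sup>2 \<le> s * (norm p)\<^sup>2" by (intro le_s) (auto simp: W_iff)
    from mult_left_mono[OF this, of b] b
    show "(1 - b * s) * (norm p)\<^sup>2 \<le> (norm p)\<^sup>2 - b * (norm (l2_of p))\<^sup>2"
      by (simp add: algebra_simps)
  qed
qed

end

section \<open>Flatness\<close>

lemma orth_sum_idem:
  assumes "finite N" "pairwise (\<lambda>i j. orthogonal (e i) (e j)) N" "\<And>i. e i \<noteq> 0"
  shows "orth_sum e N (orth_sum e N x) = orth_sum e N x"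
proof -
  have "orth_sum e N (orth_sum e N x) = (\<Sum>i\<in>N. ((orth_sum e N x \<bullet> e i) / (e i \<bullet> e i)) *\<^sub>R e i)"
    by (rule orth_sum_def)
  also have "\<dots> = (\<Sum>i\<in>N. ((x \<bullet> e i) / (e i \<bullet> e i)) *\<^sub>R e i)"
    by (intro sum.cong) (simp_all add: orth_sum_inner[OF assms(1,2) _ assms(3)])
  finally show ?thesis by (simp only: orth_sum_def)
qed

section \<open>Riesz' isometry between \<open>X\<close> and \<open>Y\<close>\<close>

context
  fixes \<Omega> :: "(real^'n::finite) set"
  assumes open_\<Omega>: "open \<Omega>" and bounded_\<Omega>: "bounded \<Omega>"
begin

lemma riesz_on_neg_laplace: "r \<in> H10 \<Omega> \<Longrightarrow> riesz_on (H10 \<Omega>) (neg_laplace r) = r"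
  by (rule riesz_on_unique[OF H10_complete_subspace[OF open_\<Omega> bounded_\<Omega>]]) (auto simp: neg_laplace_def)

lemma riesz_on_H10: "riesz_on (H10 \<Omega>) g \<in> H10 \<Omega>"
  by (rule riesz_on(1)[OF H10_complete_subspace[OF open_\<Omega> bounded_\<Omega>]])

lemma neg_laplace_riesz_on:
  assumes "g \<in> Hm1 \<Omega>"
  shows "neg_laplace (riesz_on (H10 \<Omega>) g) = g"
proof -
  have "functional \<Omega> (blinfun_apply g) = g"
    by (rule functional_eqI[OF open_\<Omega> bounded_\<Omega> assms]) simp
  moreover have "functional \<Omega> (blinfun_apply g) = neg_laplace (riesz_on (H10 \<Omega>) g)"
    by (rule functional_eqI[OF open_\<Omega> bounded_\<Omega> neg_laplace_in_Hm1[OF riesz_on_H10]])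
      (simp add: neg_laplace_def riesz_on(2)[OF H10_complete_subspace[OF open_\<Omega> bounded_\<Omega>]])
  ultimately show ?thesis by simp
qed

lemma inner_Hm1_neg_laplace:
  assumes "r \<in> H10 \<Omega>" "s \<in> H10 \<Omega>"
  shows "inner_Hm1 \<Omega> (neg_laplace r) (neg_laplace s) = r \<bullet> s"
proof -
  have "inj_on neg_laplace (H10 \<Omega>)" by (rule inj_on_inverseI) (rule riesz_on_neg_laplace)
  then show ?thesis using assms by (simp add: inner_Hm1_def)
qed

end

section \<open>The decomposition of \<open>Y\<close> as the image of that of
  \<open>X\<close>\<close>

context
  fixes \<Omega> :: "(real^'n::finite) set" and f :: "(real^'n) \<times> real \<Rightarrow> real" and a b :: real
    and lam :: "nat \<Rightarrow> real" and phi :: "nat \<Rightarrow> 'n h1"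
  assumes open_\<Omega>: "open \<Omega>" and bounded_\<Omega>: "bounded \<Omega>" and appropriate: "appropriate \<Omega> f"
    and partial2_range: "\<forall>x\<in>\<Omega>. \<forall>t. a \<le> partial2 f (x, t) \<and> partial2 f (x, t) \<le> b"
    and eigensystem: "dirichlet_eigensystem \<Omega> lam phi" and ab: "a \<le> b"
begin

lemmas phi_facts = lam_pos[OF open_\<Omega> bounded_\<Omega> eigensystem] phi_H10[OF open_\<Omega> bounded_\<Omega> eigensystem]
  phi_nonzero[OF open_\<Omega> bounded_\<Omega> eigensystem] orthogonal_phi[OF open_\<Omega> bounded_\<Omega> eigensystem]
lemmas pairwise_phi = pairwise_orthogonal_phi[OF open_\<Omega> bounded_\<Omega> eigensystem]
lemmas H10_cs = H10_complete_subspace[OF open_\<Omega> bounded_\<Omega>]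

abbreviation (input) W where "W \<equiv> W_X \<Omega> lam phi {a..b}"
abbreviation (input) V where "V \<equiv> V_X lam phi {a..b}"

lemma W_X_iff: "w \<in> W \<longleftrightarrow> w \<in> H10 \<Omega> \<and> (\<forall>i. lam i \<in> {a..b} \<longrightarrow> w \<bullet> phi i = 0)"
proof
  assume "w \<in> W"
  moreover have "phi i \<in> V" if "lam i \<in> {a..b}" for i
    unfolding V_X_def using that by (intro span_base) auto
  ultimately show "w \<in> H10 \<Omega> \<and> (\<forall>i. lam i \<in> {a..b} \<longrightarrow> w \<bullet> phi i = 0)"
    by (simp add: W_X_def orthogonal_comp_def orthogonal_def inner_commute[of w])
next
  assume w: "w \<in> H10 \<Omega> \<and> (\<forall>i. lam i \<in> {a..b} \<longrightarrow> w \<bullet> phi i = 0)"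
  have "w \<bullet> y = 0" if y: "y \<in> V" for y
  proof (rule orthogonal_span_image[OF _ y[unfolded V_X_def]])
    show "w \<bullet> phi i = 0" if "i \<in> {i. lam i \<in> {a..b}}" for i using w that by simp
  qed
  with w show "w \<in> W" by (auto simp: W_X_def orthogonal_comp_def orthogonal_def inner_commute)
qed

lemma complete_W_X: "complete W"
  unfolding W_X_def by (rule complete_Int_orthogonal_comp[OF H10_cs(1)])

lemma subspace_W_X: "subspace W"
  unfolding W_X_def by (intro subspace_inter subspace_H10 subspace_orthogonal_comp)

lemma V_X_subset: "V \<subseteq> H10 \<Omega>"
  unfolding V_X_def by (rule span_phi_subset[OF open_\<Omega> bounded_\<Omega> eigensystem])

lemma linear_neg_laplace: "linear (neg_laplace :: 'n h1 \<Rightarrow> _)"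
  unfolding neg_laplace_def[abs_def]
  by (rule bounded_linear.linear[OF bounded_linear_blinfun_inner_right])

text \<open>The weak eigenvalue equation divided by \<open>lam i\<close>. The positive factors do
  not affect spans, so \<open>-\<Delta>\<close> carries the decomposition of \<open>X\<close> to
  that of \<open>Y\<close>.\<close>

lemma l2_functional_phi: "l2_functional \<Omega> (h1_fun (phi i)) = neg_laplace ((1 / lam i) *\<^sub>R phi i)"
  unfolding l2_functional_def
proof (rule functional_eqI[OF open_\<Omega> bounded_\<Omega>])
  show "neg_laplace ((1 / lam i) *\<^sub>R phi i) \<in> Hm1 \<Omega>"
    by (intro neg_laplace_in_Hm1 subspace_scale[OF subspace_H10] phi_facts)
  show "neg_laplace ((1 / lam i) *\<^sub>R phi i) z = (LINT x:\<Omega>|lborel. h1_fun (phi i) x * h1_fun z x)"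
    if "z \<in> H10 \<Omega>" for z
    using inner_phi[OF open_\<Omega> bounded_\<Omega> eigensystem that, of i] phi_facts(1)[of i]
    by (simp add: neg_laplace_def set_integral_h1_fun[OF open_\<Omega> bounded_\<Omega> eigensystem phi_facts(2)])
qed

lemma V_Y_eq: "V_Y \<Omega> lam phi {a..b} = neg_laplace ` V"
proof -
  let ?I = "{i. lam i \<in> {a..b}}" and ?e = "\<lambda>i. (1 / lam i) *\<^sub>R phi i"
  have "span (?e ` ?I) = V"
  proof
    show "span (?e ` ?I) \<subseteq> V"
      unfolding V_X_def
    proof (intro span_minimal subspace_span image_subsetI)
      show "?e i \<in> span (phi ` ?I)" if "i \<in> ?I" for i
        using that by (intro span_scale span_base imageI)
    qed
    have "phi i \<in> span (?e ` ?I)" if "i \<in> ?I" for i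
    proof -
      have "lam i *\<^sub>R ?e i \<in> span (?e ` ?I)" using that by (intro span_scale span_base) auto
      then show ?thesis using phi_facts(1)[of i] by simp
    qed
    then show "V \<subseteq> span (?e ` ?I)"
      unfolding V_X_def by (intro span_minimal subspace_span) auto
  qed
  moreover have "V_Y \<Omega> lam phi {a..b} = span (neg_laplace ` ?e ` ?I)"
    by (simp only: V_Y_def l2_functional_phi image_image)
  ultimately show ?thesis by (simp only: linear_span_image[OF linear_neg_laplace])
qed

lemma W_Y_eq: "W_Y \<Omega> lam phi {a..b} = neg_laplace ` W"
proof -
  have iff: "neg_laplace r \<in> W_Y \<Omega> lam phi {a..b} \<longleftrightarrow> r \<in> W" if r: "r \<in> H10 \<Omega>" for r
  proof -
    have "neg_laplace r \<in> W_Y \<Omega> lam phi {a..b} \<longleftrightarrow> (\<forall>v\<in>V. r \<bullet> v = 0)"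
      by (simp add: W_Y_def V_Y_eq neg_laplace_in_Hm1[OF r]
          inner_Hm1_neg_laplace[OF open_\<Omega> bounded_\<Omega> r subsetD[OF V_X_subset]] cong: ball_cong)
    then show ?thesis using r by (auto simp: W_X_def orthogonal_comp_def orthogonal_def inner_commute)
  qed
  show ?thesis
  proof
    show "W_Y \<Omega> lam phi {a..b} \<subseteq> neg_laplace ` W"
    proof
      fix g assume g: "g \<in> W_Y \<Omega> lam phi {a..b}"
      then have eq: "neg_laplace (riesz_on (H10 \<Omega>) g) = g"
        by (intro neg_laplace_riesz_on[OF open_\<Omega> bounded_\<Omega>]) (simp add: W_Y_def)
      with g iff[OF riesz_on_H10[OF open_\<Omega> bounded_\<Omega>], of g] show "g \<in> neg_laplace ` W"
        by (intro image_eqI[of _ _ "riesz_on (H10 \<Omega>) g"]) auto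
    qed
    show "neg_laplace ` W \<subseteq> W_Y \<Omega> lam phi {a..b}" using iff by (auto simp: W_X_iff)
  qed
qed

lemma proj_Hm1_eq:
  assumes g: "g \<in> Hm1 \<Omega>"
  shows "proj_Hm1 \<Omega> (W_Y \<Omega> lam phi {a..b}) g = neg_laplace (orth_proj W (riesz_on (H10 \<Omega>) g))"
proof -
  let ?r = "riesz_on (H10 \<Omega>) g" and ?p = "orth_proj W (riesz_on (H10 \<Omega>) g)"
  have r: "?r \<in> H10 \<Omega>" by (rule riesz_on_H10[OF open_\<Omega> bounded_\<Omega>])
  have gr: "g = neg_laplace ?r" by (rule neg_laplace_riesz_on[OF open_\<Omega> bounded_\<Omega> g, symmetric])
  have WH: "w \<in> H10 \<Omega>" if "w \<in> W" for w using that by (simp add: W_X_iff)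
  have diff: "inner_Hm1 \<Omega> (g - neg_laplace h) (neg_laplace w) = (?r - h) \<bullet> w" if "h \<in> W" "w \<in> W" for h w
  proof -
    have "g - neg_laplace h = neg_laplace (?r - h)"
      by (subst gr) (simp add: linear_diff[OF linear_neg_laplace])
    then show ?thesis
      using that r by (simp add: inner_Hm1_neg_laplace[OF open_\<Omega> bounded_\<Omega>] WH subspace_diff[OF subspace_H10])
  qed
  have p: "?p \<in> W" by (rule orth_proj(1)[OF complete_W_X subspace_W_X])
  show ?thesis
    unfolding proj_Hm1_def W_Y_eq
  proof (rule the_equality)
    show "neg_laplace ?p \<in> neg_laplace ` W \<and>
        (\<forall>w\<in>neg_laplace ` W. inner_Hm1 \<Omega> (g - neg_laplace ?p) w = 0)"
      using p orth_proj(2)[OF complete_W_X subspace_W_X, of _ ?r] by (auto simp: diff inner_diff)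
    fix h assume "h \<in> neg_laplace ` W \<and> (\<forall>w\<in>neg_laplace ` W. inner_Hm1 \<Omega> (g - h) w = 0)"
    then obtain h' where h': "h' \<in> W" "h = neg_laplace h'" "\<And>w. w \<in> W \<Longrightarrow> (?r - h') \<bullet> w = 0"
      using diff by auto
    have "?p = h'"
      using h' by (intro orth_proj_unique[OF complete_W_X subspace_W_X]) (auto simp: inner_diff)
    then show "h = neg_laplace ?p" by (simp add: h')
  qed
qed

section \<open>The reflection and coercivity\<close>

abbreviation (input) N where "N \<equiv> {i. lam i < a}"

lemma finite_N: "finite N"
  by (rule finite_subset[OF _ finite_eigenvalues_le[OF open_\<Omega> bounded_\<Omega> eigensystem, of b]]) (use ab in auto)

text \<open>The reflection that changes the sign on the eigenfunctions below \<open>a\<close>: after it, the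
  indefinite form of the projected linearisation becomes coercive.\<close>

definition reflect :: "'n h1 \<Rightarrow> 'n h1" where
  "reflect x = x - 2 *\<^sub>R orth_sum phi N x"

lemma bounded_linear_reflect: "bounded_linear reflect"
  unfolding reflect_def[abs_def]
  by (intro bounded_linear_sub bounded_linear_ident
      bounded_linear_compose[OF bounded_linear_scaleR_right bounded_linear_orth_sum])

lemma inner_reflect_commute: "reflect x \<bullet> y = x \<bullet> reflect y"
  by (simp add: reflect_def inner_diff inner_orth_sum_commute)

lemma reflect_reflect: "reflect (reflect x) = x"
proof -
  interpret Q: bounded_linear "orth_sum phi N" by (rule bounded_linear_orth_sum)
  show ?thesis
    by (simp add: reflect_def Q.diff Q.scaleR orth_sum_idem[OF finite_N pairwise_phi phi_facts(3)] Q.add scaleR_2 algebra_simps)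
qed

lemma orth_sum_inner_above: "a \<le> lam i \<Longrightarrow> orth_sum phi N x \<bullet> phi i = 0"
  unfolding inner_orth_sum_commute
  by (subst orth_sum_orthogonal) (auto intro!: phi_facts(4))

lemma orth_sum_H10: "orth_sum phi N x \<in> H10 \<Omega>"
  using orth_sum_in_span span_phi_subset[OF open_\<Omega> bounded_\<Omega> eigensystem] by blast

lemma reflect_W_X: "w \<in> W \<Longrightarrow> reflect w \<in> W"
  by (auto simp: W_X_iff reflect_def inner_diff orth_sum_inner_above
      intro!: subspace_diff[OF subspace_H10] subspace_scale[OF subspace_H10] orth_sum_H10)

text \<open>The coefficient lies between \<open>a\<close> and \<open>b\<close> on \<Omega> only, but
  \<open>p\<close> vanishes almost everywhere else.\<close>

lemma mult_l2_inner_bounds: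
  assumes q: "q \<in> borel_measurable borel" "\<And>x. \<bar>q x\<bar> \<le> M" and ab: "\<And>x. x \<in> \<Omega> \<Longrightarrow> a \<le> q x \<and> q x \<le> b"
    and p: "p \<in> H10 \<Omega>"
  shows "mult_l2 q (l2_of p) \<bullet> l2_of p \<le> b * (norm (l2_of p))\<^sup>2"
    and "a * (norm (l2_of p))\<^sup>2 \<le> mult_l2 q (l2_of p) \<bullet> l2_of p"
proof -
  let ?p = "rep_l2 (l2_of p)"
  have int: "integrable lborel (\<lambda>x. c * (norm (?p x))\<^sup>2)" for c
    using sq_integrable_rep_l2[of "l2_of p"] by (simp add: sq_integrable_def)
  have norm: "c * (norm (l2_of p))\<^sup>2 = (\<integral>x. c * (norm (?p x))\<^sup>2 \<partial>lborel)" for c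
    by (simp add: power2_norm_l2(1))
  have AE: "AE x in lborel. a * (norm (?p x))\<^sup>2 \<le> q x * ?p x * ?p x \<and> q x * ?p x * ?p x \<le> b * (norm (?p x))\<^sup>2"
    using H10_zero_outside[OF open_\<Omega> p]
  proof eventually_elim
    case (elim x)
    show ?case
    proof (cases "x \<in> \<Omega>")
      case True
      from ab[OF this] show ?thesis
        using mult_right_mono[of a "q x" "?p x * ?p x"] mult_right_mono[of "q x" b "?p x * ?p x"]
        by (simp add: power2_eq_square mult.assoc)
    next
      case False
      with elim show ?thesis by (simp add: h1_fun_def l2_of_def)
    qed
  qed
  show "mult_l2 q (l2_of p) \<bullet> l2_of p \<le> b * (norm (l2_of p))\<^sup>2"
    unfolding inner_mult_l2[OF q] norm
    by (rule integral_mono_AE[OF integrable_mult_l2[OF q] int]) (use AE in eventually_elim, blast)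
  show "a * (norm (l2_of p))\<^sup>2 \<le> mult_l2 q (l2_of p) \<bullet> l2_of p"
    unfolding inner_mult_l2[OF q] norm
    by (rule integral_mono_AE[OF int integrable_mult_l2[OF q]]) (use AE in eventually_elim, blast)
qed

text \<open>\<delta> is fixed before \<open>q\<close>: monotonicity uses a different coefficient for
  each pair of points and needs one constant for all.\<close>

lemma reflected_form_coercive:
  obtains \<delta> where "0 < \<delta>"
    "\<And>q M w. q \<in> borel_measurable borel \<Longrightarrow> \<forall>x. \<bar>q x\<bar> \<le> M \<Longrightarrow> \<forall>x\<in>\<Omega>. a \<le> q x \<and> q x \<le> b \<Longrightarrow>
      w \<in> W \<Longrightarrow> \<delta> * (norm w)\<^sup>2 \<le> w \<bullet> reflect w - mult_form \<Omega> q w (reflect w)"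
proof -
  obtain \<delta>1 where \<delta>1: "0 < \<delta>1" "\<And>x. \<delta>1 * (norm (orth_sum phi N x))\<^sup>2
      \<le> a * (norm (l2_of (orth_sum phi N x)))\<^sup>2 - (norm (orth_sum phi N x))\<^sup>2"
    using spectral_gap_below[OF open_\<Omega> bounded_\<Omega> eigensystem finite_N, of a] by blast
  obtain \<delta>2 where \<delta>2: "0 < \<delta>2" "\<And>p. p \<in> H10 \<Omega> \<Longrightarrow> (\<And>i. lam i \<le> b \<Longrightarrow> p \<bullet> phi i = 0)
      \<Longrightarrow> \<delta>2 * (norm p)\<^sup>2 \<le> (norm p)\<^sup>2 - b * (norm (l2_of p))\<^sup>2"
    using spectral_gap_above[OF open_\<Omega> bounded_\<Omega> eigensystem, of b] by blast
  show ?thesis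
  proof (rule that[of "min \<delta>1 \<delta>2"])
    show "0 < min \<delta>1 \<delta>2" using \<delta>1 \<delta>2 by simp
    fix q M w
    assume "q \<in> borel_measurable borel" "\<forall>x. \<bar>q x\<bar> \<le> M" "\<forall>x\<in>\<Omega>. a \<le> q x \<and> q x \<le> b"
      and w: "w \<in> W"
    then have q: "q \<in> borel_measurable borel" "\<And>x. \<bar>q x\<bar> \<le> M" "\<And>x. x \<in> \<Omega> \<Longrightarrow> a \<le> q x \<and> q x \<le> b"
      by blast+
    define m where "m = orth_sum phi N w"
    define p where "p = w - m"
    have wH: "w \<in> H10 \<Omega>" using w by (simp add: W_X_iff)
    have mH: "m \<in> H10 \<Omega>" unfolding m_def by (rule orth_sum_H10)
    have pH: "p \<in> H10 \<Omega>" unfolding p_def by (rule subspace_diff[OF subspace_H10 wH mH])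
    \<comment> \<open>Eigenvalues below \<open>a\<close> are removed by the subtraction of
      \<open>m\<close>. Those in the interval are excluded by \<open>w \<in> W\<close>, and
      \<open>m\<close> is orthogonal to their eigenfunctions.\<close>
    have p_phi: "p \<bullet> phi i = 0" if "lam i \<le> b" for i
    proof (cases "lam i < a")
      case True
      then show ?thesis
        using orth_sum_inner[OF finite_N pairwise_phi _ phi_facts(3), of i w] by (simp add: p_def m_def inner_diff)
    next
      case False
      then show ?thesis using w that orth_sum_inner_above[of i w] by (simp add: p_def m_def inner_diff W_X_iff)
    qed
    have pm: "p \<bullet> m = 0"
      unfolding m_def using ab by (intro orthogonal_span_image[OF p_phi orth_sum_in_span]) auto
    have w_eq: "w = p + m" and r_eq: "reflect w = p - m"
      by (simp_all add: p_def m_def reflect_def scaleR_2)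
    interpret q: bounded_linear "mult_l2 q" by (rule bounded_linear_mult_l2[OF q(1,2)])
    \<comment> \<open>Symmetry cancels the cross terms between \<open>p\<close> and
      \<open>m\<close>, so the upper bound \<open>b\<close> is used on \<open>p\<close> alone and
      the lower bound \<open>a\<close> on \<open>m\<close> alone.\<close>
    have sym: "mult_l2 q U \<bullet> U' = mult_l2 q U' \<bullet> U" for U U'
      by (simp add: inner_mult_l2[OF q(1,2)] mult.assoc mult.commute[of "rep_l2 U _"])
    have "mult_form \<Omega> q w (reflect w) = mult_l2 q (l2_of w) \<bullet> l2_of (reflect w)"
      by (simp add: mult_form_apply[OF open_\<Omega> bounded_\<Omega> q(1,2)] H10_l2_H10[OF open_\<Omega> bounded_\<Omega>] wH r_eq
          subspace_diff[OF subspace_H10 pH mH] del: l2_of_simps)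
    also have "\<dots> = mult_l2 q (l2_of p) \<bullet> l2_of p - mult_l2 q (l2_of m) \<bullet> l2_of m"
      using sym[of "l2_of p" "l2_of m"] by (simp add: w_eq r_eq[unfolded w_eq] q.add inner_add inner_diff)
    also have "\<dots> \<le> b * (norm (l2_of p))\<^sup>2 - a * (norm (l2_of m))\<^sup>2"
      by (intro diff_mono mult_l2_inner_bounds[OF q] pH mH)
    finally have form: "mult_form \<Omega> q w (reflect w) \<le> b * (norm (l2_of p))\<^sup>2 - a * (norm (l2_of m))\<^sup>2" .
    have "w \<bullet> reflect w = (norm p)\<^sup>2 - (norm m)\<^sup>2"
      using pm by (simp add: r_eq[unfolded w_eq] w_eq inner_add inner_diff inner_commute power2_norm_eq_inner)
    moreover have "min \<delta>1 \<delta>2 * (norm w)\<^sup>2 = min \<delta>1 \<delta>2 * (norm p)\<^sup>2 + min \<delta>1 \<delta>2 * (norm m)\<^sup>2"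
      using pm by (simp add: w_eq inner_add inner_commute power2_norm_eq_inner flip: distrib_left)
    moreover have "min \<delta>1 \<delta>2 * (norm m)\<^sup>2 \<le> a * (norm (l2_of m))\<^sup>2 - (norm m)\<^sup>2"
      unfolding m_def by (intro order_trans[OF mult_right_mono \<delta>1(2)]) auto
    moreover have "min \<delta>1 \<delta>2 * (norm p)\<^sup>2 \<le> (norm p)\<^sup>2 - b * (norm (l2_of p))\<^sup>2"
      by (intro order_trans[OF mult_right_mono \<delta>2(2)] pH p_phi) auto
    ultimately show "min \<delta>1 \<delta>2 * (norm w)\<^sup>2 \<le> w \<bullet> reflect w - mult_form \<Omega> q w (reflect w)"
      using form by linarith
  qed
qed

lemma norm_mult_form_le:
  assumes q: "q \<in> borel_measurable borel" "\<And>x. \<bar>q x\<bar> \<le> M"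
  shows "norm (mult_form \<Omega> q h) \<le> M * (norm (H10_l2 \<Omega>))\<^sup>2 * norm h"
proof (rule norm_blinfun_bound)
  have M: "0 \<le> M" using q(2)[of undefined] by linarith
  then show "0 \<le> M * (norm (H10_l2 \<Omega>))\<^sup>2 * norm h" by simp
  fix z
  have "norm (mult_form \<Omega> q h z) \<le> norm (mult_l2 q (H10_l2 \<Omega> h)) * norm (H10_l2 \<Omega> z)"
    by (simp add: mult_form_apply[OF open_\<Omega> bounded_\<Omega> q] Cauchy_Schwarz_ineq2)
  also have "\<dots> \<le> (M * norm (H10_l2 \<Omega> h)) * norm (H10_l2 \<Omega> z)"
    by (intro mult_right_mono norm_mult_l2_le[OF q]) auto
  also have "\<dots> \<le> (M * (norm (H10_l2 \<Omega>) * norm h)) * (norm (H10_l2 \<Omega>) * norm z)"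
    using M by (intro mult_mono mult_left_mono norm_blinfun) auto
  finally show "norm (mult_form \<Omega> q h z) \<le> M * (norm (H10_l2 \<Omega>))\<^sup>2 * norm h * norm z"
    by (simp add: power2_eq_square mult_ac)
qed

text \<open>\<open>B\<close> is the projected restriction read in \<open>W\<close> and reflected, so
  the monotone theorem applies to it. Since the reflection is its own inverse,
  \<open>L o\<^sub>L J\<close> undoes this and returns the map into \<open>W_Y\<close>.\<close>

lemma semilinear_map_flat:
  "flat \<Omega> (semilinear_map \<Omega> f) V W (W_Y \<Omega> lam phi {a..b})"
  unfolding flat_def
proof (intro conjI ballI)
  let ?F = "semilinear_map \<Omega> f"
  note F_facts = semilinear_map_in_Hm1[OF open_\<Omega> bounded_\<Omega> appropriate partial2_range]
    C1_on_semilinear_map[OF open_\<Omega> bounded_\<Omega> appropriate partial2_range]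
    semilinear_map_diff[OF open_\<Omega> bounded_\<Omega> appropriate partial2_range]
  show "?F ` H10 \<Omega> \<subseteq> Hm1 \<Omega>" using F_facts(1) by blast
  show C1F: "C1_on (H10 \<Omega>) ?F" by (rule F_facts(2))
  fix v assume "v \<in> V"
  then have vH: "v \<in> H10 \<Omega>" using V_X_subset by blast
  have WH: "w \<in> H10 \<Omega>" if "w \<in> W" for w using that by (simp add: W_X_iff)
  have wv: "w + v \<in> H10 \<Omega>" if "w \<in> W" for w by (rule subspace_add[OF subspace_H10 WH[OF that] vH])
  define R where "R = Blinfun (riesz_on (H10 \<Omega>))"
  define P where "P = Blinfun (orth_proj W)"
  define J where "J = Blinfun reflect"
  define L where "L = Blinfun (neg_laplace :: 'n h1 \<Rightarrow> _)"
  have R: "blinfun_apply R = riesz_on (H10 \<Omega>)"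
    unfolding R_def by (rule bounded_linear_Blinfun_apply[OF bounded_linear_riesz_on[OF H10_cs]])
  have P: "blinfun_apply P = orth_proj W"
    unfolding P_def by (rule bounded_linear_Blinfun_apply[OF bounded_linear_orth_proj[OF complete_W_X subspace_W_X]])
  have J: "blinfun_apply J = reflect"
    unfolding J_def by (rule bounded_linear_Blinfun_apply[OF bounded_linear_reflect])
  have L: "blinfun_apply L = neg_laplace"
    unfolding L_def
    by (rule bounded_linear_Blinfun_apply) (simp add: neg_laplace_def[abs_def] bounded_linear_blinfun_inner_right)
  define A where "A = J o\<^sub>L P o\<^sub>L R"
  have A: "A g = reflect (orth_proj W (riesz_on (H10 \<Omega>) g))" for g by (simp add: A_def J P R)
  have AW: "A g \<in> W" for g
    unfolding A by (intro reflect_W_X orth_proj(1)[OF complete_W_X subspace_W_X])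
  \<comment> \<open>The symmetric reflection moves onto the test vector, so the monotonicity pairing
    of \<open>B\<close> is the functional evaluated at the reflected difference.\<close>
  have A_inner: "A g \<bullet> d = g (reflect d)" if d: "d \<in> W" for g d
    unfolding A inner_reflect_commute
    using orth_proj(2)[OF complete_W_X subspace_W_X reflect_W_X[OF d]] riesz_on(2)[OF H10_cs WH[OF reflect_W_X[OF d]]]
    by simp
  define B where "B w = A (?F (w + v))" for w
  let ?q = "\<lambda>x y. slope_coeff \<Omega> f (x + v) (y + v)"
  note q = nemytskii_measurable(3)[OF open_\<Omega> bounded_\<Omega> appropriate partial2_range]
    coeff_bounds(1)[OF open_\<Omega> bounded_\<Omega> appropriate partial2_range]
  have qb: "a \<le> slope_coeff \<Omega> f x y z \<and> slope_coeff \<Omega> f x y z \<le> b" if "z \<in> \<Omega>" for x y z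
    using slope_bounds[OF open_\<Omega> bounded_\<Omega> appropriate partial2_range that] that
    by (simp add: slope_coeff_def[OF open_\<Omega> bounded_\<Omega> appropriate partial2_range])
  have F_diff: "?F (x + v) - ?F (y + v) = neg_laplace (x - y) - mult_form \<Omega> (?q x y) (x - y)"
    if "x \<in> W" "y \<in> W" for x y
    using F_facts(3)[OF wv[OF that(1)] wv[OF that(2)]] by simp
  obtain \<delta> where \<delta>: "0 < \<delta>"
    "\<And>q M w. q \<in> borel_measurable borel \<Longrightarrow> \<forall>x. \<bar>q x\<bar> \<le> M \<Longrightarrow> \<forall>x\<in>\<Omega>. a \<le> q x \<and> q x \<le> b \<Longrightarrow>
      w \<in> W \<Longrightarrow> \<delta> * (norm w)\<^sup>2 \<le> w \<bullet> reflect w - mult_form \<Omega> q w (reflect w)"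
    using reflected_form_coercive by blast
  define K where "K = 1 + max \<bar>a\<bar> \<bar>b\<bar> * (norm (H10_l2 \<Omega>))\<^sup>2"
  have "C1_diffeomorphism W W B"
  proof (rule strongly_monotone_C1_diffeomorphism[OF complete_W_X subspace_W_X _ \<delta>(1), where M = "norm A * K"])
    show "B x \<in> W" for x unfolding B_def by (rule AW)
    fix x y assume xy: "x \<in> W" "y \<in> W"
    have d: "x - y \<in> W" by (rule subspace_diff[OF subspace_W_X xy])
    have "(B x - B y) \<bullet> (x - y) = (x - y) \<bullet> reflect (x - y) - mult_form \<Omega> (?q x y) (x - y) (reflect (x - y))"
      unfolding B_def blinfun.diff_right[symmetric] A_inner[OF d] F_diff[OF xy]
      by (simp add: blinfun.diff_left neg_laplace_def)
    moreover have "\<forall>z. \<bar>?q x y z\<bar> \<le> max \<bar>a\<bar> \<bar>b\<bar>" "\<forall>z\<in>\<Omega>. a \<le> ?q x y z \<and> ?q x y z \<le> b"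
      using q(2) qb by blast+
    ultimately show "\<delta> * (norm (x - y))\<^sup>2 \<le> (B x - B y) \<bullet> (x - y)"
      using \<delta>(2)[OF q(1) _ _ d] by (simp only:)
    have "norm (B x - B y) \<le> norm A * norm (?F (x + v) - ?F (y + v))"
      unfolding B_def blinfun.diff_right[symmetric] by (rule norm_blinfun)
    also have "norm (?F (x + v) - ?F (y + v)) \<le> K * norm (x - y)"
    proof -
      have "norm (neg_laplace (x - y)) \<le> norm (x - y)"
        unfolding neg_laplace_def by (intro norm_blinfun_bound) (auto simp: Cauchy_Schwarz_ineq2)
      then show ?thesis
        unfolding F_diff[OF xy] using norm_mult_form_le[OF q, of "x + v" "y + v" "x - y"]
        by (intro order_trans[OF norm_triangle_ineq4]) (simp add: K_def distrib_right)
    qed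
    finally show "norm (B x - B y) \<le> norm A * K * norm (x - y)" by (simp add: mult_left_mono mult.assoc)
  next
    show "C1_on W B"
      unfolding B_def
      using C1_on_blinfun_compose[OF C1_on_precompose_linear[OF C1F, of W id_blinfun v], of A] wv by simp
  qed
  moreover have "(J o\<^sub>L R) ((L o\<^sub>L J) w) = w" if "w \<in> W" for w
    using that by (simp add: J R L riesz_on_neg_laplace[OF open_\<Omega> bounded_\<Omega>] WH reflect_W_X reflect_reflect)
  ultimately have "C1_diffeomorphism W ((L o\<^sub>L J) ` W) (\<lambda>w. (L o\<^sub>L J) (B w))"
    by (rule C1_diffeomorphism_compose_linear)
  moreover have "(L o\<^sub>L J) ` W = W_Y \<Omega> lam phi {a..b}"
  proof -
    have "reflect ` W = W"
      using reflect_W_X reflect_reflect by (metis (no_types, lifting) image_eqI image_subset_iff subsetI subset_antisym)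
    then show ?thesis by (simp add: W_Y_eq L J image_image[symmetric] image_comp[symmetric] o_def)
  qed
  moreover have "(L o\<^sub>L J) (B w) = proj_Hm1 \<Omega> (W_Y \<Omega> lam phi {a..b}) (?F (w + v))" if "w \<in> W" for w
    by (simp add: proj_Hm1_eq[OF F_facts(1)[OF wv[OF that]]] B_def A L J reflect_reflect)
  ultimately show "C1_diffeomorphism W (W_Y \<Omega> lam phi {a..b})
      (\<lambda>w. proj_Hm1 \<Omega> (W_Y \<Omega> lam phi {a..b}) (?F (w + v)))"
    using C1_diffeomorphism_cong by fastforce
qed

end

theorem theorem1:
  fixes \<Omega> :: "(real^'n::finite) set" and f :: "(real^'n) \<times> real \<Rightarrow> real" and a b :: real
    and lam :: "nat \<Rightarrow> real" and phi :: "nat \<Rightarrow> 'n h1"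
  assumes "open \<Omega>" and "bounded \<Omega>" and "connected \<Omega>" and "lipschitz_boundary \<Omega>"
    and "appropriate \<Omega> f"
    and "closure (partial2 f ` (\<Omega> \<times> UNIV)) \<subseteq> {a..b}"
    and "dirichlet_eigensystem \<Omega> lam phi"
  shows "flat \<Omega> (semilinear_map \<Omega> f) (V_X lam phi {a..b})
           (W_X \<Omega> lam phi {a..b}) (W_Y \<Omega> lam phi {a..b})"
proof -
  have bounds: "\<forall>x\<in>\<Omega>. \<forall>t. a \<le> partial2 f (x, t) \<and> partial2 f (x, t) \<le> b"
    using assms(6) closure_subset[of "partial2 f ` (\<Omega> \<times> UNIV)"] by fastforce
  \<comment> \<open>A point of \<Omega> is required for \<open>a \<le> b\<close>. If there were
    none, \<open>phi 0\<close> would vanish almost everywhere, and its eigenvalue equation would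
    give it norm 0.\<close>
  have "\<Omega> \<noteq> {}"
  proof
    assume "\<Omega> = {}"
    note phi = phi_H10[OF assms(1,2,7), of 0] inner_phi[OF assms(1,2,7), of _ 0] phi_nonzero[OF assms(1,2,7), of 0]
    have "AE x in lborel. rep_l2 (l2_of (phi 0)) x = 0"
      using H10_zero_outside[OF assms(1) phi(1)] \<open>\<Omega> = {}\<close> by (simp add: h1_fun_def l2_of_def)
    then have "norm (l2_of (phi 0)) = 0"
      using power2_norm_l2(1)[of "l2_of (phi 0)"] by (simp add: integral_eq_zero_AE)
    then have "phi 0 \<bullet> phi 0 = 0" using phi(2)[OF phi(1)] by simp
    with phi(3) show False by simp
  qed
  then have "a \<le> b" using bounds by fastforce
  then show ?thesis by (rule semilinear_map_flat[OF assms(1,2,5) bounds assms(7)])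
qed

end
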